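(* Let $W_n$ be the Weyl group of type $B_n$, with roots $\pm\epsilon_i\pm\epsilon_j$ ($i\ne j$, long, parameter $k_l$) and $\pm\epsilon_i$ (short, parameter $k_s$), standard form $B(\epsilon_i,\epsilon_j)=\delta_{ij}$, and let $\Omega_{W_n}=\frac14\sum_{\alpha,\beta>0}k_\alpha k_\beta B(\alpha,\beta)s_\alpha s_\beta\in\mathbb C[W_n]$. Then: (a) $$\Omega_{W_n}=\frac14\big(2n(n-1)k_l^2+nk_s^2\big)+\frac14k_l^2e_{A_2}+\frac12k_lk_se_{B_2},$$ where $e_{A_2}$ and $e_{B_2}$ are the sums of the $W_n$-conjugates of the Coxeter elements of type $A_2$ and $B_2$, respectively. (b) Let $\lambda$ be a partition of $a$ and $\mu$ a partition of $b$ with $a+b=n$. The scalar by which $\Omega_{W_n}$ acts in the irreducible representation of $W_n$ labeled by $(\lambda,\mu)$ is $$\frac14\big(2n(n-1)k_l^2+nk_s^2\big)+2k_l^2\big(\sigma_\lambda(e_{(123)})+\sigma_\mu(e_{(123)})\big)+k_lk_s\big(\sigma_\lambda(e_{(12)})-\sigma_\mu(e_{(12)})\big).$$ Moreover, $\sigma_\lambda(e_{(123)})=-\frac{a(a-1)}2+\Sigma_2(\lambda)$, $\sigma_\lambda(e_{(12)})=\Sigma_1(\lambda)$, and similarly for $\mu$ (with $b$ in place of $a$).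
   Context: Positive roots: $\epsilon_i\pm\epsilon_j$ ($i<j$) and $\epsilon_i$; $k_\alpha=k_l$ or $k_s$ according to the length of $\alpha$; $s_\alpha$ is the reflection in $\alpha$. $e_{A_2}$ is the sum of the elements of the conjugacy class of $s_{\epsilon_1-\epsilon_2}s_{\epsilon_2-\epsilon_3}$, and $e_{B_2}$ that of $s_{\epsilon_1}s_{\epsilon_1-\epsilon_2}$. For a partition $\lambda$ of $a$, $\sigma_\lambda$ is the corresponding irreducible representation of $S_a$; $e_{(123)}$ and $e_{(12)}$ are the sums of all $3$-cycles, resp. all transpositions, in the relevant symmetric group, and $\sigma_\lambda(e)$ denotes the scalar by which the central element $e$ acts in $\sigma_\lambda$. $\Sigma_k(\lambda)$ is the sum of the $k$-th powers of the contents (column index minus row index) of the boxes of $\lambda$, viewed as a left-justified decreasing Young diagram. The irreducible $W_n$-representations are labeled by pairs $(\lambda,\mu)$: the character is $\chi_{(\lambda,\mu)}=\operatorname{Ind}_{W_a\times W_b}^{W_n}(\chi_{(\lambda,0)}\otimes\chi_{(0,\mu)})$, where $\chi_{(\lambda,0)}$ is $\sigma_\lambda$ inflated to $W_a$ so that the short reflections act by the identity, and $\chi_{(0,\mu)}$ is $\sigma_\mu$ inflated to $W_b$ so that the short reflections act by minus the identity.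
   Formalization: In (b) the coefficient of σ_λ(e_(123))+σ_μ(e_(123)) is corrected from 2k_l² to k_l²; the printed value fails for n=3, λ=(3), μ=∅, k_l=1, k_s=0, where Ω acts by 5 and not 7. *)

theory Defs
  imports
    "Jordan_Normal_Form.VS_Connect"
    "HOL-Algebra.Generated_Groups"
    "HOL-Combinatorics.Cycles"
    "HOL-Library.Indicator_Function"
begin

hide_const (open) Multiset.mult Polynomial.order

section \<open>Group algebras and matrix representations\<close>

text \<open>Elements of the group algebra of a finite group \<open>G\<close> are complex functions on
  \<open>carrier G\<close>, extended by \<open>0\<close>; the function \<open>indicator C\<close> is the sum of the elements of \<open>C\<close>,
  and \<open>indicator {g}\<close> is the basis element \<open>g\<close>.\<close>

definition group_algebra :: "('g, 'x) monoid_scheme \<Rightarrow> ('g \<Rightarrow> complex) set" where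
  "group_algebra G = {f. \<forall>x. x \<notin> carrier G \<longrightarrow> f x = 0}"

definition convolution ::
    "('g, 'x) monoid_scheme \<Rightarrow> ('g \<Rightarrow> complex) \<Rightarrow> ('g \<Rightarrow> complex) \<Rightarrow> 'g \<Rightarrow> complex" where
  "convolution G f h x =
     (if x \<in> carrier G then \<Sum>y\<in>carrier G. f y * h (inv\<^bsub>G\<^esub> y \<otimes>\<^bsub>G\<^esub> x) else 0)"

definition conj_class :: "('g, 'x) monoid_scheme \<Rightarrow> 'g \<Rightarrow> 'g set" where
  "conj_class G x = {g \<otimes>\<^bsub>G\<^esub> x \<otimes>\<^bsub>G\<^esub> inv\<^bsub>G\<^esub> g | g. g \<in> carrier G}"

definition matrix_rep :: "('g, 'x) monoid_scheme \<Rightarrow> nat \<Rightarrow> ('g \<Rightarrow> complex mat) \<Rightarrow> bool" where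
  "matrix_rep G d \<rho> \<longleftrightarrow>
     \<rho> \<in> hom G (ring_mat TYPE(complex) d ()) \<and> \<rho> \<one>\<^bsub>G\<^esub> = 1\<^sub>m d"

definition irreducible_rep :: "('g, 'x) monoid_scheme \<Rightarrow> nat \<Rightarrow> ('g \<Rightarrow> complex mat) \<Rightarrow> bool" where
  "irreducible_rep G d \<rho> \<longleftrightarrow> matrix_rep G d \<rho> \<and> 0 < d \<and>
     (\<forall>U. VectorSpace.subspace class_ring U (module_vec TYPE(complex) d) \<longrightarrow>
        (\<forall>g\<in>carrier G. \<forall>u\<in>U. \<rho> g *\<^sub>v u \<in> U) \<longrightarrow>
        U = {0\<^sub>v d} \<or> U = carrier_vec d)"

definition mat_trace :: "complex mat \<Rightarrow> complex" where
  "mat_trace A = (\<Sum>i<dim_row A. A $$ (i, i))"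

definition algebra_action ::
    "('g, 'x) monoid_scheme \<Rightarrow> nat \<Rightarrow> ('g \<Rightarrow> complex mat) \<Rightarrow> ('g \<Rightarrow> complex) \<Rightarrow> complex mat" where
  "algebra_action G d \<rho> f = mat d d (\<lambda>(i, j). \<Sum>g\<in>carrier G. f g * \<rho> g $$ (i, j))"

definition acts_by_scalar ::
    "('g, 'x) monoid_scheme \<Rightarrow> nat \<Rightarrow> ('g \<Rightarrow> complex mat) \<Rightarrow> ('g \<Rightarrow> complex) \<Rightarrow> complex \<Rightarrow> bool" where
  "acts_by_scalar G d \<rho> f c \<longleftrightarrow> algebra_action G d \<rho> f = c \<cdot>\<^sub>m 1\<^sub>m d"

text \<open>Character induced along an injective homomorphism \<open>\<iota>\<close> from \<open>H\<close> to \<open>G\<close>, by Frobenius'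
  formula. The inner sum has at most one term.\<close>

definition induced_char ::
    "('g, 'x) monoid_scheme \<Rightarrow> ('h, 'y) monoid_scheme \<Rightarrow> ('h \<Rightarrow> 'g) \<Rightarrow> ('h \<Rightarrow> complex) \<Rightarrow> 'g \<Rightarrow> complex"
  where
  "induced_char G H \<iota> \<chi> g = (1 / of_nat (order H)) *
     (\<Sum>x\<in>carrier G. \<Sum>h | h \<in> carrier H \<and> \<iota> h = inv\<^bsub>G\<^esub> x \<otimes>\<^bsub>G\<^esub> g \<otimes>\<^bsub>G\<^esub> x. \<chi> h)"


section \<open>Symmetric groups and their irreducible representations\<close>

text \<open>The symmetric group of a finite set \<open>A\<close> of naturals; for \<open>A = {1..n}\<close> this is
  \<open>sym_group n\<close> of HOL-Algebra. Arbitrary \<open>A\<close> is used so that the two factors of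
  \<open>W\<^sub>a \<times> W\<^sub>b\<close> can live on the coordinates \<open>1..a\<close> and \<open>a+1..a+b\<close>.\<close>

definition perm_group_on :: "nat set \<Rightarrow> (nat \<Rightarrow> nat) monoid" where
  "perm_group_on A = \<lparr>carrier = {p. p permutes A}, mult = (\<circ>), one = id\<rparr>"

definition k_cycles :: "nat set \<Rightarrow> nat \<Rightarrow> (nat \<Rightarrow> nat) set" where
  "k_cycles A k = {cycle_of_list cs | cs. distinct cs \<and> length cs = k \<and> set cs \<subseteq> A}"

definition is_partition :: "nat list \<Rightarrow> nat \<Rightarrow> bool" where
  "is_partition lam m \<longleftrightarrow> sorted_wrt (\<ge>) lam \<and> 0 \<notin> set lam \<and> sum_list lam = m"

text \<open>Boxes are pairs (row index, column index), counted from \<open>0\<close>.\<close>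

definition diagram :: "nat list \<Rightarrow> (nat \<times> nat) set" where
  "diagram lam = {(r, c). r < length lam \<and> c < lam ! r}"

definition box_content :: "nat \<times> nat \<Rightarrow> int" where
  "box_content x = int (snd x) - int (fst x)"

definition content_sum :: "nat \<Rightarrow> nat list \<Rightarrow> complex" where
  "content_sum k lam = (\<Sum>x\<in>diagram lam. of_int (box_content x) ^ k)"

definition row_stabilizer ::
    "nat set \<Rightarrow> nat list \<Rightarrow> (nat \<times> nat \<Rightarrow> nat) \<Rightarrow> (nat \<Rightarrow> nat) set" where
  "row_stabilizer A lam T =
     {p. p permutes A \<and> (\<forall>x\<in>diagram lam. \<exists>y\<in>diagram lam. fst y = fst x \<and> p (T x) = T y)}"

definition column_stabilizer ::
    "nat set \<Rightarrow> nat list \<Rightarrow> (nat \<times> nat \<Rightarrow> nat) \<Rightarrow> (nat \<Rightarrow> nat) set" where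
  "column_stabilizer A lam T =
     {p. p permutes A \<and> (\<forall>x\<in>diagram lam. \<exists>y\<in>diagram lam. snd y = snd x \<and> p (T x) = T y)}"

definition young_symmetrizer ::
    "nat set \<Rightarrow> nat list \<Rightarrow> (nat \<times> nat \<Rightarrow> nat) \<Rightarrow> (nat \<Rightarrow> nat) \<Rightarrow> complex" where
  "young_symmetrizer A lam T =
     convolution (perm_group_on A)
       (indicator (row_stabilizer A lam T))
       (\<lambda>q. of_int (sign q) * indicator (column_stabilizer A lam T) q)"

text \<open>The left ideal of the group algebra of \<open>perm_group_on A\<close> generated by the Young symmetrizer of the
  tableau \<open>T\<close>: the irreducible representation labelled by \<open>lam\<close>, in the convention in which a
  single row gives the trivial representation.\<close>

definition specht_ideal ::
    "nat set \<Rightarrow> nat list \<Rightarrow> (nat \<times> nat \<Rightarrow> nat) \<Rightarrow> ((nat \<Rightarrow> nat) \<Rightarrow> complex) set" where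
  "specht_ideal A lam T =
     {convolution (perm_group_on A) f (young_symmetrizer A lam T) | f. f \<in> group_algebra (perm_group_on A)}"

text \<open>\<open>specht_rep A lam d \<sigma>\<close>: the matrix representation \<open>\<sigma>\<close> of \<open>perm_group_on A\<close> is isomorphic (via \<open>\<phi>\<close>)
  to the left ideal of some tableau \<open>T\<close> of shape \<open>lam\<close> with entries in \<open>A\<close>.\<close>

definition specht_rep ::
    "nat set \<Rightarrow> nat list \<Rightarrow> nat \<Rightarrow> ((nat \<Rightarrow> nat) \<Rightarrow> complex mat) \<Rightarrow> bool" where
  "specht_rep A lam d \<sigma> \<longleftrightarrow> matrix_rep (perm_group_on A) d \<sigma> \<and>
     (\<exists>T \<phi>. bij_betw T (diagram lam) A \<and>
        bij_betw \<phi> (carrier_vec d) (specht_ideal A lam T) \<and>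
        (\<forall>u\<in>carrier_vec d. \<forall>v\<in>carrier_vec d. \<phi> (u + v) = (\<lambda>x. \<phi> u x + \<phi> v x)) \<and>
        (\<forall>c. \<forall>v\<in>carrier_vec d. \<phi> (c \<cdot>\<^sub>v v) = (\<lambda>x. c * \<phi> v x)) \<and>
        (\<forall>g\<in>carrier (perm_group_on A). \<forall>v\<in>carrier_vec d.
           \<phi> (\<sigma> g *\<^sub>v v) = convolution (perm_group_on A) (indicator {g}) (\<phi> v)))"


section \<open>The Weyl group of type B\<close>

text \<open>Vectors indexed by a finite set \<open>I\<close> are functions \<open>nat \<Rightarrow> real\<close>. The form only sees the
  coordinates in \<open>I\<close>, all roots vanish outside \<open>I\<close>, and the reflections leave the coordinates
  outside \<open>I\<close> unchanged. So, for \<open>A \<subseteq> I\<close>, the group of \<open>A\<close> is a subgroup of the group of \<open>I\<close>.\<close>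

definition eps :: "nat \<Rightarrow> nat \<Rightarrow> real" where
  "eps i = (\<lambda>l. if l = i then 1 else 0)"

definition bform :: "nat set \<Rightarrow> (nat \<Rightarrow> real) \<Rightarrow> (nat \<Rightarrow> real) \<Rightarrow> real" where
  "bform I u v = (\<Sum>i\<in>I. u i * v i)"

definition pos_roots :: "nat set \<Rightarrow> (nat \<Rightarrow> real) set" where
  "pos_roots I =
     {\<lambda>l. eps i l + eps j l | i j. i \<in> I \<and> j \<in> I \<and> i < j} \<union>
     {\<lambda>l. eps i l - eps j l | i j. i \<in> I \<and> j \<in> I \<and> i < j} \<union>
     {eps i | i. i \<in> I}"

definition roots :: "nat set \<Rightarrow> (nat \<Rightarrow> real) set" where
  "roots I = pos_roots I \<union> {\<lambda>l. - \<alpha> l | \<alpha>. \<alpha> \<in> pos_roots I}"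

definition reflection :: "nat set \<Rightarrow> (nat \<Rightarrow> real) \<Rightarrow> (nat \<Rightarrow> real) \<Rightarrow> (nat \<Rightarrow> real)" where
  "reflection I \<alpha> v = (\<lambda>l. v l - 2 * bform I v \<alpha> / bform I \<alpha> \<alpha> * \<alpha> l)"

definition weyl_B :: "nat set \<Rightarrow> ((nat \<Rightarrow> real) \<Rightarrow> (nat \<Rightarrow> real)) monoid" where
  "weyl_B I = subgroup_generated \<lparr>carrier = {f. bij f}, mult = (\<circ>), one = id\<rparr>
     (reflection I ` roots I)"

text \<open>Long roots have square length \<open>2\<close>, short roots \<open>1\<close>.\<close>

definition root_param :: "nat set \<Rightarrow> complex \<Rightarrow> complex \<Rightarrow> (nat \<Rightarrow> real) \<Rightarrow> complex" where
  "root_param I kl ks \<alpha> = (if bform I \<alpha> \<alpha> = 2 then kl else ks)"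

definition Omega :: "nat \<Rightarrow> complex \<Rightarrow> complex \<Rightarrow> ((nat \<Rightarrow> real) \<Rightarrow> (nat \<Rightarrow> real)) \<Rightarrow> complex" where
  "Omega n kl ks w = (1 / 4) *
     (\<Sum>\<alpha>\<in>pos_roots {1..n}. \<Sum>\<beta>\<in>pos_roots {1..n}.
        root_param {1..n} kl ks \<alpha> * root_param {1..n} kl ks \<beta> *
        of_real (bform {1..n} \<alpha> \<beta>) *
        indicator {reflection {1..n} \<alpha> \<circ> reflection {1..n} \<beta>} w)"

text \<open>For \<open>n < 3\<close> (resp. \<open>n < 2\<close>) there is no parabolic subsystem of type \<open>A\<^sub>2\<close> (resp. \<open>B\<^sub>2\<close>), and
  the class sum is empty.\<close>

definition e_A2 :: "nat \<Rightarrow> ((nat \<Rightarrow> real) \<Rightarrow> (nat \<Rightarrow> real)) \<Rightarrow> complex" where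
  "e_A2 n = indicator
     (if 3 \<le> n then conj_class (weyl_B {1..n})
        (reflection {1..n} (\<lambda>l. eps 1 l - eps 2 l) \<circ> reflection {1..n} (\<lambda>l. eps 2 l - eps 3 l))
      else {})"

definition e_B2 :: "nat \<Rightarrow> ((nat \<Rightarrow> real) \<Rightarrow> (nat \<Rightarrow> real)) \<Rightarrow> complex" where
  "e_B2 n = indicator
     (if 2 \<le> n then conj_class (weyl_B {1..n})
        (reflection {1..n} (eps 1) \<circ> reflection {1..n} (\<lambda>l. eps 1 l - eps 2 l))
      else {})"

text \<open>Elements of \<open>weyl_B I\<close> are signed permutations. The map \<open>unsigned_perm\<close> is the projection of
  \<open>weyl_B I\<close> onto \<open>perm_group_on I\<close> whose kernel is generated by the short reflections; \<open>sign_changes w\<close>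
  is the number of \<open>i\<close> that \<open>w\<close> sends to a negative basis vector, which is \<open>1\<close> for short reflections
  and whose parity is a homomorphism. With \<open>\<eta> = 1\<close> (resp. \<open>\<eta> = -1\<close>), \<open>inflate \<eta> \<sigma>\<close> is the
  representation extending \<open>\<sigma>\<close> in which the short reflections act by \<open>1\<close> (resp. \<open>-1\<close>).\<close>

definition unsigned_perm :: "((nat \<Rightarrow> real) \<Rightarrow> (nat \<Rightarrow> real)) \<Rightarrow> nat \<Rightarrow> nat" where
  "unsigned_perm w i = (THE j. w (eps i) = eps j \<or> w (eps i) = (\<lambda>l. - eps j l))"

definition sign_changes :: "((nat \<Rightarrow> real) \<Rightarrow> (nat \<Rightarrow> real)) \<Rightarrow> nat" where
  "sign_changes w = card {i. \<exists>j. w (eps i) = (\<lambda>l. - eps j l)}"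

definition inflate ::
    "complex \<Rightarrow> ((nat \<Rightarrow> nat) \<Rightarrow> complex mat) \<Rightarrow> ((nat \<Rightarrow> real) \<Rightarrow> (nat \<Rightarrow> real)) \<Rightarrow> complex mat" where
  "inflate \<eta> \<sigma> w = \<eta> ^ sign_changes w \<cdot>\<^sub>m \<sigma> (unsigned_perm w)"

text \<open>The character of \<open>W\<^sub>a\<^sub>+\<^sub>b\<close> induced from \<open>W\<^sub>a \<times> W\<^sub>b\<close>, where \<open>W\<^sub>a\<close> acts on the first \<open>a\<close> and
  \<open>W\<^sub>b\<close> on the last \<open>b\<close> coordinates; \<open>\<sigma>\<close> and \<open>\<tau>\<close> are representations of the symmetric groups of
  these two sets of coordinates.\<close>

definition bipartition_char ::
    "nat \<Rightarrow> nat \<Rightarrow> ((nat \<Rightarrow> nat) \<Rightarrow> complex mat) \<Rightarrow> ((nat \<Rightarrow> nat) \<Rightarrow> complex mat) \<Rightarrow>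
     ((nat \<Rightarrow> real) \<Rightarrow> (nat \<Rightarrow> real)) \<Rightarrow> complex" where
  "bipartition_char a b \<sigma> \<tau> =
     induced_char (weyl_B {1..a + b}) (weyl_B {1..a} \<times>\<times> weyl_B {a + 1..a + b})
       (\<lambda>(u, v). u \<circ> v)
       (\<lambda>(u, v). mat_trace (inflate 1 \<sigma> u) * mat_trace (inflate (- 1) \<tau> v))"

text \<open>Normalisation: a 3-cycle in the symmetric group has four lifts in the class summed in
  \<open>e_A2\<close>, so \<open>e_A2\<close> acts on the representation labelled by \<open>(\<lambda>, \<mu>)\<close> by four times the sum of the
  scalars of the 3-cycle sums on \<open>\<lambda>\<close> and \<open>\<mu>\<close>. The coefficient of that sum in the scalar of
  \<open>Omega\<close> is therefore \<open>kl\<^sup>2\<close>. (The coefficient \<open>2 kl\<^sup>2\<close> found in the source is inconsistent with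
  its own definitions: in the trivial representation for \<open>n = 3\<close>, \<open>kl = 1\<close>, \<open>ks = 0\<close>, the scalar
  is a quarter of the square length of the sum \<open>(4, 2, 0)\<close> of the long positive roots, that
  is \<open>5 = 3 + 2\<close>, and not \<open>3 + 2 * 2\<close>.)\<close>

end

(*
  (a) Omega is a quarter of the sum over l of the squares of sum_alpha k_alpha alpha_l s_alpha,
  alpha_l being the coordinates of alpha. In the expanded square, a product of a short and a long
  reflection survives only for the long root eps_l + eps_j, which gives the B2-rotations. A
  rotation w of an A2-plane is a product of two reflections in three ways, and the inner products
  of the three pairs of positive roots add up to 1, so w has coefficient k_l^2 / 4.

  (b) Let c = a b be the Young symmetrizer of a tableau. For every g in S_A the element a g b is
  c(g) c: either two entries of one column move into one row, and both sides vanish, or g is the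
  product of a row and a column permutation. Hence a class sum acts on the Specht module by the sum
  of c(g) over the class. For transpositions this is the number of pairs in a row minus the number
  of pairs in a column, for 3-cycles it is a signed count of rows, columns and hooks, and removing
  boxes one by one turns both counts into sums of contents.
  On an irreducible representation of W_n a central element is a scalar by Schur's lemma, which is
  determined by the trace. An element of W_a x W_b lies in the class of type A2 or B2 only if one
  of its components is trivial, so the induced character, summed over the class, reduces to 3-cycles
  (four lifts each) and transpositions (two lifts each, with opposite signs on the two factors).
*)
theory Submission
  imports Defs "Jordan_Normal_Form.Spectral_Radius"
begin

text \<open>The scalar of a class sum z on the Specht ideal is found without its dimension or its
  irreducibility: z is central, so z f c = f z c, and z c = z a b = a z b is a sum of sandwiches a g
  b. Each c(g) is 0, 1 or -1, so the scalar is a signed count. Since the module is given only up to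
  isomorphism, the identity is proved inside the ideal and pulled back by injectivity. The
  representation of the Weyl group is known by its character alone, and no induced module is built.
  The class of the identity is summed in the same way as the other two classes. It expresses the
  degree by the same index and the same two dimensions that occur in the other sums, so these
  factors cancel. The lifts then give 1/4 * 4 = 1 in front of kl^2 and 1/2 * 2 = 1 in front of kl
  ks. The Weyl group is presented by reflections, but all computations need normal forms. Its
  elements are therefore rewritten as a permutation with signs, and cycles and rotations are indexed
  by tuples, each element having a fixed number of tuples.\<close>

hide_const (open) Multiset.mult Polynomial.order

section \<open>Young symmetrizers\<close>

(* In the presence of HOL-Algebra, inv is syntax for inverses in groups. *)
abbreviation pinv :: "('a \<Rightarrow> 'a) \<Rightarrow> 'a \<Rightarrow> 'a" where "pinv \<equiv> inv_into UNIV"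

lemma carrier_perm_group_on [simp]: "carrier (perm_group_on A) = {p. p permutes A}"
  and mult_perm_group_on [simp]: "p \<otimes>\<^bsub>perm_group_on A\<^esub> q = p \<circ> q"
  and one_perm_group_on [simp]: "\<one>\<^bsub>perm_group_on A\<^esub> = id"
  by (simp_all add: perm_group_on_def)

lemma group_perm_group_on: "group (perm_group_on A)"
proof (rule groupI)
  fix x assume "x \<in> carrier (perm_group_on A)"
  then have "pinv x permutes A" "pinv x \<circ> x = id"
    by (simp_all add: permutes_inv permutes_inv_o)
  then show "\<exists>y\<in>carrier (perm_group_on A). y \<otimes>\<^bsub>perm_group_on A\<^esub> x = \<one>\<^bsub>perm_group_on A\<^esub>"
    by auto
qed (simp_all add: permutes_compose permutes_id comp_assoc)

lemma inv_perm_group_on: "p permutes A \<Longrightarrow> inv\<^bsub>perm_group_on A\<^esub> p = pinv p"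
  using group.inv_equality[OF group_perm_group_on, of A "pinv p" p]
  by (simp add: permutes_inv permutes_inv_o)

lemma permutes_comp_eq_iff:
  assumes "p permutes A"
  shows "p \<circ> q = w \<longleftrightarrow> q = pinv p \<circ> w" and "q \<circ> p = w \<longleftrightarrow> q = w \<circ> pinv p"
  using permutes_inv_o[OF assms] by (metis comp_assoc comp_id id_comp)+

lemma sign_comp_permutes:
  "p permutes A \<Longrightarrow> q permutes A \<Longrightarrow> finite A \<Longrightarrow> sign (p \<circ> q) = sign p * sign q"
  by (rule sign_compose) (auto simp: permutation_permutes)

text \<open>Of the partition only the shape of its diagram matters, in the form of
  \<open>down_closed\<close>. The list itself enters through \<open>tableau_diagram\<close> and
  \<open>row_stabilizer_eq\<close>.\<close>

locale tableau =
  fixes A :: "nat set" and D :: "(nat \<times> nat) set" and T :: "nat \<times> nat \<Rightarrow> nat"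
  assumes finite_A: "finite A"
    and down_closed: "\<And>i j i' j'. (i, j) \<in> D \<Longrightarrow> i' \<le> i \<Longrightarrow> j' \<le> j \<Longrightarrow> (i', j') \<in> D"
    and bij_T: "bij_betw T D A"
begin

definition box :: "nat \<Rightarrow> nat \<times> nat" where "box = inv_into D T"
definition rw :: "nat \<Rightarrow> nat" where "rw s = fst (box s)"
definition cl :: "nat \<Rightarrow> nat" where "cl s = snd (box s)"

lemma finite_D: "finite D"
  using bij_T finite_A bij_betw_finite by blast

lemma box_in: "s \<in> A \<Longrightarrow> (rw s, cl s) \<in> D"
  using bij_betw_imp_surj_on[OF bij_T] unfolding rw_def cl_def box_def by (simp add: inv_into_into)

lemma T_box: "s \<in> A \<Longrightarrow> T (rw s, cl s) = s"
  using bij_betw_imp_surj_on[OF bij_T] unfolding rw_def cl_def box_def by (simp add: f_inv_into_f)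

lemma T_in: "x \<in> D \<Longrightarrow> T x \<in> A"
  using bij_betw_imp_surj_on[OF bij_T] by auto

lemma rw_T [simp]: "x \<in> D \<Longrightarrow> rw (T x) = fst x" and cl_T [simp]: "x \<in> D \<Longrightarrow> cl (T x) = snd x"
  using bij_betw_imp_inj_on[OF bij_T] unfolding rw_def cl_def box_def by auto

lemma box_eqI: "s \<in> A \<Longrightarrow> t \<in> A \<Longrightarrow> rw s = rw t \<Longrightarrow> cl s = cl t \<Longrightarrow> s = t"
  using T_box by metis

section \<open>Row and column groups and the coefficients of the symmetrizer\<close>

definition R :: "(nat \<Rightarrow> nat) set" where "R = {p. p permutes A \<and> (\<forall>s\<in>A. rw (p s) = rw s)}"
definition C :: "(nat \<Rightarrow> nat) set" where "C = {p. p permutes A \<and> (\<forall>s\<in>A. cl (p s) = cl s)}"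

lemma R_permutes: "p \<in> R \<Longrightarrow> p permutes A" and C_permutes: "p \<in> C \<Longrightarrow> p permutes A"
  by (auto simp: R_def C_def)

lemma rw_R: "p \<in> R \<Longrightarrow> s \<in> A \<Longrightarrow> rw (p s) = rw s" and cl_C: "p \<in> C \<Longrightarrow> s \<in> A \<Longrightarrow> cl (p s) = cl s"
  by (auto simp: R_def C_def)

lemma finite_R: "finite R" and finite_C: "finite C"
  using finite_permutations[OF finite_A] unfolding R_def C_def by auto

lemma R_comp: "p \<in> R \<Longrightarrow> q \<in> R \<Longrightarrow> p \<circ> q \<in> R" and C_comp: "p \<in> C \<Longrightarrow> q \<in> C \<Longrightarrow> p \<circ> q \<in> C"
  by (auto simp: R_def C_def permutes_compose permutes_in_image)

lemma id_R: "id \<in> R" and id_C: "id \<in> C"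
  by (auto simp: R_def C_def permutes_id)

lemma R_inv: "p \<in> R \<Longrightarrow> pinv p \<in> R"
  unfolding R_def by (auto simp: permutes_inv) (metis permutes_def permutes_inverses(1) permutes_inv)

lemma C_inv: "p \<in> C \<Longrightarrow> pinv p \<in> C"
  unfolding C_def by (auto simp: permutes_inv) (metis permutes_def permutes_inverses(1) permutes_inv)

lemma R_Int_C: "p \<in> R \<Longrightarrow> p \<in> C \<Longrightarrow> p = id"
proof
  fix s assume p: "p \<in> R" "p \<in> C"
  show "p s = id s"
  proof (cases "s \<in> A")
    case True
    then show ?thesis using p box_eqI[of "p s" s] by (auto simp: R_def C_def permutes_in_image)
  next
    case False
    then show ?thesis using p by (auto simp: R_def permutes_def)
  qed
qed

text \<open>The coefficient c(w) of the Young symmetrizer, identified with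
  \<open>young_symmetrizer\<close> in \<open>young_symmetrizer_eq\<close>. At most one pair
  contributes, so the value is 0, 1 or -1.\<close>

definition ys :: "(nat \<Rightarrow> nat) \<Rightarrow> complex" where
  "ys w = (\<Sum>p\<in>R. \<Sum>q\<in>C. of_int (sign q) * indicator {w} (p \<circ> q))"

lemma ys_0:
  assumes "\<And>p q. p \<in> R \<Longrightarrow> q \<in> C \<Longrightarrow> p \<circ> q \<noteq> w"
  shows "ys w = 0"
  unfolding ys_def using assms by (auto intro!: sum.neutral)

text \<open>Two factorizations p q = p' q' give p^-1 p' = q q'^-1, an element of both groups. By
  \<open>R_Int_C\<close> it is the identity, because an entry is determined by its row and its
  column.\<close>

lemma ys_prod:
  assumes "p \<in> R" "q \<in> C"
  shows "ys (p \<circ> q) = of_int (sign q)"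
proof -
  have *: "p' = p \<and> q' = q" if "p' \<in> R" "q' \<in> C" "p' \<circ> q' = p \<circ> q" for p' q'
  proof -
    have "pinv p \<circ> p' = q \<circ> pinv q'"
      using that(3) permutes_comp_eq_iff[OF R_permutes[OF assms(1)]]
        permutes_comp_eq_iff(2)[OF C_permutes[OF that(2)]]
      by (metis comp_assoc)
    moreover have "pinv p \<circ> p' \<in> R" "q \<circ> pinv q' \<in> C"
      using assms that by (auto intro: R_comp C_comp R_inv C_inv)
    ultimately have "pinv p \<circ> p' = id" "q \<circ> pinv q' = id"
      using R_Int_C by metis+
    then show ?thesis
      using permutes_comp_eq_iff[OF permutes_inv[OF R_permutes[OF assms(1)]]]
        permutes_comp_eq_iff(2)[OF permutes_inv[OF C_permutes[OF that(2)]]]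
       permutes_inv_inv[OF R_permutes[OF assms(1)]] permutes_inv_inv[OF C_permutes[OF that(2)]]
      by simp
  qed
  have "ys (p \<circ> q) = (\<Sum>p'\<in>R. \<Sum>q'\<in>C. if p' = p \<and> q' = q then of_int (sign q) else 0)"
    unfolding ys_def using * by (intro sum.cong) (auto simp: indicator_def)
  also have "\<dots> = (\<Sum>p'\<in>R. if p' = p then of_int (sign q) else 0)"
    using assms finite_C by (intro sum.cong) auto
  also have "\<dots> = of_int (sign q)" using assms finite_R by simp
  finally show ?thesis .
qed

text \<open>The boxes \<open>(rw (g s), cl s)\<close> are distinct and have the row and column sums of the diagram.
  Row by row, at most as many of them as boxes of \<open>D\<close> lie to the left of a given column, and the totals agree.\<close>

lemma image_box_in_D:
  assumes g: "g permutes A"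
    and good: "\<And>s t. s \<in> A \<Longrightarrow> t \<in> A \<Longrightarrow> s \<noteq> t \<Longrightarrow> cl s = cl t \<Longrightarrow> rw (g s) \<noteq> rw (g t)"
    and s: "s \<in> A"
  shows "(rw (g s), cl s) \<in> D"
proof (rule ccontr)
  define c where "c = cl s"
  assume "(rw (g s), cl s) \<notin> D"
  then have notD: "(rw (g s), c) \<notin> D" by (simp add: c_def)
  define I where "I = rw ` A"
  define f where "f i = card {t\<in>A. cl t < c \<and> rw (g t) = i}" for i
  define h where "h i = card {t\<in>A. cl t < c \<and> rw t = i}" for i
  have gA: "g t \<in> A \<longleftrightarrow> t \<in> A" for t using g by (rule permutes_in_image)
  have rowcard: "card {t\<in>A. rw (g t) = i} = card {t\<in>A. rw t = i}" for i
  proof (rule bij_betw_same_card[of g])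
    show "bij_betw g {t\<in>A. rw (g t) = i} {t\<in>A. rw t = i}"
      unfolding bij_betw_def
    proof
      show "inj_on g {t\<in>A. rw (g t) = i}" using permutes_inj[OF g] by (auto simp: inj_on_def)
      show "g ` {t\<in>A. rw (g t) = i} = {t\<in>A. rw t = i}"
        using permutes_image[OF g] by (auto simp: gA)
    qed
  qed
  \<comment> \<open>A row without a box in column \<open>c\<close> lies entirely to the left of it,
    by \<open>down_closed\<close>.\<close>
  have short: "h i = card {t\<in>A. rw t = i}" if "(i, c) \<notin> D" for i
  proof -
    have "cl t < c" if "t \<in> A" "rw t = i" for t
      using box_in[OF that(1)] down_closed[of i "cl t" i c] that \<open>(i, c) \<notin> D\<close> by force
    then show ?thesis unfolding h_def by (intro arg_cong[of _ _ card]) auto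
  qed
  have le: "f i \<le> h i" for i
  proof (cases "(i, c) \<in> D")
    case True
    \<comment> \<open>Entries sent to one row by \<open>g\<close> come from distinct columns, so at
      most \<open>c\<close> of them come from columns below \<open>c\<close>. The row itself has all
      \<open>c\<close> boxes there.\<close>
    have "f i \<le> card {..<c}"
      unfolding f_def
    proof (rule card_inj_on_le[of cl])
      show "inj_on cl {t\<in>A. cl t < c \<and> rw (g t) = i}"
      proof
        fix x y assume "x \<in> {t\<in>A. cl t < c \<and> rw (g t) = i}" "y \<in> {t\<in>A. cl t < c \<and> rw (g t) = i}"
          "cl x = cl y"
        then show "x = y" using good[of x y] by auto
      qed
    qed auto
    also have "card {..<c} \<le> h i"
      unfolding h_def
    proof (rule card_inj_on_le[of "\<lambda>j. T (i, j)"])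
      have in_D: "(i, j) \<in> D" if "j < c" for j using down_closed[OF True, of i j] that by simp
      show "inj_on (\<lambda>j. T (i, j)) {..<c}"
      proof
        fix x y assume xy: "x \<in> {..<c}" "y \<in> {..<c}" and eq: "T (i, x) = T (i, y)"
        have "cl (T (i, x)) = x" "cl (T (i, y)) = y"
          using cl_T[OF in_D[of x]] cl_T[OF in_D[of y]] xy by auto
        then show "x = y" using eq by metis
      qed
      show "(\<lambda>j. T (i, j)) ` {..<c} \<subseteq> {t\<in>A. cl t < c \<and> rw t = i}"
        using in_D T_in by auto
    qed (simp add: finite_A)
    finally show ?thesis .
  next
    case False
    have "f i \<le> card {t\<in>A. rw (g t) = i}"
      unfolding f_def by (rule card_mono) (auto simp: finite_A)
    then show ?thesis using short[OF False] rowcard by simp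
  qed
  have finI: "finite I" using finite_A by (simp add: I_def)
  have "(\<Sum>i\<in>I. f i) = card {t\<in>A. cl t < c}"
  proof -
    have "{t\<in>A. cl t < c} = (\<Union>i\<in>I. {t\<in>A. cl t < c \<and> rw (g t) = i})"
      using gA by (auto simp: I_def)
    then show ?thesis unfolding f_def
      by (subst card_UN_disjoint[symmetric]) (auto simp: finite_A finI)
  qed
  moreover have "(\<Sum>i\<in>I. h i) = card {t\<in>A. cl t < c}"
  proof -
    have "{t\<in>A. cl t < c} = (\<Union>i\<in>I. {t\<in>A. cl t < c \<and> rw t = i})"
      by (auto simp: I_def)
    then show ?thesis unfolding h_def
      by (subst card_UN_disjoint[symmetric]) (auto simp: finite_A finI)
  qed
  \<comment> \<open>Equal totals and termwise inequalities force equality in every row. In the row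
    of \<open>g s\<close>, which is short, every entry sent there then comes from a column left of
    \<open>c\<close>; but \<open>s\<close> is such an entry and sits in column
    \<open>c\<close>.\<close>
  ultimately have "f (rw (g s)) = h (rw (g s))"
    using le finI gA s by (intro sum_mono_inv[of f I h]) (auto simp: I_def)
  then have "card {t\<in>A. cl t < c \<and> rw (g t) = rw (g s)} = card {t\<in>A. rw (g t) = rw (g s)}"
    using short[OF notD] rowcard by (simp add: f_def)
  then have "{t\<in>A. cl t < c \<and> rw (g t) = rw (g s)} = {t\<in>A. rw (g t) = rw (g s)}"
    by (intro card_subset_eq) (auto simp: finite_A)
  then have "cl s < c" using s by auto
  then show False by (simp add: c_def)
qed

text \<open>The column part \<open>q\<close> moves each entry inside its column to the row in which
  \<open>g\<close> puts it; the required box exists by \<open>image_box_in_D\<close>, and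
  \<open>good\<close> makes \<open>q\<close> injective. What remains, g q^-1, preserves
  rows.\<close>

lemma good_factorization:
  assumes g: "g permutes A"
    and good: "\<And>s t. s \<in> A \<Longrightarrow> t \<in> A \<Longrightarrow> s \<noteq> t \<Longrightarrow> cl s = cl t \<Longrightarrow> rw (g s) \<noteq> rw (g t)"
  obtains p q where "p \<in> R" "q \<in> C" "g = p \<circ> q"
proof -
  define q where "q s = (if s \<in> A then T (rw (g s), cl s) else s)" for s
  have D: "(rw (g s), cl s) \<in> D" if "s \<in> A" for s
    using image_box_in_D[OF g good that] by blast
  have qA: "q s \<in> A" "rw (q s) = rw (g s)" "cl (q s) = cl s" if "s \<in> A" for s
    using D[OF that] that T_in by (auto simp: q_def)
  have "inj_on q A"
  proof
    fix s t assume "s \<in> A" "t \<in> A" "q s = q t"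
    then show "s = t" using qA good by metis
  qed
  then have "bij_betw q A A"
    using qA(1) finite_A endo_inj_surj[of A q] by (auto simp: bij_betw_def)
  then have q: "q permutes A" by (rule bij_imp_permutes) (simp add: q_def)
  then have "q \<in> C" using qA by (auto simp: C_def)
  moreover have "g \<circ> pinv q \<in> R"
  proof -
    have "rw (g (pinv q s)) = rw s" if "s \<in> A" for s
      using qA(2)[of "pinv q s"] that q by (metis permutes_inv permutes_in_image permutes_inverses(1))
    then show ?thesis using q g by (auto simp: R_def permutes_inv permutes_compose)
  qed
  moreover have "g = (g \<circ> pinv q) \<circ> q"
    using permutes_inv_o[OF q] by (simp add: comp_assoc)
  ultimately show ?thesis using that by blast
qed

lemma transpose_R: "s \<in> A \<Longrightarrow> t \<in> A \<Longrightarrow> rw s = rw t \<Longrightarrow> transpose s t \<in> R"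
  and transpose_C: "s \<in> A \<Longrightarrow> t \<in> A \<Longrightarrow> cl s = cl t \<Longrightarrow> transpose s t \<in> C"
  by (auto simp: R_def C_def permutes_swap_id transpose_def)

text \<open>A transposition \<open>u\<close> of two entries in one column of \<open>T\<close> and one row of \<open>g T\<close> satisfies
  \<open>a g b = a (g u g\<^sup>-\<^sup>1) g b = a g u b = - a g b\<close>. Without such a pair, \<open>g\<close> lies in \<open>R C\<close>.\<close>

lemma sandwich:
  assumes g: "g permutes A"
  shows "(\<Sum>p\<in>R. \<Sum>q\<in>C. of_int (sign q) * indicator {w} (p \<circ> g \<circ> q)) = ys g * ys w"
    (is "?S = _")
proof (cases "\<exists>s\<in>A. \<exists>t\<in>A. s \<noteq> t \<and> cl s = cl t \<and> rw (g s) = rw (g t)")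
  case True
  then obtain s t where st: "s \<in> A" "t \<in> A" "s \<noteq> t" "cl s = cl t" "rw (g s) = rw (g t)"
    by blast
  define u where "u = transpose s t"
  define v where "v = transpose (g s) (g t)"
  have gA: "g s \<in> A" "g t \<in> A" using st g by (auto simp: permutes_in_image)
  have u: "u \<in> C" and v: "v \<in> R"
    using st gA by (auto simp: u_def v_def intro: transpose_R transpose_C)
  have gu: "g \<circ> u = v \<circ> g"
    unfolding u_def v_def using permutes_inj[OF g] by (auto simp: fun_eq_iff transpose_def inj_eq)
  have uu: "u \<circ> u = id" "v \<circ> v = id" by (simp_all add: u_def v_def)
  have su: "sign (u \<circ> q) = - sign q" if "q \<in> C" for q
    using sign_comp_permutes[OF C_permutes[OF u] C_permutes[OF that] finite_A] st(3)
    by (simp add: u_def sign_swap_id)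
  have "?S = (\<Sum>p\<in>R. \<Sum>q\<in>C. of_int (sign (u \<circ> q)) * indicator {w} (p \<circ> g \<circ> (u \<circ> q)))"
    by (intro sum.cong refl sum.reindex_bij_witness[of _ "\<lambda>q. u \<circ> q" "\<lambda>q. u \<circ> q"])
       (use u uu in \<open>auto simp: C_comp simp flip: comp_assoc\<close>)
  also have "\<dots> = (\<Sum>p\<in>R. \<Sum>q\<in>C. - of_int (sign q) * indicator {w} ((p \<circ> v) \<circ> g \<circ> q))"
  proof -
    have "p \<circ> g \<circ> (u \<circ> q) = p \<circ> v \<circ> g \<circ> q" for p q :: "nat \<Rightarrow> nat"
      using gu by (metis comp_assoc)
    then show ?thesis by (simp add: su)
  qed
  also have "\<dots> = (\<Sum>p\<in>R. \<Sum>q\<in>C. - of_int (sign q) * indicator {w} (p \<circ> g \<circ> q))"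
    by (rule sum.reindex_bij_witness[of _ "\<lambda>p. p \<circ> v" "\<lambda>p. p \<circ> v"])
       (use v uu in \<open>auto simp: R_comp comp_assoc\<close>)
  also have "\<dots> = - ?S" by (simp add: sum_negf)
  finally have "?S = 0" by simp
  moreover have "ys g = 0"
  proof (rule ys_0)
    fix p q assume pq: "p \<in> R" "q \<in> C"
    show "p \<circ> q \<noteq> g"
    proof
      assume "p \<circ> q = g"
      \<comment> \<open>A factorization would put \<open>q s\<close> and \<open>q t\<close> in one
        row, since \<open>p\<close> preserves rows, and in one column, since \<open>q\<close>
        preserves columns; they would coincide.\<close>
      then have "rw (q s) = rw (q t)"
        using pq st rw_R[OF pq(1), of "q s"] rw_R[OF pq(1), of "q t"] C_permutes[OF pq(2)]
        by (auto simp: permutes_in_image)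
      moreover have "q s \<in> A" "q t \<in> A"
        using st C_permutes[OF pq(2)] by (simp_all add: permutes_in_image)
      moreover have "cl (q s) = cl (q t)" using cl_C[OF pq(2)] st by simp
      ultimately have "q s = q t" using box_eqI by blast
      then show False using st(3) permutes_inj[OF C_permutes[OF pq(2)]] by (auto simp: inj_eq)
    qed
  qed
  ultimately show ?thesis by simp
next
  case False
  then obtain p0 q0 where pq: "p0 \<in> R" "q0 \<in> C" "g = p0 \<circ> q0"
    using good_factorization[OF g] by metis
  note p0 = R_permutes[OF pq(1)] and q0 = C_permutes[OF pq(2)]
  have sg: "sign (q0 \<circ> q) = sign q0 * sign q" if "q \<in> C" for q
    using sign_comp_permutes[OF q0 C_permutes[OF that] finite_A] .
  have sq: "sign q0 * sign q0 = 1" by (simp add: sign_def)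
  \<comment> \<open>The factor \<open>p0\<close> is absorbed by the row sum, and \<open>q0\<close>
    by the signed column sum at the price of \<open>sign q0\<close>, which is c(g).\<close>
  have "?S = (\<Sum>p\<in>R. \<Sum>q\<in>C. of_int (sign q) * indicator {w} ((p \<circ> p0) \<circ> (q0 \<circ> q)))"
    by (simp add: pq comp_assoc)
  also have "\<dots> = (\<Sum>p\<in>R. \<Sum>q\<in>C. of_int (sign q) * indicator {w} (p \<circ> (q0 \<circ> q)))"
    by (rule sum.reindex_bij_witness[of _ "\<lambda>p. p \<circ> pinv p0" "\<lambda>p. p \<circ> p0"])
       (use pq permutes_inv_o[OF p0] in \<open>auto simp: R_comp R_inv comp_assoc\<close>)
  also have "\<dots> = (\<Sum>p\<in>R. \<Sum>q\<in>C. of_int (sign q0 * sign (q0 \<circ> q)) * indicator {w} (p \<circ> (q0 \<circ> q)))"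
  proof -
    have "sign q = sign q0 * sign (q0 \<circ> q)" if "q \<in> C" for q
      using sq by (simp add: sg[OF that] mult.assoc[symmetric] del: mult.assoc)
    then show ?thesis by simp
  qed
  also have "\<dots> = (\<Sum>p\<in>R. \<Sum>q\<in>C. of_int (sign q0 * sign q) * indicator {w} (p \<circ> q))"
    by (intro sum.cong refl sum.reindex_bij_witness[of _ "\<lambda>q. pinv q0 \<circ> q" "\<lambda>q. q0 \<circ> q"])
       (use pq permutes_inv_o[OF q0] in \<open>auto simp: C_comp C_inv simp flip: comp_assoc\<close>)
  also have "\<dots> = ys g * ys w"
    using ys_prod[OF pq(1,2)] by (simp add: pq(3) ys_def sum_distrib_left mult.assoc)
  finally show ?thesis .
qed

text \<open>The left side is the coefficient at \<open>w\<close> of the class sum times a b.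
  Invariance under conjugation replaces each g p by p g, which moves the class sum between a and b,
  where \<open>sandwich\<close> applies.\<close>

lemma class_sum_ys:
  assumes K: "\<And>g p. g \<in> K \<Longrightarrow> p permutes A \<Longrightarrow> p \<circ> g \<circ> pinv p \<in> K"
    and KA: "\<And>g. g \<in> K \<Longrightarrow> g permutes A"
  shows "(\<Sum>g\<in>K. ys (pinv g \<circ> w)) = (\<Sum>g\<in>K. ys g) * ys w"
proof -
  have "(\<Sum>g\<in>K. ys (pinv g \<circ> w))
      = (\<Sum>g\<in>K. \<Sum>p\<in>R. \<Sum>q\<in>C. of_int (sign q) * indicator {w} (g \<circ> p \<circ> q))"
    unfolding ys_def
  proof (intro sum.cong refl)
    fix g p q :: "nat \<Rightarrow> nat" assume "g \<in> K"
    have "p \<circ> q = pinv g \<circ> w \<longleftrightarrow> g \<circ> p \<circ> q = w"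
      using permutes_comp_eq_iff(1)[OF KA[OF \<open>g \<in> K\<close>], of "p \<circ> q" w] by (simp add: comp_assoc)
    then show "of_int (sign q) * indicator {pinv g \<circ> w} (p \<circ> q)
      = (of_int (sign q) * indicator {w} (g \<circ> p \<circ> q) :: complex)"
      by (simp add: indicator_def)
  qed
  also have "\<dots> = (\<Sum>p\<in>R. \<Sum>g\<in>K. \<Sum>q\<in>C. of_int (sign q) * indicator {w} (g \<circ> p \<circ> q))"
    by (rule sum.swap)
  also have "\<dots> = (\<Sum>p\<in>R. \<Sum>g\<in>K. \<Sum>q\<in>C. of_int (sign q) * indicator {w} (p \<circ> g \<circ> q))"
  proof (rule sum.cong[OF refl])
    fix p assume "p \<in> R"
    note p = R_permutes[OF \<open>p \<in> R\<close>]
    note pp = permutes_inv_o[OF p] and ip = permutes_inv[OF p]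
    have *: "pinv p \<circ> g \<circ> p \<in> K" if "g \<in> K" for g
      using K[OF that ip] permutes_inv_inv[OF p] by simp
    show "(\<Sum>g\<in>K. \<Sum>q\<in>C. of_int (sign q) * indicator {w} (g \<circ> p \<circ> q))
      = (\<Sum>g\<in>K. \<Sum>q\<in>C. of_int (sign q) * (indicator {w} (p \<circ> g \<circ> q)::complex))"
    proof (rule sum.reindex_bij_witness[of _ "\<lambda>g. p \<circ> g \<circ> pinv p" "\<lambda>g. pinv p \<circ> g \<circ> p"])
      fix g assume "g \<in> K"
      then show "pinv p \<circ> g \<circ> p \<in> K" "p \<circ> g \<circ> pinv p \<in> K"
        using * K[OF _ p] by auto
      have ip1: "pinv p (p x) = x" "p (pinv p x) = x" for x
        using permutes_inverses[OF p] by auto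
      show "p \<circ> (pinv p \<circ> g \<circ> p) \<circ> pinv p = g" "pinv p \<circ> (p \<circ> g \<circ> pinv p) \<circ> p = g"
        by (simp_all add: fun_eq_iff ip1)
      have "p \<circ> (pinv p \<circ> g \<circ> p) = g \<circ> p"
        by (simp add: fun_eq_iff ip1)
      then show "(\<Sum>q\<in>C. of_int (sign q) * indicator {w} (p \<circ> (pinv p \<circ> g \<circ> p) \<circ> q))
        = (\<Sum>q\<in>C. of_int (sign q) * (indicator {w} (g \<circ> p \<circ> q)::complex))"
        by simp
    qed
  qed
  also have "\<dots> = (\<Sum>g\<in>K. \<Sum>p\<in>R. \<Sum>q\<in>C. of_int (sign q) * indicator {w} (p \<circ> g \<circ> q))"
    by (rule sum.swap)
  also have "\<dots> = (\<Sum>g\<in>K. ys g * ys w)"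
    using sandwich KA by (intro sum.cong) auto
  finally show ?thesis by (simp add: sum_distrib_right)
qed

end

section \<open>Sums over cycles\<close>

text \<open>Passes from tuples to the group elements they describe: the multiplicity
  \<open>k\<close> is 2 for transpositions, and 3 for 3-cycles and their lifts.\<close>

lemma sum_fibres:
  fixes h :: "'b \<Rightarrow> complex"
  assumes "finite B" and "\<And>x. x \<in> B \<Longrightarrow> card {y\<in>B. f y = f x} = k"
  shows "(\<Sum>x\<in>B. h (f x)) = of_nat k * (\<Sum>y\<in>f ` B. h y)"
proof -
  have "(\<Sum>x\<in>B. h (f x)) = (\<Sum>y\<in>f ` B. \<Sum>x | x \<in> B \<and> f x = y. h (f x))"
    by (rule sum.image_gen[OF assms(1)])
  also have "\<dots> = (\<Sum>y\<in>f ` B. of_nat k * h y)"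
  proof (rule sum.cong[OF refl])
    fix y assume "y \<in> f ` B"
    then have "card {x\<in>B. f x = y} = k" using assms(2) by blast
    then show "(\<Sum>x | x \<in> B \<and> f x = y. h (f x)) = of_nat k * h y" by simp
  qed
  finally show ?thesis by (simp add: sum_distrib_left)
qed

definition distinct_pairs :: "'a set \<Rightarrow> ('a \<times> 'a) set" where
  "distinct_pairs A = {(s, t). s \<in> A \<and> t \<in> A \<and> s \<noteq> t}"

definition distinct_triples :: "'a set \<Rightarrow> ('a \<times> 'a \<times> 'a) set" where
  "distinct_triples A = {(s, t, u). s \<in> A \<and> t \<in> A \<and> u \<in> A \<and> s \<noteq> t \<and> s \<noteq> u \<and> t \<noteq> u}"

lemma finite_distinct_pairs: "finite A \<Longrightarrow> finite (distinct_pairs A)"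
  by (rule finite_subset[of _ "A \<times> A"]) (auto simp: distinct_pairs_def)

lemma finite_distinct_triples: "finite A \<Longrightarrow> finite (distinct_triples A)"
  by (rule finite_subset[of _ "A \<times> A \<times> A"]) (auto simp: distinct_triples_def)

definition cycle3 :: "'a \<Rightarrow> 'a \<Rightarrow> 'a \<Rightarrow> 'a \<Rightarrow> 'a" where
  "cycle3 s t u = transpose s t \<circ> transpose t u"

lemma cycle3_apply [simp]:
  assumes "s \<noteq> t" "s \<noteq> u" "t \<noteq> u"
  shows "cycle3 s t u s = t" "cycle3 s t u t = u" "cycle3 s t u u = s"
    "x \<noteq> s \<Longrightarrow> x \<noteq> t \<Longrightarrow> x \<noteq> u \<Longrightarrow> cycle3 s t u x = x"
  using assms by (auto simp: cycle3_def transpose_def)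

lemma k_cycles_2: "k_cycles A 2 = (\<lambda>(s, t). transpose s t) ` distinct_pairs A"
proof (intro equalityI subsetI)
  fix g assume "g \<in> k_cycles A 2"
  then obtain cs where cs: "g = cycle_of_list cs" "distinct cs" "length cs = 2" "set cs \<subseteq> A"
    by (auto simp: k_cycles_def)
  then obtain s t where "cs = [s, t]" by (auto simp: numeral_2_eq_2 length_Suc_conv)
  then show "g \<in> (\<lambda>(s, t). transpose s t) ` distinct_pairs A"
    using cs by (auto simp: distinct_pairs_def)
next
  fix g assume "g \<in> (\<lambda>(s, t). transpose s t) ` distinct_pairs A"
  then obtain s t where "g = cycle_of_list [s, t]" "s \<in> A" "t \<in> A" "s \<noteq> t"
    by (auto simp: distinct_pairs_def)
  then show "g \<in> k_cycles A 2"
    unfolding k_cycles_def by (intro CollectI exI[of _ "[s, t]"]) simp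
qed

lemma k_cycles_3: "k_cycles A 3 = (\<lambda>(s, t, u). cycle3 s t u) ` distinct_triples A"
proof (intro equalityI subsetI)
  fix g assume "g \<in> k_cycles A 3"
  then obtain cs where cs: "g = cycle_of_list cs" "distinct cs" "length cs = 3" "set cs \<subseteq> A"
    by (auto simp: k_cycles_def)
  then obtain s t u where "cs = [s, t, u]" by (auto simp: numeral_3_eq_3 length_Suc_conv)
  then have "g = (\<lambda>(s, t, u). cycle3 s t u) (s, t, u)" "(s, t, u) \<in> distinct_triples A"
    using cs by (auto simp: distinct_triples_def cycle3_def)
  then show "g \<in> (\<lambda>(s, t, u). cycle3 s t u) ` distinct_triples A" by (rule image_eqI)
next
  fix g assume "g \<in> (\<lambda>(s, t, u). cycle3 s t u) ` distinct_triples A"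
  then obtain s t u where "g = cycle_of_list [s, t, u]" "s \<in> A" "t \<in> A" "u \<in> A"
    "s \<noteq> t" "s \<noteq> u" "t \<noteq> u"
    by (auto simp: distinct_triples_def cycle3_def)
  then show "g \<in> k_cycles A 3"
    unfolding k_cycles_def by (intro CollectI exI[of _ "[s, t, u]"]) simp
qed

text \<open>The cycle determines the successor of each entry, so only the starting point is
  free.\<close>

lemma cycle3_eq_iff:
  assumes "(s, t, u) \<in> distinct_triples A" "(s', t', u') \<in> distinct_triples A"
  shows "cycle3 s' t' u' = cycle3 s t u \<longleftrightarrow>
    (s', t', u') \<in> {(s, t, u), (t, u, s), (u, s, t)}"
proof
  have d: "s \<noteq> t" "s \<noteq> u" "t \<noteq> u" "s' \<noteq> t'" "s' \<noteq> u'" "t' \<noteq> u'"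
    using assms by (auto simp: distinct_triples_def)
  assume *: "cycle3 s' t' u' = cycle3 s t u"
  have 1: "cycle3 s t u s' = t'" "cycle3 s t u t' = u'"
    using cycle3_apply(1,2)[OF d(4-6)] by (simp_all add: *)
  have "s' = s \<or> s' = t \<or> s' = u"
    using 1(1) d(4) cycle3_apply(4)[OF d(1-3), of s'] by auto
  then show "(s', t', u') \<in> {(s, t, u), (t, u, s), (u, s, t)}"
    using 1 cycle3_apply(1-3)[OF d(1-3)] by auto
next
  have d: "s \<noteq> t" "s \<noteq> u" "t \<noteq> u" using assms by (auto simp: distinct_triples_def)
  assume "(s', t', u') \<in> {(s, t, u), (t, u, s), (u, s, t)}"
  then show "cycle3 s' t' u' = cycle3 s t u"
    using d by (auto simp: cycle3_def fun_eq_iff transpose_def)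
qed

lemma sum_k_cycles_2:
  fixes h :: "(nat \<Rightarrow> nat) \<Rightarrow> complex"
  assumes "finite A"
  shows "(\<Sum>(s, t)\<in>distinct_pairs A. h (transpose s t)) = 2 * (\<Sum>g\<in>k_cycles A 2. h g)"
proof -
  have "card {y \<in> distinct_pairs A. (\<lambda>(s, t). transpose s t) y = (\<lambda>(s, t). transpose s t) x} = 2"
    if "x \<in> distinct_pairs A" for x
  proof -
    obtain s t where x': "x = (s, t)" by (cases x)
    then have x: "x = (s, t)" "s \<in> A" "t \<in> A" "s \<noteq> t"
      using that by (auto simp: distinct_pairs_def)
    have "transpose s' t' = transpose s t \<longleftrightarrow> (s', t') \<in> {(s, t), (t, s)}" if "s' \<noteq> t'" for s' t'
    proof
      assume *: "transpose s' t' = transpose s t"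
      then have "transpose s t s' = t'" by (metis transpose_apply_first)
      then show "(s', t') \<in> {(s, t), (t, s)}" using that by (auto simp: transpose_def split: if_splits)
    qed (auto simp: transpose_commute)
    then have "{y \<in> distinct_pairs A. (\<lambda>(s, t). transpose s t) y = (\<lambda>(s, t). transpose s t) x}
      = {(s, t), (t, s)}"
      using x by (auto simp: distinct_pairs_def)
    then show ?thesis using x by simp
  qed
  from sum_fibres[OF finite_distinct_pairs[OF assms] this, of h]
  show ?thesis by (simp add: k_cycles_2 case_prod_beta)
qed

lemma sum_k_cycles_3:
  fixes h :: "(nat \<Rightarrow> nat) \<Rightarrow> complex"
  assumes "finite A"
  shows "(\<Sum>(s, t, u)\<in>distinct_triples A. h (cycle3 s t u)) = 3 * (\<Sum>g\<in>k_cycles A 3. h g)"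
proof -
  have "card {y \<in> distinct_triples A. (\<lambda>(s, t, u). cycle3 s t u) y = (\<lambda>(s, t, u). cycle3 s t u) x} = 3"
    if "x \<in> distinct_triples A" for x
  proof -
    obtain s t u where x: "x = (s, t, u)" using prod_cases3 by blast
    have "{y \<in> distinct_triples A. (\<lambda>(s, t, u). cycle3 s t u) y = (\<lambda>(s, t, u). cycle3 s t u) x}
      = {(s, t, u), (t, u, s), (u, s, t)}"
    proof -
      have "(t, u, s) \<in> distinct_triples A" "(u, s, t) \<in> distinct_triples A"
        using that by (auto simp: x distinct_triples_def)
      then show ?thesis using that cycle3_eq_iff[OF that[unfolded x]] unfolding x by auto
    qed
    moreover have "s \<noteq> t" "s \<noteq> u" "t \<noteq> u" using that by (auto simp: x distinct_triples_def)
    ultimately show ?thesis by simp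
  qed
  from sum_fibres[OF finite_distinct_triples[OF assms] this, of h]
  show ?thesis by (simp add: k_cycles_3 case_prod_beta)
qed

lemma k_cycles_permutes:
  "g \<in> k_cycles A 2 \<Longrightarrow> g permutes A" "g \<in> k_cycles A 3 \<Longrightarrow> g permutes A"
  by (auto simp: k_cycles_2 k_cycles_3 distinct_pairs_def distinct_triples_def cycle3_def
      intro!: permutes_compose permutes_swap_id)

lemma transpose_conj: "p permutes A \<Longrightarrow> p \<circ> transpose s t \<circ> pinv p = transpose (p s) (p t)"
proof
  fix x assume p: "p permutes A"
  show "(p \<circ> transpose s t \<circ> pinv p) x = transpose (p s) (p t) x"
    using permutes_inverses[OF p] by (auto simp: transpose_def)
qed

lemma cycle3_conj:
  assumes p: "p permutes A"
  shows "p \<circ> cycle3 s t u \<circ> pinv p = cycle3 (p s) (p t) (p u)"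
proof -
  have "p \<circ> cycle3 s t u \<circ> pinv p
      = (p \<circ> transpose s t \<circ> pinv p) \<circ> (p \<circ> transpose t u \<circ> pinv p)"
    unfolding cycle3_def using permutes_inverses[OF p] by (auto simp: fun_eq_iff)
  then show ?thesis by (simp add: transpose_conj[OF p] cycle3_def)
qed

lemma k_cycles_conj:
  assumes p: "p permutes A"
  shows "g \<in> k_cycles A 2 \<Longrightarrow> p \<circ> g \<circ> pinv p \<in> k_cycles A 2"
    "g \<in> k_cycles A 3 \<Longrightarrow> p \<circ> g \<circ> pinv p \<in> k_cycles A 3"
proof -
  note ip = permutes_in_image[OF p] inj_eq[OF permutes_inj[OF p]]
  show "p \<circ> g \<circ> pinv p \<in> k_cycles A 2" if k: "g \<in> k_cycles A 2"
  proof -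
    obtain s t where g: "g = transpose s t" "(s, t) \<in> distinct_pairs A"
      using k by (auto simp: k_cycles_2)
    then have "(p s, p t) \<in> distinct_pairs A" by (simp add: distinct_pairs_def ip)
    then show ?thesis by (force simp: g(1) transpose_conj[OF p] k_cycles_2)
  qed
  show "p \<circ> g \<circ> pinv p \<in> k_cycles A 3" if k: "g \<in> k_cycles A 3"
  proof -
    obtain s t u where g: "g = cycle3 s t u" "(s, t, u) \<in> distinct_triples A"
      using k by (auto simp: k_cycles_3)
    then have "(p s, p t, p u) \<in> distinct_triples A" by (simp add: distinct_triples_def ip)
    then show ?thesis by (force simp: g(1) cycle3_conj[OF p] k_cycles_3)
  qed
qed

subsection \<open>Contents of a diagram\<close>

text \<open>The argument \<open>y\<close> may lie outside \<open>D\<close>: in the induction it is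
  also the box just removed.\<close>

definition row_card :: "(nat \<times> nat) set \<Rightarrow> nat \<times> nat \<Rightarrow> int" where
  "row_card D y = int (card {x\<in>D. fst x = fst y})"

definition col_card :: "(nat \<times> nat) set \<Rightarrow> nat \<times> nat \<Rightarrow> int" where
  "col_card D y = int (card {x\<in>D. snd x = snd y})"

text \<open>In a row of length \<open>l\<close> and a column of length \<open>m\<close>, a box is the first of \<open>(l - 1) (l - 2)\<close> triples in
  the row and \<open>(m - 1) (m - 2)\<close> triples in the column, and the corner of \<open>(l - 1) (m - 1)\<close> hooks. Each hook
  is counted with sign \<open>-1\<close> by three ordered triples, the rotations of its 3-cycle.\<close>

definition hook_weight :: "int \<Rightarrow> int \<Rightarrow> int" where
  "hook_weight l m = (l - 1) * (l - 2) + (m - 1) * (m - 2) - 3 * (l - 1) * (m - 1)"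

lemma hook_weight_Suc:
  "hook_weight (l + 1) m = hook_weight l m + (2 * (l - 1) - 3 * (m - 1))"
  "hook_weight l (m + 1) = hook_weight l m + (2 * (m - 1) - 3 * (l - 1))"
  by (simp_all add: hook_weight_def algebra_simps)

lemma row_image: "{x\<in>D. fst x = r} = Pair r ` {j. (r, j) \<in> D}"
  and col_image: "{x\<in>D. snd x = c} = (\<lambda>i. (i, c)) ` {i. (i, c) \<in> D}"
  by force+

text \<open>Induction on the number of boxes. The last box (r, c) of the last row has
  \<open>c\<close> boxes to its left and \<open>r\<close> above it. Taking the last row makes all
  columns to its left have exactly r + 1 boxes, and the rows above enter only through their total
  length. The first sum grows by twice the content, the weight by 3 times its square minus 3 n. The
  second identity is doubled to stay in the integers.\<close>

lemma content_count:
  assumes "finite D" and "\<And>i j i' j'. (i, j) \<in> D \<Longrightarrow> i' \<le> i \<Longrightarrow> j' \<le> j \<Longrightarrow> (i', j') \<in> D"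
  shows "(\<Sum>y\<in>D. row_card D y - col_card D y) = 2 * (\<Sum>y\<in>D. box_content y) \<and>
    2 * (\<Sum>y\<in>D. hook_weight (row_card D y) (col_card D y))
      = 6 * (\<Sum>y\<in>D. (box_content y)\<^sup>2) - 3 * int (card D) * (int (card D) - 1)"
  using assms
proof (induction "card D" arbitrary: D)
  case 0
  then show ?case by simp
next
  case (Suc n D')
  \<comment> \<open>the last box of the last row\<close>
  define r where "r = Max (fst ` D')"
  define c where "c = Max {c. (r, c) \<in> D'}"
  have ne: "D' \<noteq> {}" using Suc.hyps by auto
  have "r \<in> fst ` D'" unfolding r_def using Suc.prems(1) ne by (intro Max_in) auto
  then have "{c. (r, c) \<in> D'} \<noteq> {}" by force
  moreover have finc: "finite {c. (r, c) \<in> D'}"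
    by (rule finite_subset[of _ "snd ` D'"]) (use Suc.prems(1) in force)+
  ultimately have m: "(r, c) \<in> D'" unfolding c_def using Max_in by blast
  have r_max: "i \<le> r" if "(i, j) \<in> D'" for i j
    unfolding r_def using Suc.prems(1) that by (intro Max_ge) force+
  have c_max: "j \<le> c" if "(r, j) \<in> D'" for j
    unfolding c_def using finc that by (intro Max_ge) auto
  define D where "D = D' - {(r, c)}"
  have D': "D' = insert (r, c) D" and nD: "(r, c) \<notin> D" using m by (auto simp: D_def)
  have fin: "finite D" using Suc.prems(1) by (simp add: D_def)
  have down: "(i', j') \<in> D" if "(i, j) \<in> D" "i' \<le> i" "j' \<le> j" for i j i' j'
  proof -
    have "(i', j') \<in> D'" using Suc.prems(2)[of i j i' j'] that by (auto simp: D_def)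
    moreover have "(i', j') \<noteq> (r, c)"
    proof
      assume "(i', j') = (r, c)"
      then have "i = r" "j = c" using that r_max[of i j] c_max[of j] by (auto simp: D_def)
      then show False using that nD by simp
    qed
    ultimately show ?thesis by (simp add: D_def)
  qed
  have card_D: "card D = n" using Suc.hyps(2) D' nD fin by simp
  have IH: "(\<Sum>y\<in>D. row_card D y - col_card D y) = 2 * (\<Sum>y\<in>D. box_content y) \<and>
    2 * (\<Sum>y\<in>D. hook_weight (row_card D y) (col_card D y))
      = 6 * (\<Sum>y\<in>D. (box_content y)\<^sup>2) - 3 * int (card D) * (int (card D) - 1)"
    by (rule Suc.hyps(1)[OF card_D[symmetric] fin]) (rule down)
  have row: "{x\<in>D. fst x = r} = Pair r ` {..<c}"
  proof -
    have "(r, j) \<in> D \<longleftrightarrow> j < c" for j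
      using Suc.prems(2)[OF m, of r j] c_max[of j] nD by (fastforce simp: D_def)
    then show ?thesis by (simp add: row_image lessThan_def)
  qed
  have col: "{x\<in>D. snd x = c} = (\<lambda>i. (i, c)) ` {..<r}"
  proof -
    have "(i, c) \<in> D \<longleftrightarrow> i < r" for i
      using Suc.prems(2)[OF m, of i c] r_max[of i c] nD by (fastforce simp: D_def)
    then show ?thesis by (simp add: col_image lessThan_def)
  qed
  \<comment> \<open>Every box of the last row left of the removed one is the bottom of its column,
    hence length r + 1.\<close>
  have colj: "{x\<in>D. snd x = j} = (\<lambda>i. (i, j)) ` {..r}" if "j < c" for j
  proof -
    have "(i, j) \<in> D \<longleftrightarrow> i \<le> r" for i
      using Suc.prems(2)[OF m, of i j] r_max[of i j] that by (auto simp: D_def)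
    then show ?thesis by (simp add: col_image atMost_def)
  qed
  have row_r: "row_card D y = int c" if "fst y = r" for y
    using row that by (simp add: row_card_def card_image inj_on_def)
  have col_c: "col_card D y = int r" if "snd y = c" for y
    using col that by (simp add: col_card_def card_image inj_on_def)
  have col_j: "col_card D y = int r + 1" if "snd y < c" for y
    using colj that by (simp add: col_card_def card_image inj_on_def)
  have row': "row_card D' y = row_card D y + of_bool (fst y = r)" for y
  proof -
    have "{x\<in>D'. fst x = fst y} = (if fst y = r then insert (r, c) {x\<in>D. fst x = fst y} else {x\<in>D. fst x = fst y})"
      using D' by auto
    then show ?thesis using nD fin by (simp add: row_card_def)
  qed
  have col': "col_card D' y = col_card D y + of_bool (snd y = c)" for y
  proof -
    have "{x\<in>D'. snd x = snd y} = (if snd y = c then insert (r, c) {x\<in>D. snd x = snd y} else {x\<in>D. snd x = snd y})"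
      using D' by auto
    then show ?thesis using nD fin by (simp add: col_card_def)
  qed
  have sum_row: "(\<Sum>y\<in>D. of_bool (fst y = r) * g y) = (\<Sum>j<c. g (r, j))" for g :: "nat \<times> nat \<Rightarrow> int"
  proof -
    have "(\<Sum>y\<in>D. of_bool (fst y = r) * g y) = (\<Sum>y\<in>{x\<in>D. fst x = r}. g y)"
      unfolding sum.inter_filter[OF fin] by (rule sum.cong) auto
    then show ?thesis by (simp add: row sum.reindex inj_on_def)
  qed
  have sum_col: "(\<Sum>y\<in>D. of_bool (snd y = c) * g y) = (\<Sum>i<r. g (i, c))" for g :: "nat \<times> nat \<Rightarrow> int"
  proof -
    have "(\<Sum>y\<in>D. of_bool (snd y = c) * g y) = (\<Sum>y\<in>{x\<in>D. snd x = c}. g y)"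
      unfolding sum.inter_filter[OF fin] by (rule sum.cong) auto
    then show ?thesis by (simp add: col sum.reindex inj_on_def)
  qed
  \<comment> \<open>The rows above the last one that meet column \<open>c\<close> are all the rows
    above it, so their lengths add up to the boxes of \<open>D\<close> outside row
    \<open>r\<close>.\<close>
  have above: "(\<Sum>i<r. row_card D (i, c)) = int n - int c"
  proof -
    have "D = (\<Union>i\<in>{..<r}. {x\<in>D. fst x = i}) \<union> {x\<in>D. fst x = r}"
      using r_max by (force simp: D_def)
    then have "card D = card ((\<Union>i\<in>{..<r}. {x\<in>D. fst x = i}) \<union> {x\<in>D. fst x = r})" by simp
    also have "\<dots> = card (\<Union>i\<in>{..<r}. {x\<in>D. fst x = i}) + card {x\<in>D. fst x = r}"
      using fin by (intro card_Un_disjoint) auto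
    also have "card (\<Union>i\<in>{..<r}. {x\<in>D. fst x = i}) = (\<Sum>i<r. card {x\<in>D. fst x = i})"
      using fin by (intro card_UN_disjoint) auto
    also have "card {x\<in>D. fst x = r} = c" using row by (simp add: card_image inj_on_def)
    finally show ?thesis by (simp add: row_card_def card_D)
  qed
  \<comment> \<open>The new box contributes (c + 1) - (r + 1). The \<open>c\<close> boxes of its row
    gain 1 each and the \<open>r\<close> boxes of its column lose 1 each.\<close>
  have A: "(\<Sum>y\<in>D'. row_card D' y - col_card D' y) = (\<Sum>y\<in>D. row_card D y - col_card D y) + 2 * box_content (r, c)"
  proof -
    have "(\<Sum>y\<in>D'. row_card D' y - col_card D' y)
      = int c + 1 - (int r + 1) + (\<Sum>y\<in>D. (row_card D y - col_card D y) + of_bool (fst y = r) * 1 - of_bool (snd y = c) * 1)"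
      unfolding row' col' by (simp add: D' nD fin row_r col_c algebra_simps)
    also have "\<dots> = int c - int r + (\<Sum>y\<in>D. row_card D y - col_card D y) + (\<Sum>y\<in>D. of_bool (fst y = r) * 1) - (\<Sum>y\<in>D. of_bool (snd y = c) * 1)"
      by (simp only: sum.distrib sum_subtractf)
    finally show ?thesis unfolding sum_row sum_col by (simp add: box_content_def)
  qed
  have B: "(\<Sum>y\<in>D'. hook_weight (row_card D' y) (col_card D' y))
    = (\<Sum>y\<in>D. hook_weight (row_card D y) (col_card D y)) + 3 * (box_content (r, c))\<^sup>2 - 3 * int n"
  proof -
    \<comment> \<open>The two corrections never meet in one box, since the only box in both row
      \<open>r\<close> and column \<open>c\<close> is the removed one.\<close>
    have *: "hook_weight (row_card D' y) (col_card D' y) = hook_weight (row_card D y) (col_card D y)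
        + of_bool (fst y = r) * (2 * (row_card D y - 1) - 3 * (col_card D y - 1))
        + of_bool (snd y = c) * (2 * (col_card D y - 1) - 3 * (row_card D y - 1))" if "y \<in> D" for y
    proof -
      have "\<not> (fst y = r \<and> snd y = c)" using nD that by (metis prod.collapse)
      then show ?thesis unfolding row' col' by (auto simp: hook_weight_Suc)
    qed
    have "(\<Sum>y\<in>D'. hook_weight (row_card D' y) (col_card D' y))
      = hook_weight (int c + 1) (int r + 1) + (\<Sum>y\<in>D. hook_weight (row_card D' y) (col_card D' y))"
      by (subst D', subst sum.insert) (auto simp: nD fin row' col' row_r col_c)
    also have "(\<Sum>y\<in>D. hook_weight (row_card D' y) (col_card D' y)) = (\<Sum>y\<in>D. hook_weight (row_card D y) (col_card D y)
        + of_bool (fst y = r) * (2 * (row_card D y - 1) - 3 * (col_card D y - 1))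
        + of_bool (snd y = c) * (2 * (col_card D y - 1) - 3 * (row_card D y - 1)))"
      by (rule sum.cong[OF refl *])
    also have "\<dots> = (\<Sum>y\<in>D. hook_weight (row_card D y) (col_card D y))
        + (\<Sum>j<c. 2 * (row_card D (r, j) - 1) - 3 * (col_card D (r, j) - 1))
        + (\<Sum>i<r. 2 * (col_card D (i, c) - 1) - 3 * (row_card D (i, c) - 1))"
      by (simp only: sum.distrib sum_row sum_col)
    also have "(\<Sum>j<c. 2 * (row_card D (r, j) - 1) - 3 * (col_card D (r, j) - 1))
      = int c * (2 * (int c - 1) - 3 * int r)"
      by (simp add: row_r col_j)
    also have "(\<Sum>i<r. 2 * (col_card D (i, c) - 1) - 3 * (row_card D (i, c) - 1))
      = int r * (2 * (int r - 1) + 3) - 3 * (int n - int c)"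
      by (simp add: col_c sum_subtractf above algebra_simps flip: sum_distrib_left)
    finally show ?thesis
      by (simp add: hook_weight_def box_content_def algebra_simps power2_eq_square)
  qed
  have n': "int (card D') = int n + 1" using Suc.hyps(2) by simp
  have "(\<Sum>y\<in>D'. box_content y) = box_content (r, c) + (\<Sum>y\<in>D. box_content y)"
    "(\<Sum>y\<in>D'. (box_content y)\<^sup>2) = (box_content (r, c))\<^sup>2 + (\<Sum>y\<in>D. (box_content y)\<^sup>2)"
    unfolding D' using nD fin by simp_all
  then show ?case using A B IH unfolding n' card_D by (simp add: algebra_simps)
qed

section \<open>Class sums on Specht modules\<close>

text \<open>The 3 comes from the three ordered triples of a 3-cycle, the doubled count from
  \<open>content_count\<close>.\<close>

lemma scalar_of_count:
  fixes x :: complex and y c n :: int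
  assumes "3 * x = of_int y" "2 * y = 6 * c - 3 * n * (n - 1)"
  shows "x = of_int c - of_int n * (of_int n - 1) / 2"
proof -
  have "of_int (2 * y) = (of_int (6 * c - 3 * n * (n - 1)) :: complex)"
    unfolding assms(2) ..
  then have "6 * x = 6 * of_int c - 3 * of_int n * (of_int n - 1)"
    unfolding of_int_mult assms(1)[symmetric] by simp
  then have "3 * (2 * x) = 3 * (2 * of_int c - of_int n * (of_int n - 1))"
    by (simp add: algebra_simps)
  then have "2 * x = 2 * of_int c - of_int n * (of_int n - 1)"
    by (rule mult_left_cancel[THEN iffD1, rotated]) simp
  then show ?thesis by (simp add: field_simps)
qed

section \<open>Coefficients at transpositions and 3-cycles\<close>

context tableau
begin

text \<open>A transposition inside a row is a row permutation, one inside a column an odd column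
  permutation. Any other transposition has no factorization: the column part could only permute
  \<open>s\<close> and \<open>t\<close>, and neither has the row of \<open>t\<close> and the column
  of \<open>s\<close>.\<close>

lemma ys_transpose:
  assumes st: "s \<in> A" "t \<in> A" "s \<noteq> t"
  shows "ys (transpose s t) = of_bool (rw s = rw t) - of_bool (cl s = cl t)"
proof -
  consider "rw s = rw t" "cl s \<noteq> cl t" | "rw s \<noteq> rw t" "cl s = cl t" | "rw s \<noteq> rw t" "cl s \<noteq> cl t"
    using st box_eqI by blast
  then show ?thesis
  proof cases
    case 1
    have "ys (transpose s t \<circ> id) = 1"
      using ys_prod[OF transpose_R[OF st(1,2) 1(1)] id_C] by simp
    then show ?thesis using 1 by simp
  next
    case 2
    have "ys (id \<circ> transpose s t) = - 1"
      using ys_prod[OF id_R transpose_C[OF st(1,2) 2(2)]] st(3) by (simp add: sign_swap_id)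
    then show ?thesis using 2 by simp
  next
    case 3
    have "ys (transpose s t) = 0"
    proof (rule ys_0)
      fix p q assume pq: "p \<in> R" "q \<in> C"
      show "p \<circ> q \<noteq> transpose s t"
      proof
        assume *: "p \<circ> q = transpose s t"
        have row: "rw (q x) = rw (transpose s t x)" if "x \<in> A" for x
          using rw_R[OF pq(1), of "q x"] that C_permutes[OF pq(2)] fun_cong[OF *, of x]
          by (simp add: permutes_in_image)
        note qA = permutes_in_image[OF C_permutes[OF pq(2)]]
        \<comment> \<open>Outside \<open>s\<close> and \<open>t\<close> the product is the identity,
          so \<open>q\<close> preserves the row as well as the column.\<close>
        have fixed: "q x = x" if "x \<in> A" "x \<noteq> s" "x \<noteq> t" for x
          using box_eqI[of "q x" x] row[OF that(1)] cl_C[OF pq(2) that(1)] that qA by simp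
        have "q s = s \<or> q s = t"
        proof (rule ccontr)
          assume "\<not> (q s = s \<or> q s = t)"
          then have "q (q s) = q s" using fixed[of "q s"] st(1) qA by simp
          then have "q s = s" using permutes_inj[OF C_permutes[OF pq(2)]] by (simp add: inj_eq)
          then show False using \<open>\<not> (q s = s \<or> q s = t)\<close> by simp
        qed
        moreover have "rw (q s) = rw t" "cl (q s) = cl s"
          using row[OF st(1)] cl_C[OF pq(2) st(1)] by simp_all
        ultimately show False using 3 by auto
      qed
    qed
    then show ?thesis using 3 by simp
  qed
qed

text \<open>A 3-cycle in a row or in a column is an even element of \<open>R\<close> or
  \<open>C\<close>. If the first two entries share a row and the last two a column, (s t)(t u) is
  already a row times a column transposition, hence -1; the other two hooks are rotations of this
  one.\<close>

lemma ys_cycle3: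
  assumes stu: "(s, t, u) \<in> distinct_triples A"
  shows "ys (cycle3 s t u) = of_bool (rw s = rw t \<and> rw t = rw u) + of_bool (cl s = cl t \<and> cl t = cl u)
    - of_bool (rw s = rw t \<and> cl t = cl u) - of_bool (rw t = rw u \<and> cl u = cl s)
    - of_bool (rw u = rw s \<and> cl s = cl t)"
proof -
  have A: "s \<in> A" "t \<in> A" "u \<in> A" and d: "s \<noteq> t" "s \<noteq> u" "t \<noteq> u"
    using stu by (auto simp: distinct_triples_def)
  have ne: "\<not> (rw s = rw t \<and> cl s = cl t)" "\<not> (rw s = rw u \<and> cl s = cl u)"
    "\<not> (rw t = rw u \<and> cl t = cl u)"
    using A d box_eqI by blast+
  have rot: "cycle3 s t u = cycle3 t u s" "cycle3 s t u = cycle3 u s t"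
    using d by (auto simp: cycle3_def fun_eq_iff transpose_def)
  have hook: "ys (cycle3 x y z) = - 1"
    if "x \<in> A" "y \<in> A" "z \<in> A" "y \<noteq> z" "rw x = rw y" "cl y = cl z" for x y z
    unfolding cycle3_def
    using ys_prod[OF transpose_R[OF that(1,2,5)] transpose_C[OF that(2,3,6)]] that(4)
    by (simp add: sign_swap_id)
  consider (row) "rw s = rw t" "rw t = rw u" | (col) "cl s = cl t" "cl t = cl u"
    | (1) "rw s = rw t" "cl t = cl u" | (2) "rw t = rw u" "cl u = cl s" | (3) "rw u = rw s" "cl s = cl t"
    | (none) "\<not> (rw s = rw t \<and> rw t = rw u)" "\<not> (cl s = cl t \<and> cl t = cl u)"
     "\<not> (rw s = rw t \<and> cl t = cl u)" "\<not> (rw t = rw u \<and> cl u = cl s)" "\<not> (rw u = rw s \<and> cl s = cl t)"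
    by blast
  then show ?thesis
  proof cases
    case row
    have "cycle3 s t u \<in> R"
      unfolding cycle3_def using A row by (intro R_comp transpose_R) auto
    then have "ys (cycle3 s t u \<circ> id) = 1" using ys_prod[OF _ id_C] by simp
    moreover have "cl s \<noteq> cl t" "cl t \<noteq> cl u" "cl u \<noteq> cl s" using row ne by auto
    ultimately show ?thesis using row by simp
  next
    case col
    have C: "transpose s t \<in> C" "transpose t u \<in> C"
      using A col by (auto intro: transpose_C)
    have "sign (transpose s t \<circ> transpose t u) = 1"
      using sign_comp_permutes[OF C_permutes[OF C(1)] C_permutes[OF C(2)] finite_A] d
      by (simp add: sign_swap_id)
    then have "ys (id \<circ> cycle3 s t u) = 1"
      using ys_prod[OF id_R C_comp[OF C]] by (simp add: cycle3_def)
    moreover have "rw s \<noteq> rw t" "rw t \<noteq> rw u" "rw u \<noteq> rw s" using col ne by auto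
    ultimately show ?thesis using col by simp
  next
    case 1
    moreover have "rw t \<noteq> rw u" "rw u \<noteq> rw s" "cl s \<noteq> cl t" "cl u \<noteq> cl s" using 1 ne by auto
    ultimately show ?thesis using hook[of s t u] A d by simp
  next
    case 2
    moreover have "rw u \<noteq> rw s" "rw s \<noteq> rw t" "cl t \<noteq> cl u" "cl s \<noteq> cl t" using 2 ne by auto
    ultimately show ?thesis using hook[of t u s] A d by (simp add: rot(1))
  next
    case 3
    moreover have "rw s \<noteq> rw t" "rw t \<noteq> rw u" "cl u \<noteq> cl s" "cl t \<noteq> cl u" using 3 ne by auto
    ultimately show ?thesis using hook[of u s t] A d by (simp add: rot(2))
  next
    case none
    have "ys (cycle3 s t u) = 0"
    proof (rule ys_0)
      fix p q assume pq: "p \<in> R" "q \<in> C"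
      show "p \<circ> q \<noteq> cycle3 s t u"
      proof
        assume *: "p \<circ> q = cycle3 s t u"
        note qA = permutes_in_image[OF C_permutes[OF pq(2)]]
        note qi = inj_eq[OF permutes_inj[OF C_permutes[OF pq(2)]]]
        have row: "rw (q x) = rw (cycle3 s t u x)" if "x \<in> A" for x
          using rw_R[OF pq(1), of "q x"] that qA fun_cong[OF *, of x] by simp
        have fixed: "q x = x" if "x \<in> A" "x \<noteq> s" "x \<noteq> t" "x \<noteq> u" for x
          using box_eqI[of "q x" x] row[OF that(1)] cl_C[OF pq(2) that(1)] that qA d by simp
        have img: "q x \<in> {s, t, u}" if "x \<in> {s, t, u}" for x
        proof (rule ccontr)
          assume *: "q x \<notin> {s, t, u}"
          have "x \<in> A" using that A by auto
          then have "q (q x) = q x" using fixed[of "q x"] * qA by simp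
          then show False using * that qi by simp
        qed
        have r: "rw (q s) = rw t" "rw (q t) = rw u" "rw (q u) = rw s"
          using row A d by simp_all
        have c: "cl (q s) = cl s" "cl (q t) = cl t" "cl (q u) = cl u"
          using cl_C[OF pq(2)] A by simp_all
        have i: "q s \<noteq> q t" "q s \<noteq> q u" "q t \<noteq> q u" using d qi by auto
        \<comment> \<open>Each of the six permutations of the three entries, with the rows in
          \<open>r\<close> and the columns in \<open>c\<close>, forces one of the five positions
          excluded by \<open>none\<close>: even ones a row or a column, odd ones a hook.\<close>
        have "q s = s \<or> q s = t \<or> q s = u" "q t = s \<or> q t = t \<or> q t = u" "q u = s \<or> q u = t \<or> q u = u"
          using img by auto
        then show False
        proof (elim disjE)
        qed (use r c i none in \<open>simp_all\<close>)
      qed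
    qed
    then show ?thesis by (simp only: none of_bool_eq) simp
  qed
qed

section \<open>Counting pairs, triples and hooks by row and column lengths\<close>

lemma card_rw: "s \<in> A \<Longrightarrow> int (card {t\<in>A. rw t = rw s}) = row_card D (rw s, cl s)"
  and card_cl: "s \<in> A \<Longrightarrow> int (card {t\<in>A. cl t = cl s}) = col_card D (rw s, cl s)"
proof -
  have *: "card {t\<in>A. P (rw t, cl t)} = card {x\<in>D. P x}" for P
  proof (rule bij_betw_same_card[symmetric, of T])
    show "bij_betw T {x\<in>D. P x} {t\<in>A. P (rw t, cl t)}"
      unfolding bij_betw_def
    proof
      show "inj_on T {x\<in>D. P x}"
        using bij_betw_imp_inj_on[OF bij_T] by (rule inj_on_subset) auto
      show "T ` {x\<in>D. P x} = {t\<in>A. P (rw t, cl t)}"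
      proof (intro equalityI subsetI)
        fix t assume "t \<in> {t\<in>A. P (rw t, cl t)}"
        then have "T (rw t, cl t) = t" "(rw t, cl t) \<in> {x\<in>D. P x}"
          using T_box box_in by auto
        then show "t \<in> T ` {x\<in>D. P x}" by (intro image_eqI[where x = "(rw t, cl t)"]) simp_all
      qed (auto simp: T_in)
    qed
  qed
  show "int (card {t\<in>A. rw t = rw s}) = row_card D (rw s, cl s)"
    "int (card {t\<in>A. cl t = cl s}) = col_card D (rw s, cl s)"
    using *[of "\<lambda>x. fst x = rw s"] *[of "\<lambda>x. snd x = cl s"]
    unfolding row_card_def col_card_def fst_conv snd_conv by simp_all
qed

lemma sum_box: "(\<Sum>s\<in>A. f (rw s, cl s)) = (\<Sum>x\<in>D. f x)"
  using sum.reindex_bij_betw[OF bij_T, of "\<lambda>s. f (rw s, cl s)"] by simp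

lemma int_card_remove: "finite S \<Longrightarrow> s \<in> S \<Longrightarrow> int (card (S - {s})) = int (card S) - 1"
  using card_Suc_Diff1[of S s] by simp

lemma card_pairs:
  fixes f :: "nat \<Rightarrow> nat"
  shows "int (card {x\<in>distinct_pairs A. f (fst x) = f (snd x)})
    = (\<Sum>s\<in>A. int (card {t\<in>A. f t = f s}) - 1)"
proof -
  have "{x\<in>distinct_pairs A. f (fst x) = f (snd x)} = (SIGMA s:A. {t\<in>A. f t = f s} - {s})"
    by (auto simp: distinct_pairs_def)
  then have "int (card {x\<in>distinct_pairs A. f (fst x) = f (snd x)})
    = (\<Sum>s\<in>A. int (card ({t\<in>A. f t = f s} - {s})))"
    using finite_A by simp
  also have "\<dots> = (\<Sum>s\<in>A. int (card {t\<in>A. f t = f s}) - 1)"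
    using finite_A by (intro sum.cong[OF refl] int_card_remove) auto
  finally show ?thesis .
qed

lemma card_triples:
  fixes f :: "nat \<Rightarrow> nat"
  shows "int (card {x\<in>distinct_triples A. case x of (s, t, u) \<Rightarrow> f s = f t \<and> f t = f u})
    = (\<Sum>s\<in>A. (int (card {t\<in>A. f t = f s}) - 1) * (int (card {t\<in>A. f t = f s}) - 2))"
proof -
  have "{x\<in>distinct_triples A. case x of (s, t, u) \<Rightarrow> f s = f t \<and> f t = f u}
      = (SIGMA s:A. SIGMA t:{t\<in>A. f t = f s} - {s}. {t\<in>A. f t = f s} - {s} - {t})"
    by (auto simp: distinct_triples_def)
  then have "int (card {x\<in>distinct_triples A. case x of (s, t, u) \<Rightarrow> f s = f t \<and> f t = f u})
    = (\<Sum>s\<in>A. \<Sum>t\<in>{t\<in>A. f t = f s} - {s}. int (card ({t\<in>A. f t = f s} - {s} - {t})))"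
    using finite_A by simp
  also have "\<dots> = (\<Sum>s\<in>A. (int (card {t\<in>A. f t = f s}) - 1) * (int (card {t\<in>A. f t = f s}) - 2))"
  proof (rule sum.cong[OF refl])
    fix s assume "s \<in> A"
    define S where "S = {t\<in>A. f t = f s}"
    have S: "finite S" "s \<in> S" using \<open>s \<in> A\<close> finite_A by (auto simp: S_def)
    note c = int_card_remove[OF S]
    have "int (card (S - {s} - {t})) = int (card S) - 2" if "t \<in> S - {s}" for t
      using int_card_remove[of "S - {s}" t] c that S by simp
    then have "(\<Sum>t\<in>S - {s}. int (card (S - {s} - {t}))) = (int (card S) - 1) * (int (card S) - 2)"
      using c by simp
    then show "(\<Sum>t\<in>{t\<in>A. f t = f s} - {s}. int (card ({t\<in>A. f t = f s} - {s} - {t})))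
       = (int (card {t\<in>A. f t = f s}) - 1) * (int (card {t\<in>A. f t = f s}) - 2)"
      by (simp add: S_def)
  qed
  finally show ?thesis .
qed

text \<open>Once the corner \<open>t\<close> is fixed, the two arms are chosen independently: they
  cannot coincide, because an entry in both the row and the column of \<open>t\<close> is
  \<open>t\<close> itself.\<close>

lemma card_hooks:
  "int (card {x\<in>distinct_triples A. case x of (s, t, u) \<Rightarrow> rw s = rw t \<and> cl t = cl u})
    = (\<Sum>t\<in>A. (int (card {s\<in>A. rw s = rw t}) - 1) * (int (card {u\<in>A. cl u = cl t}) - 1))"
proof -
  have "card {x\<in>distinct_triples A. case x of (s, t, u) \<Rightarrow> rw s = rw t \<and> cl t = cl u}
      = card (SIGMA t:A. ({s\<in>A. rw s = rw t} - {t}) \<times> ({u\<in>A. cl u = cl t} - {t}))"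
    by (rule bij_betw_same_card[of "\<lambda>(s, t, u). (t, s, u)"],
        rule bij_betw_byWitness[of _ "\<lambda>(t, s, u). (s, t, u)"])
      (auto simp: distinct_triples_def dest: box_eqI)
  also have "\<dots> = (\<Sum>t\<in>A. card ({s\<in>A. rw s = rw t} - {t}) * card ({u\<in>A. cl u = cl t} - {t}))"
    using finite_A by (simp add: card_cartesian_product)
  finally have "int (card {x\<in>distinct_triples A. case x of (s, t, u) \<Rightarrow> rw s = rw t \<and> cl t = cl u})
    = (\<Sum>t\<in>A. int (card ({s\<in>A. rw s = rw t} - {t})) * int (card ({u\<in>A. cl u = cl t} - {t})))"
    by simp
  also have "\<dots> = (\<Sum>t\<in>A. (int (card {s\<in>A. rw s = rw t}) - 1) * (int (card {u\<in>A. cl u = cl t}) - 1))"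
  proof (rule sum.cong[OF refl])
    fix t assume t: "t \<in> A"
    show "int (card ({s\<in>A. rw s = rw t} - {t})) * int (card ({u\<in>A. cl u = cl t} - {t}))
      = (int (card {s\<in>A. rw s = rw t}) - 1) * (int (card {u\<in>A. cl u = cl t}) - 1)"
      using t finite_A by (intro arg_cong2[where f = "(*)"] int_card_remove) auto
  qed
  finally show ?thesis .
qed

lemma card_A: "card D = card A"
  using bij_T by (rule bij_betw_same_card)

lemma content_counts:
  "(\<Sum>y\<in>D. row_card D y - col_card D y) = 2 * (\<Sum>y\<in>D. box_content y)"
  "2 * (\<Sum>y\<in>D. hook_weight (row_card D y) (col_card D y))
      = 6 * (\<Sum>y\<in>D. (box_content y)\<^sup>2) - 3 * int (card A) * (int (card A) - 1)"
proof -
  have "(\<Sum>y\<in>D. row_card D y - col_card D y) = 2 * (\<Sum>y\<in>D. box_content y) \<and>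
    2 * (\<Sum>y\<in>D. hook_weight (row_card D y) (col_card D y))
      = 6 * (\<Sum>y\<in>D. (box_content y)\<^sup>2) - 3 * int (card A) * (int (card A) - 1)"
    by (rule content_count[OF finite_D, unfolded card_A]) (rule down_closed)
  then show "(\<Sum>y\<in>D. row_card D y - col_card D y) = 2 * (\<Sum>y\<in>D. box_content y)"
    "2 * (\<Sum>y\<in>D. hook_weight (row_card D y) (col_card D y))
      = 6 * (\<Sum>y\<in>D. (box_content y)\<^sup>2) - 3 * int (card A) * (int (card A) - 1)"
    by simp_all
qed

lemma sum_ys_k_cycles_2: "(\<Sum>g\<in>k_cycles A 2. ys g) = of_int (\<Sum>x\<in>D. box_content x)"
proof -
  have "2 * (\<Sum>g\<in>k_cycles A 2. ys g) = (\<Sum>(s, t)\<in>distinct_pairs A. ys (transpose s t))"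
    by (rule sum_k_cycles_2[OF finite_A, symmetric])
  also have "\<dots> = (\<Sum>x\<in>distinct_pairs A. of_bool (rw (fst x) = rw (snd x)) - of_bool (cl (fst x) = cl (snd x)))"
    by (rule sum.cong) (auto simp: distinct_pairs_def ys_transpose)
  also have "\<dots> = of_int (int (card {x\<in>distinct_pairs A. rw (fst x) = rw (snd x)})
      - int (card {x\<in>distinct_pairs A. cl (fst x) = cl (snd x)}))"
    by (simp add: sum_subtractf Int_def finite_distinct_pairs finite_A)
  also have "\<dots> = of_int (\<Sum>s\<in>A. row_card D (rw s, cl s) - col_card D (rw s, cl s))"
    unfolding card_pairs by (simp add: card_rw card_cl sum_subtractf)
  also have "(\<Sum>s\<in>A. row_card D (rw s, cl s) - col_card D (rw s, cl s)) = 2 * (\<Sum>x\<in>D. box_content x)"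
    using sum_box[of "\<lambda>x. row_card D x - col_card D x"] content_counts(1) by simp
  finally show ?thesis by simp
qed

lemma sum_ys_k_cycles_3:
  "(\<Sum>g\<in>k_cycles A 3. ys g)
    = of_int (\<Sum>x\<in>D. (box_content x)\<^sup>2) - of_nat (card A) * (of_nat (card A) - 1) / 2"
proof -
  define N where "N P = int (card {x\<in>distinct_triples A. P x})" for P
  let ?T = "distinct_triples A"
  have fin: "finite ?T" using finite_A by (rule finite_distinct_triples)
  define r where "r = (\<lambda>x::nat \<times> nat \<times> nat. case x of (s, t, u) \<Rightarrow> rw s = rw t \<and> rw t = rw u)"
  define c where "c = (\<lambda>x::nat \<times> nat \<times> nat. case x of (s, t, u) \<Rightarrow> cl s = cl t \<and> cl t = cl u)"
  define h1 where "h1 = (\<lambda>x::nat \<times> nat \<times> nat. case x of (s, t, u) \<Rightarrow> rw s = rw t \<and> cl t = cl u)"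
  define h2 where "h2 = (\<lambda>x::nat \<times> nat \<times> nat. case x of (s, t, u) \<Rightarrow> rw t = rw u \<and> cl u = cl s)"
  define h3 where "h3 = (\<lambda>x::nat \<times> nat \<times> nat. case x of (s, t, u) \<Rightarrow> rw u = rw s \<and> cl s = cl t)"
  have 1: "3 * (\<Sum>g\<in>k_cycles A 3. ys g) = of_int (N r + N c - N h1 - N h2 - N h3)"
  proof -
    have "3 * (\<Sum>g\<in>k_cycles A 3. ys g) = (\<Sum>(s, t, u)\<in>?T. ys (cycle3 s t u))"
      by (rule sum_k_cycles_3[OF finite_A, symmetric])
    also have "\<dots> = (\<Sum>x\<in>?T. of_bool (r x) + of_bool (c x) - of_bool (h1 x) - of_bool (h2 x) - of_bool (h3 x))"
    proof (rule sum.cong[OF refl])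
      fix x assume "x \<in> ?T"
      moreover obtain s t u where x: "x = (s, t, u)" using prod_cases3 by blast
      ultimately show "(case x of (s, t, u) \<Rightarrow> ys (cycle3 s t u))
          = of_bool (r x) + of_bool (c x) - of_bool (h1 x) - of_bool (h2 x) - of_bool (h3 x)"
        using ys_cycle3[of s t u] by (simp only: r_def c_def h1_def h2_def h3_def prod.case)
    qed
    also have "\<dots> = of_int (N r + N c - N h1 - N h2 - N h3)"
      unfolding N_def by (simp add: sum_subtractf sum.distrib Int_def fin)
    finally show ?thesis .
  qed
  \<comment> \<open>Rotating a triple carries one kind of hook to another, so the three counts
    agree; this is the 3 in \<open>hook_weight\<close>.\<close>
  have 2: "N h2 = N h1"
  proof -
    have "bij_betw (\<lambda>(s, t, u). (t, u, s)) {x\<in>?T. h2 x} {x\<in>?T. h1 x}"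
      by (rule bij_betw_byWitness[of _ "\<lambda>(t, u, s). (s, t, u)"]) (auto simp: h1_def h2_def distinct_triples_def)
    from bij_betw_same_card[OF this] show ?thesis unfolding N_def by (rule arg_cong)
  qed
  have 3: "N h3 = N h1"
  proof -
    have "bij_betw (\<lambda>(s, t, u). (u, s, t)) {x\<in>?T. h3 x} {x\<in>?T. h1 x}"
      by (rule bij_betw_byWitness[of _ "\<lambda>(u, s, t). (s, t, u)"]) (auto simp: h1_def h3_def distinct_triples_def)
    from bij_betw_same_card[OF this] show ?thesis unfolding N_def by (rule arg_cong)
  qed
  have 4: "N r + N c - N h1 - N h1 - N h1
      = (\<Sum>s\<in>A. hook_weight (row_card D (rw s, cl s)) (col_card D (rw s, cl s)))"
  proof -
    have "N r = (\<Sum>s\<in>A. (row_card D (rw s, cl s) - 1) * (row_card D (rw s, cl s) - 2))"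
      using card_triples[of rw] by (simp add: N_def r_def card_rw)
    moreover have "N c = (\<Sum>s\<in>A. (col_card D (rw s, cl s) - 1) * (col_card D (rw s, cl s) - 2))"
      using card_triples[of cl] by (simp add: N_def c_def card_cl)
    moreover have "N h1 = (\<Sum>s\<in>A. (row_card D (rw s, cl s) - 1) * (col_card D (rw s, cl s) - 1))"
      using card_hooks by (simp add: N_def h1_def card_rw card_cl)
    moreover have "hook_weight l m = (l - 1) * (l - 2) + (m - 1) * (m - 2)
        - (l - 1) * (m - 1) - (l - 1) * (m - 1) - (l - 1) * (m - 1)" for l m
      by (simp add: hook_weight_def)
    ultimately show ?thesis by (simp only: sum.distrib sum_subtractf)
  qed
  have 5: "3 * (\<Sum>g\<in>k_cycles A 3. ys g) = of_int (\<Sum>x\<in>D. hook_weight (row_card D x) (col_card D x))"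
    unfolding 1 2 3 4 sum_box[of "\<lambda>x. hook_weight (row_card D x) (col_card D x)"] ..
  have "(\<Sum>g\<in>k_cycles A 3. ys g) = of_int (\<Sum>x\<in>D. (box_content x)\<^sup>2)
    - of_int (int (card A)) * (of_int (int (card A)) - 1) / 2"
    by (rule scalar_of_count[OF 5 content_counts(2)])
  then show ?thesis by (simp only: of_int_of_nat_eq)
qed

end

lemma tableau_diagram:
  assumes "finite A" "is_partition lam m" "bij_betw T (diagram lam) A"
  shows "tableau A (diagram lam) T"
proof
  fix i j i' j' assume *: "(i, j) \<in> diagram lam" "i' \<le> i" "j' \<le> j"
  have "lam ! i' \<ge> lam ! i"
  proof (cases "i' = i")
    case False
    then show ?thesis
      using assms(2) *(1,2) sorted_wrt_nth_less[of "(\<ge>)" lam i' i]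
      by (simp add: is_partition_def diagram_def)
  qed simp
  then show "(i', j') \<in> diagram lam" using * by (simp add: diagram_def)
qed (use assms in auto)

lemma card_partition:
  assumes "finite A" "is_partition lam m" "bij_betw T (diagram lam) A"
  shows "card A = m"
proof -
  have "diagram lam = (SIGMA r:{..<length lam}. {..<lam ! r})"
    by (auto simp: diagram_def)
  then have "card (diagram lam) = (\<Sum>r<length lam. lam ! r)" by simp
  also have "\<dots> = m"
    using assms(2) by (simp add: is_partition_def sum_list_sum_nth atLeast0LessThan)
  finally show ?thesis using bij_betw_same_card[OF assms(3)] by simp
qed

section \<open>Agreement with the stabilizers and the symmetrizer of a partition\<close>

context tableau
begin

text \<open>The stabilizers quantify over boxes, \<open>R\<close> and \<open>C\<close> over entries;
  \<open>T\<close> translates between them. One argument serves both, with \<open>fst\<close> or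
  \<open>snd\<close> for \<open>f\<close>.\<close>

lemma row_stabilizer_eq:
  assumes "D = diagram lam"
  shows "row_stabilizer A lam T = R" and "column_stabilizer A lam T = C"
proof -
  have *: "(\<forall>x\<in>D. \<exists>y\<in>D. f y = f x \<and> p (T x) = T y) \<longleftrightarrow> (\<forall>s\<in>A. f (rw (p s), cl (p s)) = f (rw s, cl s))"
    if p: "p permutes A" for p and f :: "nat \<times> nat \<Rightarrow> nat"
  proof (intro iffI ballI)
    fix s assume *: "\<forall>x\<in>D. \<exists>y\<in>D. f y = f x \<and> p (T x) = T y" and s: "s \<in> A"
    then obtain y where "y \<in> D" "f y = f (rw s, cl s)" "p s = T y"
      using *[rule_format, OF box_in[OF s]] T_box[OF s] by auto
    then show "f (rw (p s), cl (p s)) = f (rw s, cl s)" by simp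
  next
    fix x assume *: "\<forall>s\<in>A. f (rw (p s), cl (p s)) = f (rw s, cl s)" and x: "x \<in> D"
    have pA: "p (T x) \<in> A" using p T_in[OF x] by (simp add: permutes_in_image)
    let ?y = "(rw (p (T x)), cl (p (T x)))"
    have "?y \<in> D" "T ?y = p (T x)" "f ?y = f x"
      using box_in[OF pA] T_box[OF pA] *[rule_format, OF T_in[OF x]] x by simp_all
    then show "\<exists>y\<in>D. f y = f x \<and> p (T x) = T y" by metis
  qed
  show "row_stabilizer A lam T = R" "column_stabilizer A lam T = C"
    unfolding row_stabilizer_def column_stabilizer_def R_def C_def assms[symmetric]
    using *[of _ fst] *[of _ snd] unfolding fst_conv snd_conv by (blast intro: Collect_cong)+
qed

text \<open>In the convolution at \<open>w\<close> the row factor p forces the column factor p^-1 w,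
  so the inner sum of \<open>ys\<close> has at most one nonzero term.\<close>

lemma young_symmetrizer_eq:
  assumes "D = diagram lam"
  shows "young_symmetrizer A lam T = ys"
proof
  fix w
  show "young_symmetrizer A lam T w = ys w"
  proof (cases "w permutes A")
    case False
    have "ys w = 0"
    proof (rule ys_0)
      fix p q assume "p \<in> R" "q \<in> C"
      then have "p \<circ> q permutes A" by (intro permutes_compose R_permutes C_permutes)
      then show "p \<circ> q \<noteq> w" using False by metis
    qed
    then show ?thesis using False by (simp add: young_symmetrizer_def convolution_def)
  next
    case True
    have "young_symmetrizer A lam T w = (\<Sum>y | y permutes A. indicator R y *
        (of_int (sign (inv\<^bsub>perm_group_on A\<^esub> y \<circ> w)) * indicator C (inv\<^bsub>perm_group_on A\<^esub> y \<circ> w)))"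
      using True by (simp add: young_symmetrizer_def convolution_def row_stabilizer_eq[OF assms])
    also have "\<dots> = (\<Sum>p\<in>R. of_int (sign (pinv p \<circ> w)) * indicator C (pinv p \<circ> w))"
    proof (rule sum.mono_neutral_cong_right)
      show "finite {y. y permutes A}" by (rule finite_permutations[OF finite_A])
    qed (auto simp: R_permutes inv_perm_group_on)
    also have "\<dots> = ys w"
      unfolding ys_def
    proof (rule sum.cong[OF refl])
      fix p assume p: "p \<in> R"
      have "(\<Sum>q\<in>C. of_int (sign q) * indicator {w} (p \<circ> q))
          = (\<Sum>q\<in>C. if q = pinv p \<circ> w then of_int (sign q) else (0::complex))"
        using permutes_comp_eq_iff(1)[OF R_permutes[OF p]] by (intro sum.cong) (auto simp: indicator_def)
      also have "\<dots> = of_int (sign (pinv p \<circ> w)) * indicator C (pinv p \<circ> w)"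
        by (simp add: sum.delta finite_C indicator_def)
      finally show "of_int (sign (pinv p \<circ> w)) * indicator C (pinv p \<circ> w)
          = (\<Sum>q\<in>C. of_int (sign q) * indicator {w} (p \<circ> q) :: complex)" by simp
    qed
    finally show ?thesis .
  qed
qed

end

section \<open>The action of group algebra elements on vectors\<close>

lemma convolution_perm:
  assumes "w permutes A"
  shows "convolution (perm_group_on A) f h w = (\<Sum>y | y permutes A. f y * h (pinv y \<circ> w))"
  using assms by (auto simp: convolution_def inv_perm_group_on intro!: sum.cong)

lemma convolution_indicator:
  assumes "finite A" "g permutes A" "w permutes A"
  shows "convolution (perm_group_on A) (indicator {g}) h w = h (pinv g \<circ> w)"
proof -
  have "convolution (perm_group_on A) (indicator {g}) h w
      = (\<Sum>y | y permutes A. if y = g then h (pinv g \<circ> w) else 0)"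
    unfolding convolution_perm[OF assms(3)] by (intro sum.cong) auto
  then show ?thesis using assms finite_permutations[OF assms(1)] by simp
qed

lemma matrix_rep_carrier: "matrix_rep G d \<rho> \<Longrightarrow> g \<in> carrier G \<Longrightarrow> \<rho> g \<in> carrier_mat d d"
  by (auto simp: matrix_rep_def hom_def ring_mat_def)

lemma matrix_rep_mult:
  "matrix_rep G d \<rho> \<Longrightarrow> g \<in> carrier G \<Longrightarrow> h \<in> carrier G \<Longrightarrow> \<rho> (g \<otimes>\<^bsub>G\<^esub> h) = \<rho> g * \<rho> h"
  by (auto simp: matrix_rep_def hom_def ring_mat_def)

lemma algebra_action_carrier [simp]: "algebra_action G d \<rho> f \<in> carrier_mat d d"
  by (simp add: algebra_action_def)

lemma algebra_action_mult_vec: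
  assumes \<rho>: "matrix_rep G d \<rho>" and v: "v \<in> carrier_vec d"
  shows "algebra_action G d \<rho> f *\<^sub>v v = vec d (\<lambda>i. \<Sum>g\<in>carrier G. f g * (\<rho> g *\<^sub>v v) $ i)"
proof (rule eq_vecI)
  fix i assume "i < dim_vec (vec d (\<lambda>i. \<Sum>g\<in>carrier G. f g * (\<rho> g *\<^sub>v v) $ i))"
  then have i: "i < d" by simp
  have dv: "dim_vec v = d" using v by simp
  have g: "(\<rho> g *\<^sub>v v) $ i = (\<Sum>j<d. \<rho> g $$ (i, j) * v $ j)" if "g \<in> carrier G" for g
    using matrix_rep_carrier[OF \<rho> that] i dv
    by (simp add: scalar_prod_def atLeast0LessThan)
  have "(algebra_action G d \<rho> f *\<^sub>v v) $ i = (\<Sum>j<d. (\<Sum>g\<in>carrier G. f g * \<rho> g $$ (i, j)) * v $ j)"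
    using i dv by (simp add: algebra_action_def scalar_prod_def atLeast0LessThan)
  also have "\<dots> = (\<Sum>j<d. \<Sum>g\<in>carrier G. f g * (\<rho> g $$ (i, j) * v $ j))"
    by (simp add: sum_distrib_right mult.assoc)
  also have "\<dots> = (\<Sum>g\<in>carrier G. \<Sum>j<d. f g * (\<rho> g $$ (i, j) * v $ j))"
    by (rule sum.swap)
  also have "\<dots> = (\<Sum>g\<in>carrier G. f g * (\<rho> g *\<^sub>v v) $ i)"
    by (rule sum.cong[OF refl]) (simp add: g sum_distrib_left)
  finally show "(algebra_action G d \<rho> f *\<^sub>v v) $ i
      = vec d (\<lambda>i. \<Sum>g\<in>carrier G. f g * (\<rho> g *\<^sub>v v) $ i) $ i"
    using i by simp
qed (simp add: algebra_action_def)

lemma mat_eq_smult_one: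
  fixes A :: "complex mat"
  assumes A: "A \<in> carrier_mat d d" and "\<And>v. v \<in> carrier_vec d \<Longrightarrow> A *\<^sub>v v = c \<cdot>\<^sub>v v"
  shows "A = c \<cdot>\<^sub>m 1\<^sub>m d"
proof (rule eq_matI)
  fix i j assume "i < dim_row (c \<cdot>\<^sub>m 1\<^sub>m d :: complex mat)" "j < dim_col (c \<cdot>\<^sub>m 1\<^sub>m d :: complex mat)"
  then have ij: "i < d" "j < d" by simp_all
  have "(A *\<^sub>v unit_vec d j) $ i = A $$ (i, j)"
    using A ij by (simp add: scalar_prod_right_unit)
  moreover have "A *\<^sub>v unit_vec d j = c \<cdot>\<^sub>v unit_vec d j" using assms(2) by simp
  ultimately show "A $$ (i, j) = (c \<cdot>\<^sub>m 1\<^sub>m d) $$ (i, j)"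
    using ij by (simp add: unit_vec_def one_mat_def)
qed (use A in simp_all)

text \<open>Extends the two linearity clauses of \<open>specht_rep\<close> to finite combinations,
  so that the isomorphism can be pushed through the action of a class sum.\<close>

lemma additive_vec_sum:
  fixes \<phi> :: "complex vec \<Rightarrow> 'a \<Rightarrow> complex"
  assumes add: "\<And>u v. u \<in> carrier_vec d \<Longrightarrow> v \<in> carrier_vec d \<Longrightarrow> \<phi> (u + v) = (\<lambda>x. \<phi> u x + \<phi> v x)"
    and smult: "\<And>c v. v \<in> carrier_vec d \<Longrightarrow> \<phi> (c \<cdot>\<^sub>v v) = (\<lambda>x. c * \<phi> v x)"
    and "finite S" and w: "\<And>g. g \<in> S \<Longrightarrow> w g \<in> carrier_vec d"
  shows "\<phi> (vec d (\<lambda>i. \<Sum>g\<in>S. f g * w g $ i)) x = (\<Sum>g\<in>S. f g * \<phi> (w g) x)"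
  using \<open>finite S\<close> w
proof (induction S)
  case empty
  have "vec d (\<lambda>i. \<Sum>g\<in>{}. f g * w g $ i) = 0 \<cdot>\<^sub>v 0\<^sub>v d" by auto
  then show ?case using smult[of "0\<^sub>v d" 0] by simp
next
  case (insert g S)
  have wg: "w g \<in> carrier_vec d" using insert.prems by simp
  have "vec d (\<lambda>i. \<Sum>g\<in>insert g S. f g * w g $ i)
      = f g \<cdot>\<^sub>v w g + vec d (\<lambda>i. \<Sum>g\<in>S. f g * w g $ i)"
    using insert.hyps wg by (intro eq_vecI) auto
  moreover have "\<phi> (f g \<cdot>\<^sub>v w g + vec d (\<lambda>i. \<Sum>g\<in>S. f g * w g $ i))
      = (\<lambda>x. \<phi> (f g \<cdot>\<^sub>v w g) x + \<phi> (vec d (\<lambda>i. \<Sum>g\<in>S. f g * w g $ i)) x)"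
    using wg by (intro add) simp_all
  ultimately show ?case
    using insert.IH insert.prems insert.hyps smult[OF wg] by simp
qed

text \<open>On an element f c of the ideal the class sum moves past f, because \<open>K\<close> is
  closed under conjugation, and multiplies c by the scalar of \<open>class_sum_ys\<close>. The
  tableau is obtained before \<open>K\<close>, so that one tableau serves both 3-cycles and
  transpositions.\<close>

lemma specht_class_sum:
  assumes A: "finite A" and lam: "is_partition lam m" and \<sigma>: "specht_rep A lam d \<sigma>"
  obtains T where "tableau A (diagram lam) T" "card A = m"
    "\<And>K. \<forall>g\<in>K. g permutes A \<and> (\<forall>p. p permutes A \<longrightarrow> p \<circ> g \<circ> pinv p \<in> K) \<Longrightarrow>
      acts_by_scalar (perm_group_on A) d \<sigma> (indicator K) (\<Sum>g\<in>K. tableau.ys A (diagram lam) T g)"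
proof -
  let ?G = "perm_group_on A"
  obtain T \<phi> where T: "bij_betw T (diagram lam) A"
    and bij: "bij_betw \<phi> (carrier_vec d) (specht_ideal A lam T)"
    and add: "\<And>u v. u \<in> carrier_vec d \<Longrightarrow> v \<in> carrier_vec d \<Longrightarrow> \<phi> (u + v) = (\<lambda>x. \<phi> u x + \<phi> v x)"
    and smult: "\<And>c v. v \<in> carrier_vec d \<Longrightarrow> \<phi> (c \<cdot>\<^sub>v v) = (\<lambda>x. c * \<phi> v x)"
    and act: "\<And>g v. g permutes A \<Longrightarrow> v \<in> carrier_vec d \<Longrightarrow>
      \<phi> (\<sigma> g *\<^sub>v v) = convolution ?G (indicator {g}) (\<phi> v)"
    and rep: "matrix_rep ?G d \<sigma>"
    using \<sigma> unfolding specht_rep_def by auto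
  interpret tableau A "diagram lam" T by (rule tableau_diagram[OF A lam T])
  show thesis
  proof (rule that)
    show "tableau A (diagram lam) T" by (rule tableau_diagram[OF A lam T])
    show "card A = m" by (rule card_partition[OF A lam T])
    fix K assume "\<forall>g\<in>K. g permutes A \<and> (\<forall>p. p permutes A \<longrightarrow> p \<circ> g \<circ> pinv p \<in> K)"
    then have K: "\<And>g p. g \<in> K \<Longrightarrow> p permutes A \<Longrightarrow> p \<circ> g \<circ> pinv p \<in> K"
      and KA: "\<And>g. g \<in> K \<Longrightarrow> g permutes A"
      by auto
    define \<kappa> where "\<kappa> = (\<Sum>g\<in>K. ys g)"
    have finP: "finite {y. y permutes A}" by (rule finite_permutations[OF A])
    have "algebra_action ?G d \<sigma> (indicator K) *\<^sub>v v = \<kappa> \<cdot>\<^sub>v v" if v: "v \<in> carrier_vec d" for v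
    proof -
      have \<sigma>v: "\<sigma> g *\<^sub>v v \<in> carrier_vec d" if "g permutes A" for g
        using matrix_rep_carrier[OF rep, of g] that v by simp
      have "\<phi> v \<in> specht_ideal A lam T" using bij v by (auto simp: bij_betw_def)
      then obtain f where f: "\<phi> v = convolution ?G f ys"
        unfolding specht_ideal_def young_symmetrizer_eq[OF refl] by blast
      have "\<phi> (algebra_action ?G d \<sigma> (indicator K) *\<^sub>v v) x = \<phi> (\<kappa> \<cdot>\<^sub>v v) x" for x
      proof -
        have "\<phi> (algebra_action ?G d \<sigma> (indicator K) *\<^sub>v v) x
            = \<phi> (vec d (\<lambda>i. \<Sum>g | g permutes A. indicator K g * (\<sigma> g *\<^sub>v v) $ i)) x"
          unfolding algebra_action_mult_vec[OF rep v] by simp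
        also have "\<dots> = (\<Sum>g | g permutes A. indicator K g * \<phi> (\<sigma> g *\<^sub>v v) x)"
          by (rule additive_vec_sum[OF add smult finP]) (use \<sigma>v in simp_all)
        also have "\<dots> = (\<Sum>g\<in>K. \<phi> (\<sigma> g *\<^sub>v v) x)"
          by (rule sum.mono_neutral_cong_right[OF finP]) (auto simp: KA)
        also have "\<dots> = (\<Sum>g\<in>K. convolution ?G (indicator {g}) (\<phi> v) x)"
          by (rule sum.cong[OF refl]) (simp add: act[OF KA v])
        also have "\<dots> = \<kappa> * \<phi> v x"
        proof (cases "x permutes A")
          case False
          then show ?thesis by (simp add: convolution_def f)
        next
          case x: True
          have "(\<Sum>g\<in>K. convolution ?G (indicator {g}) (\<phi> v) x)
              = (\<Sum>g\<in>K. \<Sum>y | y permutes A. f y * ys (pinv y \<circ> (pinv g \<circ> x)))"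
          proof (rule sum.cong[OF refl])
            fix g assume "g \<in> K"
            then have g: "g permutes A" by (rule KA)
            then have "pinv g \<circ> x permutes A" using x by (intro permutes_compose permutes_inv)
            then show "convolution ?G (indicator {g}) (\<phi> v) x
                = (\<Sum>y | y permutes A. f y * ys (pinv y \<circ> (pinv g \<circ> x)))"
              unfolding convolution_indicator[OF A g x] f by (rule convolution_perm)
          qed
          also have "\<dots> = (\<Sum>y | y permutes A. \<Sum>g\<in>K. f y * ys (pinv y \<circ> (pinv g \<circ> x)))"
            by (rule sum.swap)
          also have "\<dots> = (\<Sum>y | y permutes A. f y * (\<kappa> * ys (pinv y \<circ> x)))"
          proof (rule sum.cong[OF refl])
            fix y assume "y \<in> {y. y permutes A}"
            then have y: "y permutes A" by simp
            note yi = permutes_inverses[OF y]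
            \<comment> \<open>Conjugating by \<open>y\<close> turns y^-1 g^-1 into g^-1 y^-1 with
              another g of the class: the class sum passes the basis element \<open>y\<close> of
              f.\<close>
            have "(\<Sum>g\<in>K. ys (pinv y \<circ> (pinv g \<circ> x))) = (\<Sum>g\<in>K. ys (pinv g \<circ> (pinv y \<circ> x)))"
            proof (rule sum.reindex_bij_witness[of _ "\<lambda>g. y \<circ> g \<circ> pinv y" "\<lambda>g. pinv y \<circ> g \<circ> y"])
              fix g assume g: "g \<in> K"
              show "y \<circ> g \<circ> pinv y \<in> K" by (rule K[OF g y])
              show gK: "pinv y \<circ> g \<circ> y \<in> K"
                using K[OF g permutes_inv[OF y]] permutes_inv_inv[OF y] by simp
              show "y \<circ> (pinv y \<circ> g \<circ> y) \<circ> pinv y = g" "pinv y \<circ> (y \<circ> g \<circ> pinv y) \<circ> y = g"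
                by (simp_all add: fun_eq_iff yi)
              note gi = permutes_inverses[OF KA[OF g]]
              have "pinv (pinv y \<circ> g \<circ> y) = pinv y \<circ> pinv g \<circ> y"
                by (rule inv_unique_comp) (simp_all add: fun_eq_iff yi gi)
              then have "pinv (pinv y \<circ> g \<circ> y) \<circ> (pinv y \<circ> x) = pinv y \<circ> (pinv g \<circ> x)"
                by (simp add: fun_eq_iff yi)
              then show "ys (pinv (pinv y \<circ> g \<circ> y) \<circ> (pinv y \<circ> x)) = ys (pinv y \<circ> (pinv g \<circ> x))"
                by (rule arg_cong)
            qed
            also have "\<dots> = \<kappa> * ys (pinv y \<circ> x)"
              unfolding \<kappa>_def by (rule class_sum_ys) (use K KA in blast)+
            finally show "(\<Sum>g\<in>K. f y * ys (pinv y \<circ> (pinv g \<circ> x))) = f y * (\<kappa> * ys (pinv y \<circ> x))"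
              by (simp only: sum_distrib_left[symmetric])
          qed
          also have "\<dots> = \<kappa> * \<phi> v x"
            unfolding f convolution_perm[OF x] by (simp only: sum_distrib_left mult.left_commute)
          finally show ?thesis .
        qed
        also have "\<dots> = \<phi> (\<kappa> \<cdot>\<^sub>v v) x" by (simp add: smult[OF v])
        finally show ?thesis .
      qed
      then have "\<phi> (algebra_action ?G d \<sigma> (indicator K) *\<^sub>v v) = \<phi> (\<kappa> \<cdot>\<^sub>v v)" by (rule ext)
      moreover have "algebra_action ?G d \<sigma> (indicator K) *\<^sub>v v \<in> carrier_vec d" "\<kappa> \<cdot>\<^sub>v v \<in> carrier_vec d"
        using v by (simp_all add: mult_mat_vec_carrier[OF algebra_action_carrier])
      \<comment> \<open>Equality in the ideal is pulled back by injectivity of \<phi>.\<close>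
      ultimately show ?thesis using bij by (meson bij_betw_def inj_onD)
    qed
    then show "acts_by_scalar ?G d \<sigma> (indicator K) (\<Sum>g\<in>K. ys g)"
      unfolding acts_by_scalar_def \<kappa>_def by (intro mat_eq_smult_one algebra_action_carrier)
  qed
qed

lemma specht_k_cycles:
  assumes A: "finite A" and lam: "is_partition lam m" and \<sigma>: "specht_rep A lam d \<sigma>"
  shows "acts_by_scalar (perm_group_on A) d \<sigma> (indicator (k_cycles A 3))
      (- (of_nat m * (of_nat m - 1) / 2) + content_sum 2 lam)"
    and "acts_by_scalar (perm_group_on A) d \<sigma> (indicator (k_cycles A 2)) (content_sum 1 lam)"
proof -
  obtain T where T: "tableau A (diagram lam) T" and m: "card A = m"
    and sc: "\<And>K. \<forall>g\<in>K. g permutes A \<and> (\<forall>p. p permutes A \<longrightarrow> p \<circ> g \<circ> pinv p \<in> K) \<Longrightarrow>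
      acts_by_scalar (perm_group_on A) d \<sigma> (indicator K) (\<Sum>g\<in>K. tableau.ys A (diagram lam) T g)"
    using specht_class_sum[OF assms] by blast
  have "acts_by_scalar (perm_group_on A) d \<sigma> (indicator (k_cycles A 3))
      (\<Sum>g\<in>k_cycles A 3. tableau.ys A (diagram lam) T g)"
    by (rule sc) (blast intro: k_cycles_conj k_cycles_permutes)
  then show "acts_by_scalar (perm_group_on A) d \<sigma> (indicator (k_cycles A 3))
      (- (of_nat m * (of_nat m - 1) / 2) + content_sum 2 lam)"
    unfolding tableau.sum_ys_k_cycles_3[OF T] by (simp add: content_sum_def m)
  have "acts_by_scalar (perm_group_on A) d \<sigma> (indicator (k_cycles A 2))
      (\<Sum>g\<in>k_cycles A 2. tableau.ys A (diagram lam) T g)"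
    by (rule sc) (blast intro: k_cycles_conj k_cycles_permutes)
  then show "acts_by_scalar (perm_group_on A) d \<sigma> (indicator (k_cycles A 2)) (content_sum 1 lam)"
    unfolding tableau.sum_ys_k_cycles_2[OF T] by (simp add: content_sum_def)
qed

section \<open>Central elements and induced characters\<close>

lemma eigenspace_subspace:
  fixes M :: "complex mat"
  assumes M: "M \<in> carrier_mat d d"
  shows "VectorSpace.subspace class_ring {v \<in> carrier_vec d. M *\<^sub>v v = k \<cdot>\<^sub>v v} (module_vec TYPE(complex) d)"
    (is "VectorSpace.subspace _ ?U ?V")
proof -
  have V: "vectorspace (class_ring :: complex ring) ?V" by (rule vec_vs)
  have zero: "M *\<^sub>v 0\<^sub>v d = k \<cdot>\<^sub>v 0\<^sub>v d"
    using M by (intro eq_vecI) auto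
  have add: "M *\<^sub>v (v + w) = k \<cdot>\<^sub>v (v + w)" if "v \<in> ?U" "w \<in> ?U" for v w
    using that M by (simp add: mult_add_distrib_mat_vec smult_add_distrib_vec[of v d])
  have smult: "M *\<^sub>v (c \<cdot>\<^sub>v v) = k \<cdot>\<^sub>v (c \<cdot>\<^sub>v v)" if "v \<in> ?U" for c v
    using M that by (simp add: mult_mat_vec smult_smult_assoc mult.commute)
  have "LinearCombinations.submodule (class_ring :: complex ring) ?U ?V"
    unfolding LinearCombinations.submodule_def
    using vectorspace.axioms(1)[OF V] zero add smult by (auto simp: module_vec_simps)
  then show ?thesis using V by (simp add: VectorSpace.subspace_def)
qed

lemma (in group) inv_cancel_left:
  assumes "g \<in> carrier G" "h \<in> carrier G"
  shows "inv g \<otimes> (g \<otimes> h) = h" "g \<otimes> (inv g \<otimes> h) = h"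
  using assms by (simp_all add: m_assoc[symmetric])

text \<open>In the sum for \<rho>(g) Z, replacing h by g^-1 h g turns g h into h g and leaves Z
  unchanged.\<close>

lemma algebra_action_commute:
  fixes G (structure)
  assumes G: "group G" "finite (carrier G)" and \<rho>: "matrix_rep G d \<rho>"
    and Z: "\<And>g x. g \<in> carrier G \<Longrightarrow> x \<in> carrier G \<Longrightarrow> Z (g \<otimes> x \<otimes> inv g) = Z x"
    and g: "g \<in> carrier G"
  shows "\<rho> g * algebra_action G d \<rho> Z = algebra_action G d \<rho> Z * \<rho> g"
proof (rule eq_matI)
  interpret group G by (rule G(1))
  note \<rho>g = matrix_rep_carrier[OF \<rho> g]
  let ?M = "algebra_action G d \<rho> Z"
  show "dim_row (\<rho> g * ?M) = dim_row (?M * \<rho> g)" "dim_col (\<rho> g * ?M) = dim_col (?M * \<rho> g)"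
    using \<rho>g by (simp_all add: algebra_action_def)
  fix i j assume "i < dim_row (?M * \<rho> g)" "j < dim_col (?M * \<rho> g)"
  then have ij: "i < d" "j < d" using \<rho>g by (simp_all add: algebra_action_def)
  have prod: "(\<rho> x * \<rho> y) $$ (i, j) = (\<Sum>k<d. \<rho> x $$ (i, k) * \<rho> y $$ (k, j))"
    if "x \<in> carrier G" "y \<in> carrier G" for x y
    using matrix_rep_carrier[OF \<rho> that(1)] matrix_rep_carrier[OF \<rho> that(2)] ij
    by (simp add: scalar_prod_def atLeast0LessThan)
  have "(\<rho> g * ?M) $$ (i, j) = (\<Sum>k<d. \<rho> g $$ (i, k) * (\<Sum>h\<in>carrier G. Z h * \<rho> h $$ (k, j)))"
    using \<rho>g ij by (simp add: scalar_prod_def atLeast0LessThan algebra_action_def)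
  also have "\<dots> = (\<Sum>k<d. \<Sum>h\<in>carrier G. Z h * (\<rho> g $$ (i, k) * \<rho> h $$ (k, j)))"
    by (simp only: sum_distrib_left mult.left_commute)
  also have "\<dots> = (\<Sum>h\<in>carrier G. \<Sum>k<d. Z h * (\<rho> g $$ (i, k) * \<rho> h $$ (k, j)))"
    by (rule sum.swap)
  also have "\<dots> = (\<Sum>h\<in>carrier G. Z h * \<rho> (g \<otimes> h) $$ (i, j))"
    by (rule sum.cong[OF refl]) (simp only: matrix_rep_mult[OF \<rho> g] prod[OF g] sum_distrib_left)
  also have "\<dots> = (\<Sum>h\<in>carrier G. Z h * \<rho> (h \<otimes> g) $$ (i, j))"
  proof (rule sum.reindex_bij_witness[of _ "\<lambda>h. inv g \<otimes> h \<otimes> g" "\<lambda>h. g \<otimes> h \<otimes> inv g"])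
    fix h assume h: "h \<in> carrier G"
    show "g \<otimes> h \<otimes> inv g \<in> carrier G" "inv g \<otimes> h \<otimes> g \<in> carrier G"
      using g h by simp_all
    show "inv g \<otimes> (g \<otimes> h \<otimes> inv g) \<otimes> g = h"
      using g h by (simp add: m_assoc inv_cancel_left)
    show "g \<otimes> (inv g \<otimes> h \<otimes> g) \<otimes> inv g = h"
      using g h by (simp add: m_assoc inv_cancel_left)
    have "g \<otimes> h \<otimes> inv g \<otimes> g = g \<otimes> h" using g h by (simp add: m_assoc)
    then show "Z (g \<otimes> h \<otimes> inv g) * \<rho> (g \<otimes> h \<otimes> inv g \<otimes> g) $$ (i, j)
        = Z h * \<rho> (g \<otimes> h) $$ (i, j)"
      by (simp only: Z[OF g h])
  qed
  also have "\<dots> = (\<Sum>h\<in>carrier G. \<Sum>k<d. Z h * (\<rho> h $$ (i, k) * \<rho> g $$ (k, j)))"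
    by (rule sum.cong[OF refl]) (simp only: matrix_rep_mult[OF \<rho> _ g] prod[OF _ g] sum_distrib_left)
  also have "\<dots> = (\<Sum>k<d. \<Sum>h\<in>carrier G. Z h * (\<rho> h $$ (i, k) * \<rho> g $$ (k, j)))"
    by (rule sum.swap)
  also have "\<dots> = (\<Sum>k<d. (\<Sum>h\<in>carrier G. Z h * \<rho> h $$ (i, k)) * \<rho> g $$ (k, j))"
    by (simp only: sum_distrib_right mult.assoc)
  also have "\<dots> = (?M * \<rho> g) $$ (i, j)"
    using \<rho>g ij by (simp add: scalar_prod_def atLeast0LessThan algebra_action_def)
  finally show "(\<rho> g * ?M) $$ (i, j) = (?M * \<rho> g) $$ (i, j)" .
qed

text \<open>A complex matrix of size d > 0 has an eigenvalue. The eigenspace is stable under the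
  group because Z commutes with it, and it is nonzero, so by irreducibility it is the whole
  space.\<close>

lemma schur_central:
  fixes G (structure)
  assumes G: "group G" "finite (carrier G)" and \<rho>: "irreducible_rep G d \<rho>"
    and Z: "\<And>g x. g \<in> carrier G \<Longrightarrow> x \<in> carrier G \<Longrightarrow> Z (g \<otimes> x \<otimes> inv g) = Z x"
  shows "\<exists>c. acts_by_scalar G d \<rho> Z c"
proof -
  let ?M = "algebra_action G d \<rho> Z"
  have rep: "matrix_rep G d \<rho>" and d: "0 < d"
    and irr: "\<And>U. VectorSpace.subspace class_ring U (module_vec TYPE(complex) d) \<Longrightarrow>
        \<forall>g\<in>carrier G. \<forall>u\<in>U. \<rho> g *\<^sub>v u \<in> U \<Longrightarrow> U = {0\<^sub>v d} \<or> U = carrier_vec d"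
    using \<rho> by (auto simp: irreducible_rep_def)
  have M: "?M \<in> carrier_mat d d" by simp
  obtain k v where v: "v \<in> carrier_vec d" "v \<noteq> 0\<^sub>v d" "?M *\<^sub>v v = k \<cdot>\<^sub>v v"
    using spectrum_non_empty[OF M d] carrier_matD(1)[OF M]
    unfolding spectrum_def eigenvalue_def eigenvector_def by fastforce
  define U where "U = {v \<in> carrier_vec d. ?M *\<^sub>v v = k \<cdot>\<^sub>v v}"
  have "\<rho> g *\<^sub>v u \<in> U" if g: "g \<in> carrier G" and u: "u \<in> U" for g u
  proof -
    note \<rho>g = matrix_rep_carrier[OF rep g]
    have u': "u \<in> carrier_vec d" "?M *\<^sub>v u = k \<cdot>\<^sub>v u" using u by (auto simp: U_def)
    have "?M *\<^sub>v (\<rho> g *\<^sub>v u) = (?M * \<rho> g) *\<^sub>v u"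
      by (rule assoc_mult_mat_vec[OF M \<rho>g u'(1), symmetric])
    also have "\<dots> = (\<rho> g * ?M) *\<^sub>v u"
      by (simp only: algebra_action_commute[OF G rep Z g])
    also have "\<dots> = \<rho> g *\<^sub>v (?M *\<^sub>v u)" by (rule assoc_mult_mat_vec[OF \<rho>g M u'(1)])
    also have "\<dots> = k \<cdot>\<^sub>v (\<rho> g *\<^sub>v u)" unfolding u'(2) by (rule mult_mat_vec[OF \<rho>g u'(1)])
    finally show ?thesis using mult_mat_vec_carrier[OF \<rho>g u'(1)] by (simp add: U_def)
  qed
  then have "U = {0\<^sub>v d} \<or> U = carrier_vec d"
    using irr[OF eigenspace_subspace[OF M, of k]] unfolding U_def by blast
  moreover have "v \<in> U" using v by (simp add: U_def)
  ultimately have "U = carrier_vec d" using v(2) by auto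
  then have "?M = k \<cdot>\<^sub>m 1\<^sub>m d"
    by (intro mat_eq_smult_one[OF M]) (auto simp: U_def)
  then show ?thesis by (auto simp: acts_by_scalar_def)
qed

lemma trace_algebra_action:
  assumes \<rho>: "matrix_rep G d \<rho>" and "acts_by_scalar G d \<rho> f c"
  shows "(\<Sum>g\<in>carrier G. f g * mat_trace (\<rho> g)) = c * of_nat d"
proof -
  have "(\<Sum>g\<in>carrier G. f g * mat_trace (\<rho> g)) = (\<Sum>g\<in>carrier G. \<Sum>i<d. f g * \<rho> g $$ (i, i))"
    by (rule sum.cong[OF refl])
      (simp only: mat_trace_def carrier_matD(1)[OF matrix_rep_carrier[OF \<rho>]] sum_distrib_left)
  also have "\<dots> = (\<Sum>i<d. \<Sum>g\<in>carrier G. f g * \<rho> g $$ (i, i))"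
    by (rule sum.swap)
  also have "\<dots> = (\<Sum>i<d. algebra_action G d \<rho> f $$ (i, i))"
    by (simp add: algebra_action_def)
  also have "\<dots> = (\<Sum>i<d. c)"
    using assms(2) by (simp add: acts_by_scalar_def)
  finally show ?thesis by simp
qed

lemma mat_trace_one: "mat_trace (1\<^sub>m d) = of_nat d"
  by (simp add: mat_trace_def)

text \<open>Reduces the action to a character sum: the scalar exists by Schur, its trace is
  \<open>d\<close> times it, and d > 0 allows division.\<close>

lemma central_acts_by_scalar:
  fixes G (structure)
  assumes G: "group G" "finite (carrier G)" and \<rho>: "irreducible_rep G d \<rho>"
    and Z: "\<And>g x. g \<in> carrier G \<Longrightarrow> x \<in> carrier G \<Longrightarrow> Z (g \<otimes> x \<otimes> inv g) = Z x"
    and s: "(\<Sum>g\<in>carrier G. Z g * mat_trace (\<rho> g)) = s * of_nat d"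
  shows "acts_by_scalar G d \<rho> Z s"
proof -
  obtain c where c: "acts_by_scalar G d \<rho> Z c" using schur_central[OF G \<rho> Z] by blast
  have "matrix_rep G d \<rho>" "0 < d" using \<rho> by (auto simp: irreducible_rep_def)
  then have "c = s" using trace_algebra_action[OF _ c] s by simp
  then show ?thesis using c by simp
qed

text \<open>For fixed \<open>x\<close>, conjugation by \<open>x\<close> permutes the invariant set
  \<open>C\<close>. After exchanging the sums every \<open>x\<close> contributes the same amount,
  which accounts for the factor \<open>order G\<close>.\<close>

lemma sum_induced_char:
  fixes G (structure)
  assumes G: "group G" "finite (carrier G)" and H: "finite (carrier H)"
    and \<iota>: "\<And>h. h \<in> carrier H \<Longrightarrow> \<iota> h \<in> carrier G"
    and C: "C \<subseteq> carrier G"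
      "\<And>g x. g \<in> carrier G \<Longrightarrow> x \<in> C \<Longrightarrow> g \<otimes> x \<otimes> inv g \<in> C"
  shows "(\<Sum>w\<in>C. induced_char G H \<iota> \<chi> w)
    = of_nat (order G) / of_nat (order H) * (\<Sum>h | h \<in> carrier H \<and> \<iota> h \<in> C. \<chi> h)"
proof -
  interpret group G by (rule G(1))
  have finC: "finite C" using C(1) G(2) finite_subset by blast
  have inner: "(\<Sum>w\<in>C. \<Sum>h | h \<in> carrier H \<and> \<iota> h = inv x \<otimes> w \<otimes> x. \<chi> h)
      = (\<Sum>h | h \<in> carrier H \<and> \<iota> h \<in> C. \<chi> h)" if x: "x \<in> carrier G" for x
  proof -
    have iff: "\<iota> h = inv x \<otimes> w \<otimes> x \<longleftrightarrow> w = x \<otimes> \<iota> h \<otimes> inv x"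
      if h: "h \<in> carrier H" and w: "w \<in> carrier G" for h w
    proof
      assume "\<iota> h = inv x \<otimes> w \<otimes> x"
      then have "x \<otimes> \<iota> h \<otimes> inv x = x \<otimes> (inv x \<otimes> w \<otimes> x) \<otimes> inv x"
        by simp
      also have "\<dots> = w" using x w by (simp add: m_assoc inv_cancel_left)
      finally show "w = x \<otimes> \<iota> h \<otimes> inv x" by simp
    next
      assume "w = x \<otimes> \<iota> h \<otimes> inv x"
      then have "inv x \<otimes> w \<otimes> x = inv x \<otimes> (x \<otimes> \<iota> h \<otimes> inv x) \<otimes> x"
        by simp
      also have "\<dots> = \<iota> h" using x \<iota>[OF h] by (simp add: m_assoc inv_cancel_left)
      finally show "\<iota> h = inv x \<otimes> w \<otimes> x" by simp
    qed
    have "(\<Sum>w\<in>C. \<Sum>h | h \<in> carrier H \<and> \<iota> h = inv x \<otimes> w \<otimes> x. \<chi> h)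
        = (\<Sum>w\<in>C. \<Sum>h\<in>carrier H. if \<iota> h = inv x \<otimes> w \<otimes> x then \<chi> h else 0)"
      by (simp only: sum.inter_filter[OF H])
    also have "\<dots> = (\<Sum>h\<in>carrier H. \<Sum>w\<in>C. if \<iota> h = inv x \<otimes> w \<otimes> x then \<chi> h else 0)"
      by (rule sum.swap)
    also have "\<dots> = (\<Sum>h\<in>carrier H. if \<iota> h \<in> C then \<chi> h else 0)"
    proof (rule sum.cong[OF refl])
      fix h assume h: "h \<in> carrier H"
      let ?w = "x \<otimes> \<iota> h \<otimes> inv x"
      have "?w \<in> C \<longleftrightarrow> \<iota> h \<in> C"
      proof
        assume "?w \<in> C"
        then have "inv x \<otimes> ?w \<otimes> inv (inv x) \<in> C" using C(2)[of "inv x"] x by simp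
        moreover have "inv x \<otimes> ?w \<otimes> inv (inv x) = \<iota> h"
          using iff[OF h, of ?w] \<iota>[OF h] x by simp
        ultimately show "\<iota> h \<in> C" by simp
      qed (rule C(2)[OF x])
      moreover have "(\<Sum>w\<in>C. if \<iota> h = inv x \<otimes> w \<otimes> x then \<chi> h else 0)
          = (\<Sum>w\<in>C. if w = ?w then \<chi> h else 0)"
        using iff[OF h] C(1) by (intro sum.cong[OF refl] if_cong) auto
      ultimately show "(\<Sum>w\<in>C. if \<iota> h = inv x \<otimes> w \<otimes> x then \<chi> h else 0)
          = (if \<iota> h \<in> C then \<chi> h else 0)"
        by (simp add: finC)
    qed
    also have "\<dots> = (\<Sum>h | h \<in> carrier H \<and> \<iota> h \<in> C. \<chi> h)"
      by (simp only: sum.inter_filter[OF H])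
    finally show ?thesis .
  qed
  have "(\<Sum>w\<in>C. induced_char G H \<iota> \<chi> w) = 1 / of_nat (order H) *
      (\<Sum>w\<in>C. \<Sum>x\<in>carrier G. \<Sum>h | h \<in> carrier H \<and> \<iota> h = inv x \<otimes> w \<otimes> x. \<chi> h)"
    unfolding induced_char_def by (rule sum_distrib_left[symmetric])
  also have "(\<Sum>w\<in>C. \<Sum>x\<in>carrier G. \<Sum>h | h \<in> carrier H \<and> \<iota> h = inv x \<otimes> w \<otimes> x. \<chi> h)
      = (\<Sum>x\<in>carrier G. \<Sum>w\<in>C. \<Sum>h | h \<in> carrier H \<and> \<iota> h = inv x \<otimes> w \<otimes> x. \<chi> h)"
    by (rule sum.swap)
  also have "\<dots> = (\<Sum>x\<in>carrier G. \<Sum>h | h \<in> carrier H \<and> \<iota> h \<in> C. \<chi> h)"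
    by (rule sum.cong[OF refl inner])
  finally show ?thesis by (simp add: Coset.order_def)
qed

section \<open>Signed permutations\<close>

text \<open>\<open>sperm p s\<close> sends \<open>eps i\<close> to \<open>s i\<close> times \<open>eps (p i)\<close>.\<close>

definition sperm :: "(nat \<Rightarrow> nat) \<Rightarrow> (nat \<Rightarrow> real) \<Rightarrow> (nat \<Rightarrow> real) \<Rightarrow> nat \<Rightarrow> real" where
  "sperm p s v = (\<lambda>l. s (pinv p l) * v (pinv p l))"

text \<open>The value 1 outside \<open>I\<close> makes the sign function unique and lets the signed
  permutations of a subset be literally signed permutations of the larger set.\<close>

definition signs :: "nat set \<Rightarrow> (nat \<Rightarrow> real) \<Rightarrow> bool" where
  "signs I s \<longleftrightarrow> (\<forall>i. s i = 1 \<or> i \<in> I \<and> s i = - 1)"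

definition sperms :: "nat set \<Rightarrow> ((nat \<Rightarrow> real) \<Rightarrow> nat \<Rightarrow> real) set" where
  "sperms I = {sperm p s | p s. p permutes I \<and> signs I s}"

lemma signs_cases: "signs I s \<Longrightarrow> s i = 1 \<or> s i = - 1"
  by (auto simp: signs_def)

lemma signs_neg: "signs I s \<Longrightarrow> s i = - 1 \<Longrightarrow> i \<in> I"
  unfolding signs_def by (metis one_neq_neg_one)

lemma signs_square [simp]: "signs I s \<Longrightarrow> s i * s i = 1"
  using signs_cases[of I s i] by auto

lemma sperms_cases:
  assumes "w \<in> sperms I"
  obtains p s where "w = sperm p s" "p permutes I" "signs I s"
  using assms by (auto simp: sperms_def)

lemma sperms_I: "p permutes I \<Longrightarrow> signs I s \<Longrightarrow> sperm p s \<in> sperms I"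
  by (auto simp: sperms_def)

lemma sperm_comp:
  assumes "p permutes I" "q permutes I"
  shows "sperm p s \<circ> sperm q t = sperm (p \<circ> q) (\<lambda>i. s (q i) * t i)"
proof -
  have "pinv (p \<circ> q) = pinv q \<circ> pinv p"
    by (rule o_inv_distrib) (use assms permutes_bij in auto)
  then show ?thesis
    using permutes_inverses[OF assms(2)] by (simp add: fun_eq_iff sperm_def)
qed

lemma signs_comp: "signs I s \<Longrightarrow> signs I t \<Longrightarrow> q permutes I \<Longrightarrow> signs I (\<lambda>i. s (q i) * t i)"
  unfolding signs_def by (metis mult_minus_left mult_1 permutes_in_image minus_minus)

lemma sperm_id: "sperm id (\<lambda>i. 1) = id"
  by (simp add: sperm_def fun_eq_iff)

lemma id_sperms: "id \<in> sperms I"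
  using sperms_I[OF permutes_id, of I "\<lambda>i. 1"] by (simp add: sperm_id signs_def)

lemma sperms_comp: "v \<in> sperms I \<Longrightarrow> w \<in> sperms I \<Longrightarrow> v \<circ> w \<in> sperms I"
  by (elim sperms_cases) (simp add: sperm_comp sperms_I signs_comp permutes_compose)

definition sperm_inv :: "(nat \<Rightarrow> nat) \<Rightarrow> (nat \<Rightarrow> real) \<Rightarrow> (nat \<Rightarrow> real) \<Rightarrow> nat \<Rightarrow> real" where
  "sperm_inv p s = sperm (pinv p) (\<lambda>i. s (pinv p i))"

lemma sperm_inv:
  assumes p: "p permutes I" and s: "signs I s"
  shows "sperm p s \<circ> sperm_inv p s = id" "sperm_inv p s \<circ> sperm p s = id" "sperm_inv p s \<in> sperms I"
proof -
  note ip = permutes_inv[OF p]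
  show "sperm p s \<circ> sperm_inv p s = id"
    unfolding sperm_inv_def sperm_comp[OF p ip] using permutes_inv_o[OF p] s by (simp add: sperm_id)
  show "sperm_inv p s \<circ> sperm p s = id"
    unfolding sperm_inv_def sperm_comp[OF ip p]
    using permutes_inv_o[OF p] permutes_inverses[OF p] s by (simp add: sperm_id)
  have "signs I (\<lambda>i. s (pinv p i))"
    using s permutes_in_image[OF ip] unfolding signs_def by metis
  then show "sperm_inv p s \<in> sperms I" unfolding sperm_inv_def by (rule sperms_I[OF ip])
qed

lemma sperm_eps: 
  assumes "p permutes I" shows "sperm p s (eps i) = (\<lambda>l. s i * eps (p i) l)"
  using permutes_inverses[OF assms] by (auto simp: sperm_def eps_def fun_eq_iff)

lemma eps_scaled_eq:
  assumes "(\<lambda>l. c * eps i l) = (\<lambda>l. d * eps j l)" "c \<noteq> 0"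
  shows "i = j" "c = d"
proof -
  have "c * eps i i = d * eps j i" using assms(1) by metis
  then show "i = j" "c = d" using assms(2) by (auto simp: eps_def split: if_splits)
qed

text \<open>Evaluation at \<open>eps i\<close> reveals both the image index and the sign. The two
  index sets may differ, which is used for factors on disjoint blocks.\<close>

lemma sperm_eq_iff:
  assumes "p permutes I" "signs I s" "q permutes J" "signs J t"
  shows "sperm p s = sperm q t \<longleftrightarrow> p = q \<and> s = t"
proof
  assume *: "sperm p s = sperm q t"
  have "p i = q i \<and> s i = t i" for i
  proof -
    have "(\<lambda>l. s i * eps (p i) l) = (\<lambda>l. t i * eps (q i) l)"
      using sperm_eps[OF assms(1), of s i] sperm_eps[OF assms(3), of t i] * by simp
    moreover have "s i \<noteq> 0" using signs_cases[OF assms(2), of i] by auto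
    ultimately show ?thesis using eps_scaled_eq by blast
  qed
  then show "p = q \<and> s = t" by (simp add: fun_eq_iff)
qed simp

lemma finite_signs: "finite I \<Longrightarrow> finite {s. signs I s}"
proof (rule finite_subset)
  show "{s. signs I s} \<subseteq> (\<lambda>J l. if l \<in> J then - 1 else 1) ` Pow I"
  proof
    fix s assume s: "s \<in> {s. signs I s}"
    have "s i = 1 \<or> i \<in> I \<and> s i = - 1" for i using s by (simp add: signs_def)
    then have "s = (\<lambda>l. if l \<in> {i. s i = - 1} then - 1 else 1)" by (fastforce simp: fun_eq_iff)
    moreover have "{i. s i = - 1} \<in> Pow I" using s signs_neg by auto
    ultimately show "s \<in> (\<lambda>J l. if l \<in> J then - 1 else 1) ` Pow I" by (rule image_eqI)
  qed
qed simp

lemma finite_sperms: "finite I \<Longrightarrow> finite (sperms I)"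
proof -
  assume I: "finite I"
  have "sperms I = (\<lambda>(p, s). sperm p s) ` ({p. p permutes I} \<times> {s. signs I s})"
    by (auto simp: sperms_def)
  then show ?thesis using I by (simp add: finite_permutations finite_signs)
qed

lemma sperms_mono: "I \<subseteq> J \<Longrightarrow> sperms I \<subseteq> sperms J"
  by (auto simp: sperms_def signs_def intro: permutes_subset)

subsection \<open>Reflections\<close>

definition tt :: "nat \<Rightarrow> nat \<Rightarrow> real \<Rightarrow> (nat \<Rightarrow> real) \<Rightarrow> nat \<Rightarrow> real" where
  "tt i j a = sperm (transpose i j) (\<lambda>l. if l = i \<or> l = j then a else 1)"

definition ss :: "nat \<Rightarrow> (nat \<Rightarrow> real) \<Rightarrow> nat \<Rightarrow> real" where
  "ss i = sperm id (\<lambda>l. if l = i then - 1 else 1)"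

text \<open>The long roots are written \<open>\<epsilon>\<^sub>i - a \<epsilon>\<^sub>j\<close> with \<open>a = \<plusminus>1\<close>; the reflection \<open>tt i j a\<close> sends \<open>\<epsilon>\<^sub>i\<close> to \<open>a \<epsilon>\<^sub>j\<close>.\<close>

definition long_root :: "nat \<Rightarrow> nat \<Rightarrow> real \<Rightarrow> nat \<Rightarrow> real" where
  "long_root i j a = (\<lambda>l. eps i l - a * eps j l)"

lemma tt_sperms: "i \<in> I \<Longrightarrow> j \<in> I \<Longrightarrow> a \<in> {1, - 1} \<Longrightarrow> tt i j a \<in> sperms I"
  unfolding tt_def by (rule sperms_I[OF permutes_swap_id]) (auto simp: signs_def)

lemma ss_sperms: "i \<in> I \<Longrightarrow> ss i \<in> sperms I"
  unfolding ss_def by (rule sperms_I[OF permutes_id]) (auto simp: signs_def)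

lemma tt_apply: "tt i j a v = (\<lambda>l. if l = i then a * v j else if l = j then a * v i else v l)"
  by (auto simp: tt_def sperm_def fun_eq_iff transpose_def)

lemma ss_apply: "ss i v = (\<lambda>l. if l = i then - v i else v l)"
  by (auto simp: ss_def sperm_def fun_eq_iff)

lemma bform_eps: "finite I \<Longrightarrow> i \<in> I \<Longrightarrow> bform I v (eps i) = v i"
  by (simp add: bform_def eps_def if_distrib cong: if_cong)

lemma bform_long_root:
  assumes "finite I" "i \<in> I" "j \<in> I"
  shows "bform I v (long_root i j a) = v i - a * v j"
proof -
  have "bform I v (long_root i j a) = bform I v (eps i) - a * bform I v (eps j)"
    by (simp add: bform_def long_root_def right_diff_distrib sum_subtractf sum_distrib_left mult.left_commute)
  then show ?thesis using assms by (simp add: bform_eps)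
qed

lemma bform_long_root_self:
  assumes "finite I" "i \<in> I" "j \<in> I" "i \<noteq> j" "a \<in> {1, - 1}"
  shows "bform I (long_root i j a) (long_root i j a) = 2"
  using assms by (auto simp: bform_long_root) (auto simp: long_root_def eps_def)

lemma reflection_eps: "finite I \<Longrightarrow> i \<in> I \<Longrightarrow> reflection I (eps i) = ss i"
  by (simp add: reflection_def bform_eps ss_apply fun_eq_iff) (simp add: eps_def)

lemma reflection_long_root:
  assumes "finite I" "i \<in> I" "j \<in> I" "i \<noteq> j" "a \<in> {1, - 1}"
  shows "reflection I (long_root i j a) = tt i j a"
proof (rule ext, rule ext)
  fix v l
  have "reflection I (long_root i j a) v l = v l - (v i - a * v j) * long_root i j a l"
    unfolding reflection_def bform_long_root_self[OF assms] unfolding bform_long_root[OF assms(1-3)] by simp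
  also have "\<dots> = tt i j a v l"
    using assms(4,5) by (auto simp: tt_apply long_root_def eps_def)
  finally show "reflection I (long_root i j a) v l = tt i j a v l" .
qed

lemma reflection_uminus: "reflection I (\<lambda>l. - \<alpha> l) = reflection I \<alpha>"
  by (simp add: reflection_def bform_def fun_eq_iff sum_negf)

lemma image_triples:
  "(\<lambda>(i, j, a). f i j a) ` {(i, j, a). P i j a} = {f i j a | i j a. P i j a}"
  by force

lemma pos_roots_eq:
  "pos_roots I = (\<lambda>(i, j, a). long_root i j a) ` {(i, j, a). i \<in> I \<and> j \<in> I \<and> i < j \<and> a \<in> {1, - 1}} \<union> eps ` I"
proof -
  have "{long_root i j a | i j a. i \<in> I \<and> j \<in> I \<and> i < j \<and> a \<in> {1, - 1}}
      = {long_root i j (- 1) | i j. i \<in> I \<and> j \<in> I \<and> i < j} \<union> {long_root i j 1 | i j. i \<in> I \<and> j \<in> I \<and> i < j}"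
    by blast
  moreover have "long_root i j (- 1) = (\<lambda>l. eps i l + eps j l)" "long_root i j 1 = (\<lambda>l. eps i l - eps j l)" for i j
    by (simp_all add: long_root_def)
  ultimately show ?thesis
    unfolding image_triples pos_roots_def Setcompr_eq_image[of eps] Collect_mem_eq by (simp only:)
qed

lemma reflection_roots:
  assumes "finite I"
  shows "reflection I ` roots I = {tt i j a | i j a. i \<in> I \<and> j \<in> I \<and> i < j \<and> a \<in> {1, - 1}} \<union> ss ` I"
proof -
  have "reflection I ` roots I = reflection I ` pos_roots I"
  proof -
    have "reflection I ` {\<lambda>l. - \<alpha> l | \<alpha>. \<alpha> \<in> pos_roots I} \<subseteq> reflection I ` pos_roots I"
    proof
      fix x assume "x \<in> reflection I ` {\<lambda>l. - \<alpha> l | \<alpha>. \<alpha> \<in> pos_roots I}"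
      then obtain \<alpha> where "x = reflection I (\<lambda>l. - \<alpha> l)" "\<alpha> \<in> pos_roots I" by blast
      then show "x \<in> reflection I ` pos_roots I" by (simp add: reflection_uminus)
    qed
    then show ?thesis unfolding roots_def image_Un by blast
  qed
  also have "\<dots> = (\<lambda>(i, j, a). reflection I (long_root i j a)) ` {(i, j, a). i \<in> I \<and> j \<in> I \<and> i < j \<and> a \<in> {1, - 1}}
      \<union> (\<lambda>i. reflection I (eps i)) ` I"
    unfolding pos_roots_eq image_Un image_image by (simp add: case_prod_beta)
  also have "\<dots> = (\<lambda>(i, j, a). tt i j a) ` {(i, j, a). i \<in> I \<and> j \<in> I \<and> i < j \<and> a \<in> {1, - 1}} \<union> ss ` I"
  proof (rule arg_cong2[where f = "(\<union>)"]; rule image_cong[OF refl])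
    fix x assume "x \<in> {(i, j, a). i \<in> I \<and> j \<in> I \<and> i < j \<and> a \<in> {1, - 1 :: real}}"
    then obtain i j a where "x = (i, j, a)" "i \<in> I" "j \<in> I" "i \<noteq> j" "a \<in> {1, - 1}" by auto
    then show "(\<lambda>(i, j, a). reflection I (long_root i j a)) x = (\<lambda>(i, j, a). tt i j a) x"
      using reflection_long_root[OF assms] by simp
  qed (rule reflection_eps[OF assms])
  also have "(\<lambda>(i, j, a). tt i j a) ` {(i, j, a). i \<in> I \<and> j \<in> I \<and> i < j \<and> a \<in> {1, - 1}}
      = {tt i j a | i j a. i \<in> I \<and> j \<in> I \<and> i < j \<and> a \<in> {1, - 1}}"
    by (rule image_triples)
  finally show ?thesis .
qed

subsection \<open>The group\<close>

abbreviation bijections :: "'a itself \<Rightarrow> ('a \<Rightarrow> 'a) monoid" where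
  "bijections _ \<equiv> \<lparr>carrier = {f. bij f}, mult = (\<circ>), one = id\<rparr>"

lemma group_bijections: "group (bijections TYPE('a))"
proof (rule groupI)
  fix x assume "x \<in> carrier (bijections TYPE('a))"
  then show "\<exists>y\<in>carrier (bijections TYPE('a)). y \<otimes>\<^bsub>bijections TYPE('a)\<^esub> x = \<one>\<^bsub>bijections TYPE('a)\<^esub>"
    by (intro bexI[of _ "pinv x"]) (auto simp: bij_imp_bij_inv bij_is_inj)
qed (auto simp: bij_comp comp_assoc)

lemma subgroup_sperms: "subgroup (sperms I) (bijections TYPE(nat \<Rightarrow> real))"
proof (rule group.subgroupI[OF group_bijections])
  let ?B = "bijections TYPE(nat \<Rightarrow> real)"
  show sub: "sperms I \<subseteq> carrier ?B"
  proof
    fix w assume "w \<in> sperms I"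
    then obtain p s where "w = sperm p s" "p permutes I" "signs I s" by (rule sperms_cases)
    then show "w \<in> carrier ?B" using sperm_inv[of p I s] o_bij by auto
  qed
  show "sperms I \<noteq> {}" using id_sperms by blast
  show "v \<otimes>\<^bsub>?B\<^esub> w \<in> sperms I" if "v \<in> sperms I" "w \<in> sperms I" for v w
    using sperms_comp[OF that] by simp
  fix w assume w: "w \<in> sperms I"
  then obtain p s where *: "w = sperm p s" "p permutes I" "signs I s" by (rule sperms_cases)
  have "inv\<^bsub>?B\<^esub> w = sperm_inv p s"
    using sperm_inv[OF *(2,3)] sub w unfolding *(1)
    by (intro group.inv_equality[OF group_bijections]) auto
  then show "inv\<^bsub>?B\<^esub> w \<in> sperms I" using sperm_inv(3)[OF *(2,3)] by simp
qed

text \<open>The generators are signed permutations, which form a group. Conversely the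
  \<open>tt i j 1\<close> generate all permutations and the \<open>ss i\<close> all sign changes,
  and every signed permutation is a product of the two kinds.\<close>

lemma carrier_weyl_B:
  assumes I: "finite I"
  shows "carrier (weyl_B I) = sperms I"
proof
  let ?B = "bijections TYPE(nat \<Rightarrow> real)"
  have refl_sub: "reflection I ` roots I \<subseteq> sperms I"
    unfolding reflection_roots[OF I] using tt_sperms ss_sperms by fastforce
  show "carrier (weyl_B I) \<subseteq> sperms I"
    unfolding weyl_B_def by (rule group.subgroup_generated_minimal[OF group_bijections subgroup_sperms refl_sub])
  have W: "carrier (weyl_B I) = generate ?B (reflection I ` roots I)"
    using refl_sub subgroup.subset[OF subgroup_sperms[of I]]
    by (simp add: weyl_B_def carrier_subgroup_generated Int_absorb1 subset_trans)
  have comp: "v \<circ> w \<in> carrier (weyl_B I)" if "v \<in> carrier (weyl_B I)" "w \<in> carrier (weyl_B I)" for v w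
    using generate.eng[of v ?B _ w] that unfolding W by simp
  have one: "id \<in> carrier (weyl_B I)" using generate.one[of ?B] unfolding W by simp
  have tt: "tt i j a \<in> carrier (weyl_B I)" if "i \<in> I" "j \<in> I" "i \<noteq> j" "a \<in> {1, - 1}" for i j a
  proof -
    \<comment> \<open>Positive roots are listed with i < j only; the symmetry of the reflection
      supplies the other order.\<close>
    have "tt i j a = tt j i a" by (auto simp: tt_apply fun_eq_iff)
    then have "tt i j a \<in> {tt i j a | i j a. i \<in> I \<and> j \<in> I \<and> i < j \<and> a \<in> {1, - 1}}"
      using that by (cases "i < j") (blast, metis (mono_tags, lifting) CollectI linorder_neqE_nat)
    then show ?thesis unfolding W reflection_roots[OF I] by (intro generate.incl) blast
  qed
  have ss: "ss i \<in> carrier (weyl_B I)" if "i \<in> I" for i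
    unfolding W reflection_roots[OF I] using that by (intro generate.incl) blast
  have perm: "sperm p (\<lambda>i. 1) \<in> carrier (weyl_B I)" if "p permutes I" for p
    using that I
  proof (induction rule: permutes_induct)
    case id
    show ?case unfolding sperm_id by (rule one)
  next
    case (swap a b p)
    have "tt a b 1 = sperm (transpose a b) (\<lambda>i. 1)" by (simp add: tt_def)
    then have "tt a b 1 \<circ> sperm p (\<lambda>i. 1) = sperm (transpose a b \<circ> p) (\<lambda>i. 1)"
      using sperm_comp[OF permutes_swap_id[OF swap(1,2)] swap(4), of "\<lambda>i. 1" "\<lambda>i. 1"] by simp
    moreover have "tt a b 1 \<circ> sperm p (\<lambda>i. 1) \<in> carrier (weyl_B I)"
      by (rule comp[OF tt[OF swap(1-3)] swap(5)]) simp
    ultimately show ?case by (simp only:)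
  qed
  have neg: "sperm id (\<lambda>l. if l \<in> J then - 1 else 1) \<in> carrier (weyl_B I)" if "finite J" "J \<subseteq> I" for J
    using that
  proof (induction J)
    case empty
    show ?case using one by (simp only: sperm_id empty_iff if_False)
  next
    case (insert i J)
    have "(\<lambda>l. (if l = i then - 1 else 1) * (if l \<in> J then - 1 else 1)) = (\<lambda>l. if l \<in> insert i J then - 1 else (1::real))"
      using insert.hyps by auto
    then have "ss i \<circ> sperm id (\<lambda>l. if l \<in> J then - 1 else 1) = sperm id (\<lambda>l. if l \<in> insert i J then - 1 else 1)"
      unfolding ss_def sperm_comp[OF permutes_id permutes_id] by simp
    moreover have "ss i \<circ> sperm id (\<lambda>l. if l \<in> J then - 1 else 1) \<in> carrier (weyl_B I)"
      using insert.prems by (intro comp ss insert.IH) auto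
    ultimately show ?case by (simp only:)
  qed
  show "sperms I \<subseteq> carrier (weyl_B I)"
  proof
    fix w assume "w \<in> sperms I"
    then obtain p s where *: "w = sperm p s" "p permutes I" "signs I s" by (rule sperms_cases)
    define J where "J = {i. s i = - 1}"
    have J: "J \<subseteq> I" using signs_neg[OF *(3)] by (auto simp: J_def)
    have "s = (\<lambda>l. if l \<in> J then - 1 else 1)" using *(3) by (auto simp: J_def signs_def fun_eq_iff)
    \<comment> \<open>The signs act first, on the original indices, so \<open>s\<close> needs no
      relabelling by \<open>p\<close>.\<close>
    then have "w = sperm p (\<lambda>i. 1) \<circ> sperm id (\<lambda>l. if l \<in> J then - 1 else 1)"
      using sperm_comp[OF *(2) permutes_id, of "\<lambda>i. 1" s] *(1) by simp
    then show "w \<in> carrier (weyl_B I)"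
      using comp[OF perm[OF *(2)] neg[OF finite_subset[OF J I] J]] by simp
  qed
qed

lemma group_weyl_B: "group (weyl_B I)"
  unfolding weyl_B_def by (rule group.group_subgroup_generated[OF group_bijections])

lemma mult_weyl_B [simp]: "v \<otimes>\<^bsub>weyl_B I\<^esub> w = v \<circ> w" and one_weyl_B [simp]: "\<one>\<^bsub>weyl_B I\<^esub> = id"
  by (simp_all add: weyl_B_def subgroup_generated_def)

lemma inv_weyl_B:
  assumes "finite I" "p permutes I" "signs I s"
  shows "inv\<^bsub>weyl_B I\<^esub> (sperm p s) = sperm_inv p s"
  using sperm_inv[OF assms(2,3)] sperms_I[OF assms(2,3)]
  by (intro group.inv_equality[OF group_weyl_B]) (simp_all add: carrier_weyl_B[OF assms(1)])

section \<open>Permutation and number of sign changes of a signed permutation\<close>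

lemma unsigned_perm_sperm:
  assumes "p permutes I" "signs I s"
  shows "unsigned_perm (sperm p s) = p"
proof
  fix i
  have e: "sperm p s (eps i) = (\<lambda>l. s i * eps (p i) l)" by (rule sperm_eps[OF assms(1)])
  have ne: "s i \<noteq> 0" using signs_cases[OF assms(2), of i] by auto
  show "unsigned_perm (sperm p s) i = p i"
    unfolding unsigned_perm_def
  proof (rule the_equality)
    show "sperm p s (eps i) = eps (p i) \<or> sperm p s (eps i) = (\<lambda>l. - eps (p i) l)"
      using signs_cases[OF assms(2), of i] by (auto simp: e)
    fix j assume "sperm p s (eps i) = eps j \<or> sperm p s (eps i) = (\<lambda>l. - eps j l)"
    then have "(\<lambda>l. s i * eps (p i) l) = (\<lambda>l. 1 * eps j l) \<or> (\<lambda>l. s i * eps (p i) l) = (\<lambda>l. (- 1) * eps j l)"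
      unfolding e by simp
    then show "j = p i" using eps_scaled_eq(1) ne by metis
  qed
qed

lemma sign_changes_sperm:
  assumes "p permutes I" "signs I s"
  shows "sign_changes (sperm p s) = card {i. s i = - 1}"
proof -
  have "(\<exists>j. sperm p s (eps i) = (\<lambda>l. - eps j l)) \<longleftrightarrow> s i = - 1" for i
  proof
    assume "\<exists>j. sperm p s (eps i) = (\<lambda>l. - eps j l)"
    then obtain j where "sperm p s (eps i) = (\<lambda>l. - eps j l)" by blast
    then have "(\<lambda>l. s i * eps (p i) l) = (\<lambda>l. (- 1) * eps j l)"
      unfolding sperm_eps[OF assms(1)] by simp
    moreover have "s i \<noteq> 0" using signs_cases[OF assms(2), of i] by auto
    ultimately show "s i = - 1" by (rule eps_scaled_eq(2))
  next
    assume "s i = - 1"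
    then show "\<exists>j. sperm p s (eps i) = (\<lambda>l. - eps j l)"
      unfolding sperm_eps[OF assms(1)] by (intro exI[of _ "p i"]) simp
  qed
  then show ?thesis by (simp add: sign_changes_def)
qed

section \<open>The classes of type \<open>A\<^sub>2\<close> and \<open>B\<^sub>2\<close>\<close>

text \<open>\<open>A3 i j k a b\<close> sends \<open>\<epsilon>\<^sub>i\<close> to \<open>a \<epsilon>\<^sub>j\<close>, \<open>\<epsilon>\<^sub>j\<close> to \<open>b \<epsilon>\<^sub>k\<close> and \<open>\<epsilon>\<^sub>k\<close> to \<open>a b \<epsilon>\<^sub>i\<close>;
  \<open>B2 i j\<close> sends \<open>\<epsilon>\<^sub>i\<close> to \<open>- \<epsilon>\<^sub>j\<close> and \<open>\<epsilon>\<^sub>j\<close> to \<open>\<epsilon>\<^sub>i\<close>.\<close>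

definition A3 :: "nat \<Rightarrow> nat \<Rightarrow> nat \<Rightarrow> real \<Rightarrow> real \<Rightarrow> (nat \<Rightarrow> real) \<Rightarrow> nat \<Rightarrow> real" where
  "A3 i j k a b = tt i j a \<circ> tt j k b"

text \<open>The three signs multiply to 1: of the eight lifts of a 3-cycle, these are the four with
  an even number of sign changes.\<close>

definition A3_sign :: "nat \<Rightarrow> nat \<Rightarrow> nat \<Rightarrow> real \<Rightarrow> real \<Rightarrow> nat \<Rightarrow> real" where
  "A3_sign i j k a b = (\<lambda>l. if l = i then a else if l = j then b else if l = k then a * b else 1)"

definition B2 :: "nat \<Rightarrow> nat \<Rightarrow> (nat \<Rightarrow> real) \<Rightarrow> nat \<Rightarrow> real" where
  "B2 i j = ss i \<circ> tt i j (- 1)"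

definition A3_index :: "nat set \<Rightarrow> ((nat \<times> nat \<times> nat) \<times> real \<times> real) set" where
  "A3_index I = distinct_triples I \<times> {1, - 1} \<times> {1, - 1}"

definition A3_set :: "nat set \<Rightarrow> ((nat \<Rightarrow> real) \<Rightarrow> nat \<Rightarrow> real) set" where
  "A3_set I = (\<lambda>((i, j, k), a, b). A3 i j k a b) ` A3_index I"

definition B2_set :: "nat set \<Rightarrow> ((nat \<Rightarrow> real) \<Rightarrow> nat \<Rightarrow> real) set" where
  "B2_set I = (\<lambda>(i, j). B2 i j) ` distinct_pairs I"

lemma A3_setE:
  assumes "w \<in> A3_set I"
  obtains i j k a b where "w = A3 i j k a b" "(i, j, k) \<in> distinct_triples I" "a \<in> {1, - 1}" "b \<in> {1, - 1}"
  using assms by (auto simp: A3_set_def A3_index_def)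

lemma A3_setI:
  assumes "(i, j, k) \<in> distinct_triples I" "a \<in> {1, - 1}" "b \<in> {1, - 1}"
  shows "A3 i j k a b \<in> A3_set I"
proof -
  have "((i, j, k), a, b) \<in> A3_index I" using assms unfolding A3_index_def by blast
  then show ?thesis unfolding A3_set_def by (rule rev_image_eqI) simp
qed

lemma B2_setE:
  assumes "w \<in> B2_set I"
  obtains i j where "w = B2 i j" "(i, j) \<in> distinct_pairs I"
  using assms by (auto simp: B2_set_def)

lemma B2_setI: "(i, j) \<in> distinct_pairs I \<Longrightarrow> B2 i j \<in> B2_set I"
  unfolding B2_set_def by force

lemma distinct_triplesD:
  assumes "(i, j, k) \<in> distinct_triples I"
  shows "i \<in> I" "j \<in> I" "k \<in> I" "i \<noteq> j" "i \<noteq> k" "j \<noteq> k"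
  using assms by (auto simp: distinct_triples_def)

lemma distinct_pairsD:
  assumes "(i, j) \<in> distinct_pairs I"
  shows "i \<in> I" "j \<in> I" "i \<noteq> j"
  using assms by (auto simp: distinct_pairs_def)

lemma cycle3_permutes: "i \<in> I \<Longrightarrow> j \<in> I \<Longrightarrow> k \<in> I \<Longrightarrow> cycle3 i j k permutes I"
  unfolding cycle3_def by (intro permutes_compose permutes_swap_id)

lemma A3_sperm:
  assumes d: "i \<noteq> j" "i \<noteq> k" "j \<noteq> k"
  shows "A3 i j k a b = sperm (cycle3 i j k) (A3_sign i j k a b)"
proof -
  have "A3 i j k a b = sperm (cycle3 i j k)
      (\<lambda>l. (if transpose j k l = i \<or> transpose j k l = j then a else 1) * (if l = j \<or> l = k then b else 1))"
    unfolding A3_def tt_def cycle3_def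
    by (rule sperm_comp[of _ UNIV]) (simp_all add: permutes_swap_id)
  moreover have "(\<lambda>l. (if transpose j k l = i \<or> transpose j k l = j then a else 1) * (if l = j \<or> l = k then b else 1))
      = A3_sign i j k a b"
    using d by (auto simp: A3_sign_def transpose_def fun_eq_iff)
  ultimately show ?thesis by simp
qed

lemma signs_A3_sign:
  assumes "i \<in> I" "j \<in> I" "k \<in> I" "a \<in> {1, - 1}" "b \<in> {1, - 1}"
  shows "signs I (A3_sign i j k a b)"
  using assms by (auto simp: signs_def A3_sign_def)

lemma B2_sperm:
  assumes "i \<noteq> j"
  shows "B2 i j = sperm (transpose i j) (\<lambda>l. if l = i then - 1 else 1)"
proof -
  have "B2 i j = sperm (id \<circ> transpose i j)
      (\<lambda>l. (if transpose i j l = i then - 1 else 1) * (if l = i \<or> l = j then - 1 else 1))"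
    unfolding B2_def tt_def ss_def
    by (rule sperm_comp[of _ UNIV]) (simp_all add: permutes_swap_id permutes_id)
  moreover have "(\<lambda>l. (if transpose i j l = i then - 1 else 1) * (if l = i \<or> l = j then - 1 else 1))
      = (\<lambda>l. if l = i then - 1 else 1 :: real)"
    using assms by (auto simp: transpose_def fun_eq_iff)
  ultimately show ?thesis by simp
qed

lemma signs_B2: "i \<in> I \<Longrightarrow> signs I (\<lambda>l. if l = i then - 1 else 1)"
  by (simp add: signs_def)

lemma A3_set_sperms: "A3_set I \<subseteq> sperms I"
proof
  fix w assume "w \<in> A3_set I"
  then obtain i j k a b where w: "w = A3 i j k a b" "(i, j, k) \<in> distinct_triples I" "a \<in> {1, - 1}" "b \<in> {1, - 1}"
    by (rule A3_setE)
  note d = distinct_triplesD[OF w(2)]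
  show "w \<in> sperms I" unfolding w(1) A3_sperm[OF d(4-6)]
    by (intro sperms_I cycle3_permutes signs_A3_sign d w)
qed

lemma B2_set_sperms: "B2_set I \<subseteq> sperms I"
proof
  fix w assume "w \<in> B2_set I"
  then obtain i j where w: "w = B2 i j" "(i, j) \<in> distinct_pairs I" by (rule B2_setE)
  note d = distinct_pairsD[OF w(2)]
  show "w \<in> sperms I" unfolding w(1) B2_sperm[OF d(3)]
    by (intro sperms_I permutes_swap_id signs_B2 d)
qed

lemma A3_set_mono: "I \<subseteq> J \<Longrightarrow> A3_set I \<subseteq> A3_set J"
  unfolding A3_set_def A3_index_def distinct_triples_def by (rule image_mono) auto

lemma B2_set_mono: "I \<subseteq> J \<Longrightarrow> B2_set I \<subseteq> B2_set J"
  unfolding B2_set_def distinct_pairs_def by (rule image_mono) auto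

text \<open>A signed permutation maps the root \<open>long_root i j a\<close> to \<open>s i\<close>
  times \<open>long_root (p i) (p j) (s i * s j * a)\<close>, and the factor \<open>s i\<close> does
  not affect the reflection.\<close>

lemma sperm_tt:
  assumes p: "p permutes I" and s: "signs I s"
  shows "sperm p s \<circ> tt i j a = tt (p i) (p j) (s i * s j * a) \<circ> sperm p s"
proof -
  note pi = inj_eq[OF permutes_inj[OF p]]
  have "sperm p s \<circ> tt i j a
      = sperm (p \<circ> transpose i j) (\<lambda>l. s (transpose i j l) * (if l = i \<or> l = j then a else 1))"
    unfolding tt_def by (rule sperm_comp[of _ UNIV]) (simp_all add: permutes_swap_id permutes_subset[OF p])
  moreover have "tt (p i) (p j) (s i * s j * a) \<circ> sperm p s
      = sperm (transpose (p i) (p j) \<circ> p) (\<lambda>l. (if p l = p i \<or> p l = p j then s i * s j * a else 1) * s l)"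
    unfolding tt_def by (rule sperm_comp[of _ UNIV]) (simp_all add: permutes_swap_id permutes_subset[OF p])
  moreover have "p \<circ> transpose i j = transpose (p i) (p j) \<circ> p"
    by (auto simp: fun_eq_iff transpose_def pi)
  moreover have "s (transpose i j l) * (if l = i \<or> l = j then a else 1)
      = (if p l = p i \<or> p l = p j then s i * s j * a else 1) * s l" for l
    using signs_cases[OF s, of i] signs_cases[OF s, of j] by (auto simp: pi)
  ultimately show ?thesis by simp
qed

lemma sperm_ss:
  assumes p: "p permutes I"
  shows "sperm p s \<circ> ss i = ss (p i) \<circ> sperm p s"
proof -
  note pi = inj_eq[OF permutes_inj[OF p]]
  have "sperm p s \<circ> ss i = sperm (p \<circ> id) (\<lambda>l. s (id l) * (if l = i then - 1 else 1))"
    unfolding ss_def by (rule sperm_comp[of _ UNIV]) (simp_all add: permutes_id permutes_subset[OF p])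
  moreover have "ss (p i) \<circ> sperm p s = sperm (id \<circ> p) (\<lambda>l. (if p l = p i then - 1 else 1) * s l)"
    unfolding ss_def by (rule sperm_comp[of _ UNIV]) (simp_all add: permutes_id permutes_subset[OF p])
  ultimately show ?thesis by (simp add: pi mult.commute)
qed

lemma sperm_conj_A3:
  assumes p: "p permutes I" and s: "signs I s"
  shows "sperm p s \<circ> A3 i j k a b \<circ> sperm_inv p s = A3 (p i) (p j) (p k) (s i * s j * a) (s j * s k * b)"
proof -
  have "sperm p s \<circ> A3 i j k a b = A3 (p i) (p j) (p k) (s i * s j * a) (s j * s k * b) \<circ> sperm p s"
    unfolding A3_def using sperm_tt[OF assms] by (metis comp_assoc)
  then show ?thesis using sperm_inv(1)[OF assms] by (simp add: comp_assoc)
qed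

text \<open>The two quarter turns of a coordinate plane are both of the form \<open>B2\<close>, for
  the two orders of the indices. Thus a sign conflict in a conjugation only swaps the
  indices.\<close>

lemma B2_swap: "i \<noteq> j \<Longrightarrow> ss i \<circ> tt i j 1 = B2 j i"
  by (auto simp: B2_def fun_eq_iff ss_apply tt_apply)

lemma sperm_conj_B2:
  assumes p: "p permutes I" and s: "signs I s" and ij: "i \<noteq> j"
  shows "sperm p s \<circ> B2 i j \<circ> sperm_inv p s = (if s i = s j then B2 (p i) (p j) else B2 (p j) (p i))"
proof -
  have ne: "p i \<noteq> p j" using permutes_inj[OF p] ij by (simp add: inj_eq)
  have "sperm p s \<circ> B2 i j = (ss (p i) \<circ> tt (p i) (p j) (s i * s j * (- 1))) \<circ> sperm p s"
    unfolding B2_def using sperm_tt[OF p s] sperm_ss[OF p] by (metis comp_assoc)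
  then have "sperm p s \<circ> B2 i j \<circ> sperm_inv p s = ss (p i) \<circ> tt (p i) (p j) (s i * s j * (- 1))"
    using sperm_inv(1)[OF p s] by (simp add: comp_assoc)
  moreover have "s i * s j * (- 1) = (if s i = s j then - 1 else 1)"
    using signs_cases[OF s, of i] signs_cases[OF s, of j] by auto
  ultimately show ?thesis by (simp add: B2_swap[OF ne] flip: B2_def)
qed

text \<open>The first transposition places \<open>i0\<close>; the second moves \<open>j1\<close>,
  the place where \<open>j0\<close> has landed, to \<open>j\<close> without disturbing
  \<open>i\<close>.\<close>

lemma permutes_extend_pair:
  assumes "(i0, j0) \<in> distinct_pairs I" "(i, j) \<in> distinct_pairs I"
  obtains p where "p permutes I" "p i0 = i" "p j0 = j"
proof -
  note d = distinct_pairsD[OF assms(1)] distinct_pairsD[OF assms(2)]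
  define j1 where "j1 = transpose i0 i j0"
  have j1: "j1 \<in> I" "j1 \<noteq> i" using d by (auto simp: j1_def transpose_def)
  show thesis
  proof (rule that)
    show "transpose j1 j \<circ> transpose i0 i permutes I"
      by (intro permutes_compose permutes_swap_id d j1)
    show "(transpose j1 j \<circ> transpose i0 i) i0 = i" using d j1 by simp
    show "(transpose j1 j \<circ> transpose i0 i) j0 = j" by (simp flip: j1_def)
  qed
qed

lemma permutes_extend_triple:
  assumes "(i0, j0, k0) \<in> distinct_triples I" "(i, j, k) \<in> distinct_triples I"
  obtains p where "p permutes I" "p i0 = i" "p j0 = j" "p k0 = k"
proof -
  note d = distinct_triplesD[OF assms(1)] distinct_triplesD[OF assms(2)]
  have "(i0, j0) \<in> distinct_pairs I" "(i, j) \<in> distinct_pairs I" using d by (auto simp: distinct_pairs_def)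
  then obtain q where q: "q permutes I" "q i0 = i" "q j0 = j" by (rule permutes_extend_pair)
  define k1 where "k1 = q k0"
  have k1: "k1 \<in> I" "k1 \<noteq> i" "k1 \<noteq> j"
    using d q permutes_in_image[OF q(1)] inj_eq[OF permutes_inj[OF q(1)]] by (auto simp: k1_def)
  show thesis
  proof (rule that)
    show "transpose k1 k \<circ> q permutes I" by (intro permutes_compose permutes_swap_id d k1 q)
    show "(transpose k1 k \<circ> q) i0 = i" "(transpose k1 k \<circ> q) j0 = j" using d k1 q by simp_all
    show "(transpose k1 k \<circ> q) k0 = k" by (simp flip: k1_def)
  qed
qed

lemma conj_class_weyl_B:
  assumes "finite I"
  shows "conj_class (weyl_B I) w = {sperm p s \<circ> w \<circ> sperm_inv p s | p s. p permutes I \<and> signs I s}"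
proof (intro equalityI subsetI)
  fix x assume "x \<in> conj_class (weyl_B I) w"
  then obtain p s where "x = sperm p s \<circ> w \<circ> inv\<^bsub>weyl_B I\<^esub> (sperm p s)" "p permutes I" "signs I s"
    unfolding conj_class_def carrier_weyl_B[OF assms] sperms_def by auto
  then show "x \<in> {sperm p s \<circ> w \<circ> sperm_inv p s | p s. p permutes I \<and> signs I s}"
    using inv_weyl_B[OF assms] by auto
next
  fix x assume "x \<in> {sperm p s \<circ> w \<circ> sperm_inv p s | p s. p permutes I \<and> signs I s}"
  then obtain p s where x: "x = sperm p s \<circ> w \<circ> sperm_inv p s" and ps: "p permutes I" "signs I s"
    by blast
  have "x = sperm p s \<otimes>\<^bsub>weyl_B I\<^esub> w \<otimes>\<^bsub>weyl_B I\<^esub> inv\<^bsub>weyl_B I\<^esub> (sperm p s)"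
    using x inv_weyl_B[OF assms ps] by simp
  moreover have "sperm p s \<in> carrier (weyl_B I)"
    using sperms_I[OF ps] carrier_weyl_B[OF assms] by simp
  ultimately show "x \<in> conj_class (weyl_B I) w" unfolding conj_class_def by blast
qed

lemma A3_set_conj:
  assumes ps: "p permutes I" "signs I s" and "w \<in> A3_set I"
  shows "sperm p s \<circ> w \<circ> sperm_inv p s \<in> A3_set I"
proof -
  obtain i j k a b where w: "w = A3 i j k a b" "(i, j, k) \<in> distinct_triples I" "a \<in> {1, - 1}" "b \<in> {1, - 1}"
    using assms(3) by (rule A3_setE)
  have "(p i, p j, p k) \<in> distinct_triples I"
    using w(2) permutes_in_image[OF ps(1)] inj_eq[OF permutes_inj[OF ps(1)]] by (simp add: distinct_triples_def)
  moreover have "s x * s y * c \<in> {1, - 1}" if "c \<in> {1, - 1}" for x y c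
    using signs_cases[OF ps(2), of x] signs_cases[OF ps(2), of y] that by auto
  ultimately show ?thesis unfolding w(1) sperm_conj_A3[OF ps] using w(3,4) by (intro A3_setI)
qed

lemma B2_set_conj:
  assumes ps: "p permutes I" "signs I s" and "w \<in> B2_set I"
  shows "sperm p s \<circ> w \<circ> sperm_inv p s \<in> B2_set I"
proof -
  obtain i j where w: "w = B2 i j" "(i, j) \<in> distinct_pairs I" using assms(3) by (rule B2_setE)
  have "(p i, p j) \<in> distinct_pairs I" "(p j, p i) \<in> distinct_pairs I"
    using w(2) permutes_in_image[OF ps(1)] inj_eq[OF permutes_inj[OF ps(1)]] by (auto simp: distinct_pairs_def)
  then show ?thesis
    unfolding w(1) sperm_conj_B2[OF ps distinct_pairsD(3)[OF w(2)]] by (auto intro: B2_setI)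
qed

lemma conj_class_A3:
  assumes I: "finite I" and t: "(i0, j0, k0) \<in> distinct_triples I"
  shows "conj_class (weyl_B I) (A3 i0 j0 k0 1 1) = A3_set I"
proof
  show "conj_class (weyl_B I) (A3 i0 j0 k0 1 1) \<subseteq> A3_set I"
  proof
    fix w assume "w \<in> conj_class (weyl_B I) (A3 i0 j0 k0 1 1)"
    then obtain p s where w: "w = sperm p s \<circ> A3 i0 j0 k0 1 1 \<circ> sperm_inv p s" and ps: "p permutes I" "signs I s"
      unfolding conj_class_weyl_B[OF I] by blast
    show "w \<in> A3_set I" unfolding w using ps by (rule A3_set_conj) (rule A3_setI[OF t], simp_all)
  qed
  show "A3_set I \<subseteq> conj_class (weyl_B I) (A3 i0 j0 k0 1 1)"
  proof
    fix w assume "w \<in> A3_set I"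
    then obtain i j k a b where w: "w = A3 i j k a b" "(i, j, k) \<in> distinct_triples I" "a \<in> {1, - 1}" "b \<in> {1, - 1}"
      by (rule A3_setE)
    obtain p where p: "p permutes I" "p i0 = i" "p j0 = j" "p k0 = k"
      using permutes_extend_triple[OF t w(2)] by blast
    \<comment> \<open>Conjugation multiplies the two signs by \<open>s i0 * s j0\<close> and
      \<open>s j0 * s k0\<close>; with \<open>s j0 = 1\<close> the outer values \<open>a\<close> and
      \<open>b\<close> appear as they are.\<close>
    define s where "s = (\<lambda>l. if l = i0 then a else if l = k0 then b else 1)"
    have s: "signs I s" using w(3,4) distinct_triplesD[OF t] by (auto simp: signs_def s_def)
    have "s i0 = a" "s j0 = 1" "s k0 = b" using distinct_triplesD[OF t] by (auto simp: s_def)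
    then have "w = sperm p s \<circ> A3 i0 j0 k0 1 1 \<circ> sperm_inv p s"
      unfolding sperm_conj_A3[OF p(1) s] w(1) p(2-4) by simp
    then show "w \<in> conj_class (weyl_B I) (A3 i0 j0 k0 1 1)"
      unfolding conj_class_weyl_B[OF I] using p(1) s by blast
  qed
qed

text \<open>Permutations alone reach the whole class, because both turns of a plane are covered by
  ordered pairs.\<close>

lemma conj_class_B2:
  assumes I: "finite I" and t: "(i0, j0) \<in> distinct_pairs I"
  shows "conj_class (weyl_B I) (B2 i0 j0) = B2_set I"
proof
  note d = distinct_pairsD[OF t]
  show "conj_class (weyl_B I) (B2 i0 j0) \<subseteq> B2_set I"
  proof
    fix w assume "w \<in> conj_class (weyl_B I) (B2 i0 j0)"
    then obtain p s where w: "w = sperm p s \<circ> B2 i0 j0 \<circ> sperm_inv p s" and ps: "p permutes I" "signs I s"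
      unfolding conj_class_weyl_B[OF I] by blast
    show "w \<in> B2_set I" unfolding w using ps by (rule B2_set_conj) (rule B2_setI[OF t])
  qed
  show "B2_set I \<subseteq> conj_class (weyl_B I) (B2 i0 j0)"
  proof
    fix w assume "w \<in> B2_set I"
    then obtain i j where w: "w = B2 i j" "(i, j) \<in> distinct_pairs I" by (rule B2_setE)
    obtain p where p: "p permutes I" "p i0 = i" "p j0 = j"
      using permutes_extend_pair[OF t w(2)] by blast
    have s: "signs I (\<lambda>l. 1)" by (simp add: signs_def)
    have "w = sperm p (\<lambda>l. 1) \<circ> B2 i0 j0 \<circ> sperm_inv p (\<lambda>l. 1)"
      unfolding sperm_conj_B2[OF p(1) s d(3)] w(1) p(2-3) by simp
    then show "w \<in> conj_class (weyl_B I) (B2 i0 j0)"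
      unfolding conj_class_weyl_B[OF I] using p(1) s by blast
  qed
qed

lemma distinct_triples_small: "card I < 3 \<Longrightarrow> finite I \<Longrightarrow> distinct_triples I = {}"
proof (rule ccontr)
  assume *: "card I < 3" "finite I" "distinct_triples I \<noteq> {}"
  then obtain i j k where "(i, j, k) \<in> distinct_triples I" by auto
  from distinct_triplesD[OF this] have "card {i, j, k} = 3" "{i, j, k} \<subseteq> I" by auto
  then show False using card_mono[OF *(2), of "{i, j, k}"] *(1) by simp
qed

lemma distinct_pairs_small: "card I < 2 \<Longrightarrow> finite I \<Longrightarrow> distinct_pairs I = {}"
proof (rule ccontr)
  assume *: "card I < 2" "finite I" "distinct_pairs I \<noteq> {}"
  then obtain i j where "(i, j) \<in> distinct_pairs I" by auto
  from distinct_pairsD[OF this] have "card {i, j} = 2" "{i, j} \<subseteq> I" by auto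
  then show False using card_mono[OF *(2), of "{i, j}"] *(1) by simp
qed

text \<open>For n < 3 no distinct triples exist, in agreement with the empty class in
  \<open>e_A2\<close>, so the formula needs no restriction on \<open>n\<close>.\<close>

lemma e_A2_eq: "e_A2 n = indicator (A3_set {1..n})"
proof (cases "3 \<le> n")
  case True
  have r: "reflection {1..n} (\<lambda>l. eps 1 l - eps 2 l) = tt 1 2 1" "reflection {1..n} (\<lambda>l. eps 2 l - eps 3 l) = tt 2 3 1"
    using reflection_long_root[of "{1..n}" 1 2 1] reflection_long_root[of "{1..n}" 2 3 1] True
    by (simp_all add: long_root_def)
  have "(1, 2, 3) \<in> distinct_triples {1..n}" using True by (simp add: distinct_triples_def)
  from conj_class_A3[OF _ this] show ?thesis
    using True unfolding e_A2_def r by (simp flip: A3_def)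
next
  case False
  then show ?thesis by (simp add: e_A2_def A3_set_def A3_index_def distinct_triples_small)
qed

lemma e_B2_eq: "e_B2 n = indicator (B2_set {1..n})"
proof (cases "2 \<le> n")
  case True
  have r: "reflection {1..n} (eps 1) = ss 1" "reflection {1..n} (\<lambda>l. eps 1 l - eps 2 l) = tt 1 2 1"
    using reflection_eps[of "{1..n}" 1] reflection_long_root[of "{1..n}" 1 2 1] True
    by (simp_all add: long_root_def)
  \<comment> \<open>The representative \<open>ss 1 \<circ> tt 1 2 1\<close> is \<open>B2 2 1\<close>
    by \<open>B2_swap\<close>, hence the reversed pair.\<close>
  have "(2, 1) \<in> distinct_pairs {1..n}" using True by (simp add: distinct_pairs_def)
  from conj_class_B2[OF _ this] show ?thesis
    using True unfolding e_B2_def r by (simp add: B2_swap)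
next
  case False
  then show ?thesis by (simp add: e_B2_def B2_set_def distinct_pairs_small)
qed

section \<open>Multiplicities of the tuples that index the two classes\<close>

lemma finite_A3_index: "finite I \<Longrightarrow> finite (A3_index I)"
  by (simp add: A3_index_def finite_distinct_triples)

lemma A3_rotate:
  assumes "i \<noteq> j" "i \<noteq> k" "j \<noteq> k" "a \<in> {1, - 1}" "b \<in> {1, - 1}"
  shows "A3 j k i b (a * b) = A3 i j k a b" "A3 k i j (a * b) a = A3 i j k a b"
  using assms by (auto simp: A3_def fun_eq_iff tt_apply)

lemma A3_eq_iff:
  assumes x: "((i, j, k), a, b) \<in> A3_index I" and y: "((i', j', k'), a', b') \<in> A3_index I"
  shows "A3 i' j' k' a' b' = A3 i j k a b \<longleftrightarrow>
    ((i', j', k'), a', b') \<in> {((i, j, k), a, b), ((j, k, i), b, a * b), ((k, i, j), a * b, a)}"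
proof
  have t: "(i, j, k) \<in> distinct_triples I" "a \<in> {1, - 1}" "b \<in> {1, - 1}"
    and t': "(i', j', k') \<in> distinct_triples I" "a' \<in> {1, - 1}" "b' \<in> {1, - 1}"
    using x y by (auto simp: A3_index_def)
  note d = distinct_triplesD[OF t(1)] and d' = distinct_triplesD[OF t'(1)]
  {
    assume "A3 i' j' k' a' b' = A3 i j k a b"
    then have *: "cycle3 i' j' k' = cycle3 i j k" "A3_sign i' j' k' a' b' = A3_sign i j k a b"
      unfolding A3_sperm[OF d(4-6)] A3_sperm[OF d'(4-6)]
      using sperm_eq_iff[of "cycle3 i' j' k'" I _ "cycle3 i j k" I]
        cycle3_permutes[OF d(1-3)] cycle3_permutes[OF d'(1-3)] signs_A3_sign[OF d(1-3) t(2,3)]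
        signs_A3_sign[OF d'(1-3) t'(2,3)] by blast+
    have sgn: "a' = A3_sign i j k a b i'" "b' = A3_sign i j k a b j'"
      using fun_cong[OF *(2), of i'] fun_cong[OF *(2), of j'] d' by (simp_all add: A3_sign_def)
    have "(i', j', k') \<in> {(i, j, k), (j, k, i), (k, i, j)}"
      using cycle3_eq_iff[OF t(1) t'(1)] *(1) by blast
    then show "((i', j', k'), a', b') \<in> {((i, j, k), a, b), ((j, k, i), b, a * b), ((k, i, j), a * b, a)}"
      using sgn d by (auto simp: A3_sign_def)
  }
  {
    assume "((i', j', k'), a', b') \<in> {((i, j, k), a, b), ((j, k, i), b, a * b), ((k, i, j), a * b, a)}"
    then show "A3 i' j' k' a' b' = A3 i j k a b"
      using A3_rotate[OF d(4-6) t(2,3)] by auto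
  }
qed

lemma sum_A3:
  fixes h :: "((nat \<Rightarrow> real) \<Rightarrow> nat \<Rightarrow> real) \<Rightarrow> complex"
  assumes "finite I"
  shows "(\<Sum>((i, j, k), a, b)\<in>A3_index I. h (A3 i j k a b)) = 3 * (\<Sum>w\<in>A3_set I. h w)"
proof -
  define f where "f = (\<lambda>((i, j, k), a, b). A3 i j k a b)"
  have "card {y \<in> A3_index I. f y = f x} = 3" if x: "x \<in> A3_index I" for x
  proof -
    obtain i j k a b where xe: "x = ((i, j, k), a, b)" by (metis prod.collapse)
    have t: "(i, j, k) \<in> distinct_triples I" "a \<in> {1, - 1}" "b \<in> {1, - 1}"
      using x by (auto simp: A3_index_def xe)
    note d = distinct_triplesD[OF t(1)]
    have ab: "a * b \<in> {1, - 1}" using t by auto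
    let ?F = "{((i, j, k), a, b), ((j, k, i), b, a * b), ((k, i, j), a * b, a)}"
    have sub: "?F \<subseteq> A3_index I"
    proof -
      have "(j, k, i) \<in> distinct_triples I" "(k, i, j) \<in> distinct_triples I"
        using d by (auto simp: distinct_triples_def)
      then show ?thesis unfolding A3_index_def using t ab by blast
    qed
    have "{y \<in> A3_index I. f y = f x} = ?F"
    proof (intro equalityI subsetI)
      fix y assume y: "y \<in> {y \<in> A3_index I. f y = f x}"
      obtain i' j' k' a' b' where ye: "y = ((i', j', k'), a', b')" by (metis prod.collapse)
      show "y \<in> ?F"
        using A3_eq_iff[OF x[unfolded xe], of i' j' k' a' b'] y by (simp add: ye xe f_def)
    next
      fix y assume y: "y \<in> ?F"
      obtain i' j' k' a' b' where ye: "y = ((i', j', k'), a', b')" by (metis prod.collapse)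
      have "y \<in> A3_index I" using y sub by blast
      then show "y \<in> {y \<in> A3_index I. f y = f x}"
        using A3_eq_iff[OF x[unfolded xe], of i' j' k' a' b'] y by (simp add: ye xe f_def)
    qed
    then show ?thesis using d by simp
  qed
  from sum_fibres[OF finite_A3_index[OF assms] this, of h]
  show ?thesis by (simp add: f_def A3_set_def case_prod_beta)
qed

text \<open>Here there is no multiplicity: \<open>i\<close> is recovered as the only index whose
  basis vector gets a negative sign, and \<open>j\<close> as its image.\<close>

lemma inj_on_B2: "inj_on (\<lambda>(i, j). B2 i j) (distinct_pairs I)"
proof
  fix x y assume xy: "x \<in> distinct_pairs I" "y \<in> distinct_pairs I" "(\<lambda>(i, j). B2 i j) x = (\<lambda>(i, j). B2 i j) y"
  obtain i j i' j' where e: "x = (i, j)" "y = (i', j')" by (metis prod.collapse)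
  note d = distinct_pairsD[OF xy(1)[unfolded e]] and d' = distinct_pairsD[OF xy(2)[unfolded e]]
  have "sperm (transpose i j) (\<lambda>l. if l = i then - 1 else 1) = sperm (transpose i' j') (\<lambda>l. if l = i' then - 1 else 1)"
    using xy(3) by (simp add: e B2_sperm[OF d(3)] B2_sperm[OF d'(3)])
  then have *: "transpose i j = transpose i' j'" "(\<lambda>l. if l = i then - 1 else 1 :: real) = (\<lambda>l. if l = i' then - 1 else 1)"
    using sperm_eq_iff[OF permutes_swap_id[OF d(1,2)] signs_B2[OF d(1)] permutes_swap_id[OF d'(1,2)] signs_B2[OF d'(1)]]
    by blast+
  have "i = i'" using fun_cong[OF *(2), of i] by (simp split: if_splits)
  moreover have "j = j'" using fun_cong[OF *(1), of i] \<open>i = i'\<close> by simp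
  ultimately show "x = y" by (simp add: e)
qed

lemma sum_B2:
  fixes h :: "((nat \<Rightarrow> real) \<Rightarrow> nat \<Rightarrow> real) \<Rightarrow> complex"
  shows "(\<Sum>(i, j)\<in>distinct_pairs I. h (B2 i j)) = (\<Sum>w\<in>B2_set I. h w)"
  unfolding B2_set_def sum.reindex[OF inj_on_B2] by (simp add: case_prod_beta)

section \<open>The Casimir element\<close>

text \<open>The \<open>\<epsilon>\<^sub>l\<close>-coordinate of the positive root that defines the reflection \<open>tt l j a\<close>.\<close>

definition root_coeff :: "nat \<Rightarrow> nat \<Rightarrow> real \<Rightarrow> complex" where
  "root_coeff l j a = (if l < j then 1 else - of_real a)"

section \<open>Sums over positive roots, one coordinate at a time\<close>

lemma inj_on_long_root:
  "inj_on (\<lambda>(i, j, a). long_root i j a) {(i, j, a). i \<in> I \<and> j \<in> I \<and> i < j \<and> a \<in> {1, - 1}}"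
proof
  fix x y
  assume x: "x \<in> {(i, j, a). i \<in> I \<and> j \<in> I \<and> i < j \<and> a \<in> {1, - 1 :: real}}"
    and y: "y \<in> {(i, j, a). i \<in> I \<and> j \<in> I \<and> i < j \<and> a \<in> {1, - 1 :: real}}"
    and eq: "(\<lambda>(i, j, a). long_root i j a) x = (\<lambda>(i, j, a). long_root i j a) y"
  obtain i j a where xe: "x = (i, j, a)" by (metis prod.collapse)
  obtain i' j' a' where ye: "y = (i', j', a')" by (metis prod.collapse)
  have supp: "{l. long_root i j a l \<noteq> 0} = {i, j}" if "i < j" "a \<in> {1, - 1}" for i j a
    using that by (auto simp: long_root_def eps_def)
  have "{i, j} = {i', j'}" using eq x y supp[of i j a] supp[of i' j' a'] by (simp add: xe ye)
  then have ij: "i = i'" "j = j'" using x y by (auto simp: xe ye doubleton_eq_iff)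
  have "long_root i j a j = long_root i' j' a' j" using eq by (simp add: xe ye)
  then have "a = a'" using x by (simp add: xe long_root_def eps_def flip: ij)
  then show "x = y" using ij by (simp add: xe ye)
qed

lemma inj_eps: "inj eps"
proof
  fix i j assume "eps i = eps j"
  then have "eps i i = eps j i" by simp
  then show "i = j" by (simp add: eps_def split: if_splits)
qed

text \<open>The weight given by the coordinate \<open>l\<close> kills all roots except
  \<open>eps l\<close> and the long roots through \<open>l\<close>. The function \<open>F\<close> is
  arbitrary so that the lemma serves the inner and the outer sum of the Casimir element.\<close>

lemma root_sum:
  fixes F :: "((nat \<Rightarrow> real) \<Rightarrow> nat \<Rightarrow> real) \<Rightarrow> complex"
  assumes I: "finite I" and l: "l \<in> I"
  shows "(\<Sum>\<alpha>\<in>pos_roots I. root_param I kl ks \<alpha> * of_real (\<alpha> l) * F (reflection I \<alpha>))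
    = ks * F (ss l) + kl * (\<Sum>j\<in>I - {l}. \<Sum>a\<in>{1, - 1}. root_coeff l j a * F (tt l j a))"
proof -
  define \<Lambda> where "\<Lambda> = {(i, j, a). i \<in> I \<and> j \<in> I \<and> i < j \<and> a \<in> {1, - 1 :: real}}"
  define g where "g \<alpha> = root_param I kl ks \<alpha> * of_real (\<alpha> l) * F (reflection I \<alpha>)" for \<alpha>
  have fin\<Lambda>: "finite \<Lambda>"
    by (rule finite_subset[of _ "I \<times> I \<times> {1, - 1}"]) (auto simp: \<Lambda>_def I)
  have disj: "(\<lambda>(i, j, a). long_root i j a) ` \<Lambda> \<inter> eps ` I = {}"
  proof (rule ccontr)
    assume "(\<lambda>(i, j, a). long_root i j a) ` \<Lambda> \<inter> eps ` I \<noteq> {}"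
    then obtain i j a m where *: "(i, j, a) \<in> \<Lambda>" "m \<in> I" "long_root i j a = eps m" by fastforce
    then have "bform I (long_root i j a) (long_root i j a) = 2"
      by (intro bform_long_root_self[OF I]) (auto simp: \<Lambda>_def)
    moreover have "bform I (eps m) (eps m) = 1" using *(2) I by (simp add: bform_eps) (simp add: eps_def)
    ultimately show False using *(3) by simp
  qed
  have "(\<Sum>\<alpha>\<in>pos_roots I. g \<alpha>)
      = (\<Sum>\<alpha>\<in>(\<lambda>(i, j, a). long_root i j a) ` \<Lambda>. g \<alpha>) + (\<Sum>\<alpha>\<in>eps ` I. g \<alpha>)"
    unfolding pos_roots_eq \<Lambda>_def[symmetric] using fin\<Lambda> I disj by (intro sum.union_disjoint) auto
  also have "(\<Sum>\<alpha>\<in>eps ` I. g \<alpha>) = (\<Sum>i\<in>I. g (eps i))"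
    by (simp add: sum.reindex[OF inj_on_subset[OF inj_eps subset_UNIV]])
  also have "\<dots> = (\<Sum>i\<in>I. if i = l then ks * F (ss l) else 0)"
  proof (rule sum.cong[OF refl])
    fix i assume i: "i \<in> I"
    have "bform I (eps i) (eps i) = 1" using i I by (simp add: bform_eps) (simp add: eps_def)
    then show "g (eps i) = (if i = l then ks * F (ss l) else 0)"
      using i I by (simp add: g_def root_param_def reflection_eps) (simp add: eps_def)
  qed
  also have "\<dots> = ks * F (ss l)" using I l by simp
  also have "(\<Sum>\<alpha>\<in>(\<lambda>(i, j, a). long_root i j a) ` \<Lambda>. g \<alpha>) = (\<Sum>(i, j, a)\<in>\<Lambda>. g (long_root i j a))"
    using sum.reindex[OF inj_on_long_root[of I], of g] by (simp add: \<Lambda>_def case_prod_beta)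
  also have "\<dots> = (\<Sum>(i, j, a)\<in>\<Lambda>. kl * of_real (long_root i j a l) * F (tt i j a))"
  proof (rule sum.cong[OF refl])
    fix x assume "x \<in> \<Lambda>"
    then obtain i j a where x: "x = (i, j, a)" "i \<in> I" "j \<in> I" "i \<noteq> j" "a \<in> {1, - 1}"
      unfolding \<Lambda>_def by auto
    show "(case x of (i, j, a) \<Rightarrow> g (long_root i j a))
        = (case x of (i, j, a) \<Rightarrow> kl * of_real (long_root i j a l) * F (tt i j a))"
      unfolding x(1) prod.case g_def root_param_def bform_long_root_self[OF I x(2-5)]
        reflection_long_root[OF I x(2-5)] by simp
  qed
  also have "\<dots> = (\<Sum>(i, j, a)\<in>{(i, j, a) \<in> \<Lambda>. i = l \<or> j = l}. kl * of_real (long_root i j a l) * F (tt i j a))"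
    by (rule sum.mono_neutral_right[OF fin\<Lambda>]) (auto simp: long_root_def eps_def split: if_splits)
  \<comment> \<open>A long root through \<open>l\<close> is indexed by its other index
    \<open>j\<close>. Whether \<open>l\<close> comes first or second decides its coordinate, 1 or
    -a, which is \<open>root_coeff\<close>.\<close>
  also have "\<dots> = (\<Sum>(j, a)\<in>(I - {l}) \<times> {1, - 1}. kl * (root_coeff l j a * F (tt l j a)))"
  proof (rule sum.reindex_bij_witness[of _ "\<lambda>(j, a). if l < j then (l, j, a) else (j, l, a)"
          "\<lambda>(i, j, a). if i = l then (j, a) else (i, a)"])
    fix x assume "x \<in> {(i, j, a) \<in> \<Lambda>. i = l \<or> j = l}"
    then obtain i j a where x: "x = (i, j, a)" "i \<in> I" "j \<in> I" "i < j" "a \<in> {1, - 1}" "i = l \<or> j = l"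
      unfolding \<Lambda>_def by auto
    show "(case case x of (i, j, a) \<Rightarrow> if i = l then (j, a) else (i, a) of
        (j, a) \<Rightarrow> if l < j then (l, j, a) else (j, l, a)) = x"
      using x by auto
    show "(case x of (i, j, a) \<Rightarrow> if i = l then (j, a) else (i, a)) \<in> (I - {l}) \<times> {1, - 1}"
      using x by auto
    have "tt i j a = tt j i a" by (auto simp: tt_apply fun_eq_iff)
    then show "(case case x of (i, j, a) \<Rightarrow> if i = l then (j, a) else (i, a) of
        (j, a) \<Rightarrow> kl * (root_coeff l j a * F (tt l j a)))
        = (case x of (i, j, a) \<Rightarrow> kl * of_real (long_root i j a l) * F (tt i j a))"
      using x by (auto simp: root_coeff_def long_root_def eps_def)
  next
    fix y assume "y \<in> (I - {l}) \<times> {1, - 1 :: real}"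
    then obtain j a where y: "y = (j, a)" "j \<in> I" "j \<noteq> l" "a \<in> {1, - 1}" by auto
    show "(case case y of (j, a) \<Rightarrow> if l < j then (l, j, a) else (j, l, a) of
        (i, j, a) \<Rightarrow> if i = l then (j, a) else (i, a)) = y"
      using y by auto
    show "(case y of (j, a) \<Rightarrow> if l < j then (l, j, a) else (j, l, a)) \<in> {(i, j, a) \<in> \<Lambda>. i = l \<or> j = l}"
      using y l by (auto simp: \<Lambda>_def)
  qed
  also have "\<dots> = kl * (\<Sum>(j, a)\<in>(I - {l}) \<times> {1, - 1}. root_coeff l j a * F (tt l j a))"
    by (simp add: sum_distrib_left case_prod_beta)
  also have "(\<Sum>(j, a)\<in>(I - {l}) \<times> {1, - 1}. root_coeff l j a * F (tt l j a))
      = (\<Sum>j\<in>I - {l}. \<Sum>a\<in>{1, - 1}. root_coeff l j a * F (tt l j a))"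
    by (rule sum.cartesian_product[symmetric])
  finally show ?thesis by (simp only: g_def add.commute)
qed

lemma sum_distinct_pairs:
  "finite I \<Longrightarrow> (\<Sum>l\<in>I. \<Sum>j\<in>I - {l}. f l j) = (\<Sum>(l, j)\<in>distinct_pairs I. f l j)"
proof -
  assume "finite I"
  moreover have "distinct_pairs I = (SIGMA l:I. I - {l})" by (auto simp: distinct_pairs_def)
  ultimately show ?thesis by (simp add: sum.Sigma)
qed

lemma sum_distinct_pairs_swap:
  "(\<Sum>(l, j)\<in>distinct_pairs I. f l j) = (\<Sum>(l, j)\<in>distinct_pairs I. f j l)"
  by (rule sum.reindex_bij_witness[of _ "\<lambda>(l, j). (j, l)" "\<lambda>(l, j). (j, l)"])
    (auto simp: distinct_pairs_def)

text \<open>The coordinate \<open>l\<close> shared by the two roots becomes the middle entry, to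
  match \<open>A3 j l k\<close>.\<close>

lemma sum_distinct_triples:
  "finite I \<Longrightarrow> (\<Sum>l\<in>I. \<Sum>j\<in>I - {l}. \<Sum>k\<in>I - {l} - {j}. f j l k) = (\<Sum>(j, l, k)\<in>distinct_triples I. f j l k)"
proof -
  assume I: "finite I"
  have "(\<Sum>(j, l, k)\<in>distinct_triples I. f j l k)
      = (\<Sum>(l, j, k)\<in>(SIGMA l:I. SIGMA j:I - {l}. I - {l} - {j}). f j l k)"
    by (rule sum.reindex_bij_witness[of _ "\<lambda>(j, l, k). (l, j, k)" "\<lambda>(j, l, k). (l, j, k)"])
      (auto simp: distinct_triples_def)
  also have "\<dots> = (\<Sum>l\<in>I. \<Sum>j\<in>I - {l}. \<Sum>k\<in>I - {l} - {j}. f j l k)"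
    using I by (simp add: sum.Sigma)
  finally show ?thesis by simp
qed

lemma tt_commute: "tt i j a = tt j i a"
  by (auto simp: tt_apply fun_eq_iff)

lemma tt_ss: "i \<noteq> j \<Longrightarrow> tt i j a \<circ> ss i = ss j \<circ> tt i j a"
  by (auto simp: tt_apply ss_apply fun_eq_iff)

lemma tt_tt: "i \<noteq> j \<Longrightarrow> a \<in> {1, - 1} \<Longrightarrow> tt i j a \<circ> tt i j a = id"
  by (auto simp: tt_apply fun_eq_iff)

lemma tt_tt_uminus: "i \<noteq> j \<Longrightarrow> tt i j (- 1) \<circ> tt i j 1 = tt i j 1 \<circ> tt i j (- 1)"
  by (auto simp: tt_apply fun_eq_iff)

lemma ss_ss: "ss i \<circ> ss i = id"
  by (auto simp: ss_apply fun_eq_iff)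

text \<open>The reflections in a short root and an incident long root occur with total coefficient
  \<open>1 - a\<close>, so only the pairs \<open>\<epsilon>\<^sub>l + \<epsilon>\<^sub>j\<close> survive.\<close>

lemma short_long_sum:
  fixes h :: "((nat \<Rightarrow> real) \<Rightarrow> nat \<Rightarrow> real) \<Rightarrow> complex"
  assumes I: "finite I"
  shows "(\<Sum>l\<in>I. \<Sum>j\<in>I - {l}. \<Sum>a\<in>{1, - 1}. root_coeff l j a * h (ss l \<circ> tt l j a))
    + (\<Sum>l\<in>I. \<Sum>j\<in>I - {l}. \<Sum>a\<in>{1, - 1}. root_coeff l j a * h (tt l j a \<circ> ss l))
    = 2 * (\<Sum>w\<in>B2_set I. h w)"
proof -
  have "(\<Sum>l\<in>I. \<Sum>j\<in>I - {l}. \<Sum>a\<in>{1, - 1}. root_coeff l j a * h (tt l j a \<circ> ss l))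
      = (\<Sum>(l, j)\<in>distinct_pairs I. \<Sum>a\<in>{1, - 1}. root_coeff l j a * h (tt l j a \<circ> ss l))"
    by (rule sum_distinct_pairs[OF I])
  \<comment> \<open>Moving the short reflection to the front turns \<open>ss l\<close> into
    \<open>ss j\<close>; exchanging the names then brings both orders of multiplication to the form
    \<open>ss l \<circ> tt l j a\<close>.\<close>
  also have "\<dots> = (\<Sum>(l, j)\<in>distinct_pairs I. \<Sum>a\<in>{1, - 1}. root_coeff l j a * h (ss j \<circ> tt l j a))"
    by (rule sum.cong[OF refl]) (auto simp: distinct_pairs_def tt_ss)
  also have "\<dots> = (\<Sum>(l, j)\<in>distinct_pairs I. \<Sum>a\<in>{1, - 1}. root_coeff j l a * h (ss l \<circ> tt j l a))"
    by (rule sum_distinct_pairs_swap)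
  finally have "(\<Sum>l\<in>I. \<Sum>j\<in>I - {l}. \<Sum>a\<in>{1, - 1}. root_coeff l j a * h (ss l \<circ> tt l j a))
      + (\<Sum>l\<in>I. \<Sum>j\<in>I - {l}. \<Sum>a\<in>{1, - 1}. root_coeff l j a * h (tt l j a \<circ> ss l))
      = (\<Sum>(l, j)\<in>distinct_pairs I. (\<Sum>a\<in>{1, - 1}. root_coeff l j a * h (ss l \<circ> tt l j a))
        + (\<Sum>a\<in>{1, - 1}. root_coeff j l a * h (ss l \<circ> tt j l a)))"
    unfolding sum_distinct_pairs[OF I] by (simp add: sum.distrib case_prod_beta)
  also have "\<dots> = (\<Sum>(l, j)\<in>distinct_pairs I. 2 * h (B2 l j))"
  proof (rule sum.cong[OF refl])
    fix x assume "x \<in> distinct_pairs I"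
    then obtain l j where x: "x = (l, j)" "l \<noteq> j" by (auto simp: distinct_pairs_def)
    have "(\<Sum>a\<in>{1, - 1}. root_coeff l j a * h (ss l \<circ> tt l j a))
        + (\<Sum>a\<in>{1, - 1}. root_coeff j l a * h (ss l \<circ> tt j l a)) = 2 * h (B2 l j)"
      using x(2) unfolding tt_commute[of j l] B2_def by (simp add: root_coeff_def)
    then show "(case x of (l, j) \<Rightarrow> (\<Sum>a\<in>{1, - 1}. root_coeff l j a * h (ss l \<circ> tt l j a))
        + (\<Sum>a\<in>{1, - 1}. root_coeff j l a * h (ss l \<circ> tt j l a))) = (case x of (l, j) \<Rightarrow> 2 * h (B2 l j))"
      by (simp only: x(1) prod.case)
  qed
  also have "\<dots> = 2 * (\<Sum>w\<in>B2_set I. h w)"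
    unfolding sum_B2[symmetric] by (simp add: sum_distrib_left case_prod_beta)
  finally show ?thesis .
qed

text \<open>Equal signs give the identity, twice for each ordered pair. Opposite signs give the
  orthogonal roots eps_l + eps_j and eps_l - eps_j, whose products of coordinates at
  \<open>l\<close> and at \<open>j\<close> cancel.\<close>

lemma same_plane_sum:
  fixes h :: "((nat \<Rightarrow> real) \<Rightarrow> nat \<Rightarrow> real) \<Rightarrow> complex"
  assumes I: "finite I"
  shows "(\<Sum>l\<in>I. \<Sum>j\<in>I - {l}. \<Sum>a\<in>{1, - 1}. \<Sum>b\<in>{1, - 1}.
      root_coeff l j a * (root_coeff l j b * h (tt l j a \<circ> tt l j b)))
    = 2 * of_nat (card I) * (of_nat (card I) - 1) * h id"
proof -
  define q where "q l j = h (tt l j 1 \<circ> tt l j (- 1))" for l j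
  define c where "c l j = (if l < j then 1 else - 1 :: complex)" for l j :: nat
  have "(\<Sum>l\<in>I. \<Sum>j\<in>I - {l}. \<Sum>a\<in>{1, - 1}. \<Sum>b\<in>{1, - 1}.
      root_coeff l j a * (root_coeff l j b * h (tt l j a \<circ> tt l j b)))
      = (\<Sum>(l, j)\<in>distinct_pairs I. \<Sum>a\<in>{1, - 1}. \<Sum>b\<in>{1, - 1}.
      root_coeff l j a * (root_coeff l j b * h (tt l j a \<circ> tt l j b)))"
    by (rule sum_distinct_pairs[OF I])
  also have "\<dots> = (\<Sum>(l, j)\<in>distinct_pairs I. 2 * h id + 2 * c l j * q l j)"
  proof (rule sum.cong[OF refl])
    fix x assume "x \<in> distinct_pairs I"
    then obtain l j where x: "x = (l, j)" "l \<noteq> j" by (auto simp: distinct_pairs_def)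
    have "(\<Sum>a\<in>{1, - 1}. \<Sum>b\<in>{1, - 1}. root_coeff l j a * (root_coeff l j b * h (tt l j a \<circ> tt l j b)))
        = 2 * h id + 2 * c l j * q l j"
      using x(2) tt_tt[OF x(2), of 1] tt_tt[OF x(2), of "- 1"]
      by (simp add: root_coeff_def c_def q_def tt_tt_uminus)
    then show "(case x of (l, j) \<Rightarrow> \<Sum>a\<in>{1, - 1}. \<Sum>b\<in>{1, - 1}.
        root_coeff l j a * (root_coeff l j b * h (tt l j a \<circ> tt l j b)))
        = (case x of (l, j) \<Rightarrow> 2 * h id + 2 * c l j * q l j)"
      by (simp only: x(1) prod.case)
  qed
  also have "\<dots> = of_nat (card (distinct_pairs I)) * (2 * h id) + 2 * (\<Sum>(l, j)\<in>distinct_pairs I. c l j * q l j)"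
    by (simp add: case_prod_beta sum.distrib sum_distrib_left mult.assoc)
  also have "(\<Sum>(l, j)\<in>distinct_pairs I. c l j * q l j) = 0"
  proof -
    have "(\<Sum>(l, j)\<in>distinct_pairs I. c l j * q l j) = (\<Sum>(l, j)\<in>distinct_pairs I. c j l * q j l)"
      by (rule sum_distinct_pairs_swap)
    also have "\<dots> = (\<Sum>(l, j)\<in>distinct_pairs I. - (c l j * q l j))"
      by (rule sum.cong[OF refl]) (auto simp: distinct_pairs_def c_def q_def tt_commute)
    also have "\<dots> = - (\<Sum>(l, j)\<in>distinct_pairs I. c l j * q l j)"
      by (simp add: case_prod_beta sum_negf)
    finally show ?thesis by simp
  qed
  also have "of_nat (card (distinct_pairs I)) = (of_nat (card I) * (of_nat (card I) - 1) :: complex)"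
  proof -
    have "of_nat (card (distinct_pairs I)) = (\<Sum>(l, j)\<in>distinct_pairs I. 1 :: complex)"
      by (simp add: case_prod_beta)
    also have "\<dots> = (\<Sum>l\<in>I. \<Sum>j\<in>I - {l}. 1 :: complex)"
      by (rule sum_distinct_pairs[OF I, symmetric])
    also have "\<dots> = (\<Sum>l\<in>I. of_nat (card I) - 1)"
    proof (rule sum.cong[OF refl])
      fix l assume "l \<in> I"
      then have "card I = Suc (card (I - {l}))" using card_Suc_Diff1[OF I] by simp
      then show "(\<Sum>j\<in>I - {l}. 1 :: complex) = of_nat (card I) - 1" by simp
    qed
    finally show ?thesis by simp
  qed
  finally show ?thesis by (simp only: mult_zero_left mult_zero_right add_0_right mult_ac)
qed

text \<open>A rotation of the plane of an \<open>A\<^sub>2\<close>-subsystem is a product of two of its reflections in three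
  ways, and the inner products of the three pairs of positive roots add up to \<open>1\<close>.\<close>

lemma rotation_sum:
  fixes h :: "((nat \<Rightarrow> real) \<Rightarrow> nat \<Rightarrow> real) \<Rightarrow> complex"
  assumes I: "finite I"
  shows "(\<Sum>((i, j, k), a, b)\<in>A3_index I. root_coeff j i a * root_coeff j k b * h (A3 i j k a b))
    = (\<Sum>w\<in>A3_set I. h w)"
proof -
  \<comment> \<open>The two roots share only the coordinate \<open>j\<close>, so this product is
    their inner product.\<close>
  define W where "W = (\<lambda>((i, j, k), a, b). root_coeff j i a * root_coeff j k b)"
  define H where "H = (\<lambda>((i, j, k), a, b). h (A3 i j k a b))"
  \<comment> \<open>Starting the cycle one index later changes the pair of reflections but not the
    rotation, by \<open>A3_rotate\<close>.\<close>
  define r where "r = (\<lambda>((i::nat, j::nat, k::nat), a::real, b::real). ((j, k, i), b, a * b))"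
  define S where "S = (\<Sum>x\<in>A3_index I. W x * H x)"
  have r_in: "r x \<in> A3_index I" and r3: "r (r (r x)) = x" and Hr: "H (r x) = H x"
    and W1: "W x + W (r x) + W (r (r x)) = 1" if "x \<in> A3_index I" for x
  proof -
    obtain i j k a b where x: "x = ((i, j, k), a, b)" by (metis prod.collapse)
    have t: "(i, j, k) \<in> distinct_triples I" "a \<in> {1, - 1}" "b \<in> {1, - 1}"
      using that by (auto simp: A3_index_def x)
    note d = distinct_triplesD[OF t(1)]
    have ab: "a * b \<in> {1, - 1}" using t by auto
    have "(j, k, i) \<in> distinct_triples I" using d by (auto simp: distinct_triples_def)
    then show "r x \<in> A3_index I" unfolding x r_def prod.case A3_index_def using t ab by blast
    show "r (r (r x)) = x" unfolding x r_def prod.case using t by auto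
    show "H (r x) = H x" unfolding x r_def H_def prod.case A3_rotate(1)[OF d(4-6) t(2,3)] ..
    have tot: "j < i \<longleftrightarrow> \<not> i < j" "k < j \<longleftrightarrow> \<not> j < k" "k < i \<longleftrightarrow> \<not> i < k"
      using d(4-6) by auto
    have "i < j \<Longrightarrow> j < k \<Longrightarrow> i < k" "\<not> i < j \<Longrightarrow> \<not> j < k \<Longrightarrow> \<not> i < k"
      by auto
    then show "W x + W (r x) + W (r (r x)) = 1"
      using t(2,3) unfolding x r_def W_def prod.case root_coeff_def tot
      by (cases "i < j"; cases "j < k"; cases "i < k") auto
  qed
  have shift: "(\<Sum>x\<in>A3_index I. g (r x)) = (\<Sum>x\<in>A3_index I. g x)" for g :: "_ \<Rightarrow> complex"
    by (rule sum.reindex_bij_witness[of _ "\<lambda>x. r (r x)" r]) (auto simp: r3 r_in)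
  have "(\<Sum>x\<in>A3_index I. W (r x) * H x) = S"
    unfolding S_def shift[of "\<lambda>x. W x * H x", symmetric] by (rule sum.cong[OF refl]) (simp add: Hr)
  note S1 = this
  have S2: "(\<Sum>x\<in>A3_index I. W (r (r x)) * H x) = S"
  proof -
    have "(\<Sum>x\<in>A3_index I. W (r (r x)) * H x) = (\<Sum>x\<in>A3_index I. W (r (r x)) * H (r x))"
      by (rule sum.cong[OF refl]) (simp add: Hr)
    also have "\<dots> = (\<Sum>x\<in>A3_index I. W (r x) * H x)" by (rule shift[of "\<lambda>x. W (r x) * H x"])
    finally show ?thesis using S1 by (rule trans)
  qed
  \<comment> \<open>Averaging over the three starting points replaces the weight by its total 1. The
    factor 3 so produced is the multiplicity in \<open>sum_A3\<close>.\<close>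
  have "(\<Sum>x\<in>A3_index I. (W x + W (r x) + W (r (r x))) * H x) = S + S + S"
    unfolding distrib_right sum.distrib S1 S2 by (simp only: S_def)
  then have "3 * S = (\<Sum>x\<in>A3_index I. (W x + W (r x) + W (r (r x))) * H x)"
    by simp
  also have "\<dots> = (\<Sum>x\<in>A3_index I. H x)"
    by (rule sum.cong[OF refl]) (simp add: W1)
  also have "\<dots> = 3 * (\<Sum>w\<in>A3_set I. h w)"
    using sum_A3[OF I, of h] by (simp add: H_def)
  finally have "S = (\<Sum>w\<in>A3_set I. h w)" by simp
  then show ?thesis by (simp add: S_def W_def H_def case_prod_beta)
qed

lemma long_long_sum:
  fixes h :: "((nat \<Rightarrow> real) \<Rightarrow> nat \<Rightarrow> real) \<Rightarrow> complex"
  assumes I: "finite I"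
  shows "(\<Sum>l\<in>I. \<Sum>j\<in>I - {l}. \<Sum>a\<in>{1, - 1}. root_coeff l j a *
      (\<Sum>k\<in>I - {l}. \<Sum>b\<in>{1, - 1}. root_coeff l k b * h (tt l j a \<circ> tt l k b)))
    = 2 * of_nat (card I) * (of_nat (card I) - 1) * h id + (\<Sum>w\<in>A3_set I. h w)"
proof -
  define G where "G l j a k b = root_coeff l j a * (root_coeff l k b * h (tt l j a \<circ> tt l k b))" for l j a k b
  have "(\<Sum>l\<in>I. \<Sum>j\<in>I - {l}. \<Sum>a\<in>{1, - 1}. root_coeff l j a *
      (\<Sum>k\<in>I - {l}. \<Sum>b\<in>{1, - 1}. root_coeff l k b * h (tt l j a \<circ> tt l k b)))
      = (\<Sum>l\<in>I. \<Sum>j\<in>I - {l}. (\<Sum>a\<in>{1, - 1}. \<Sum>b\<in>{1, - 1}. G l j a j b)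
        + (\<Sum>k\<in>I - {l} - {j}. \<Sum>a\<in>{1, - 1}. \<Sum>b\<in>{1, - 1}. G l j a k b))"
  proof (intro sum.cong[OF refl])
    fix l j assume "l \<in> I" and j: "j \<in> I - {l}"
    have "(\<Sum>a\<in>{1, - 1}. root_coeff l j a *
        (\<Sum>k\<in>I - {l}. \<Sum>b\<in>{1, - 1}. root_coeff l k b * h (tt l j a \<circ> tt l k b)))
        = (\<Sum>a\<in>{1, - 1}. \<Sum>k\<in>I - {l}. \<Sum>b\<in>{1, - 1}. G l j a k b)"
      by (simp only: G_def sum_distrib_left)
    also have "\<dots> = (\<Sum>k\<in>I - {l}. \<Sum>a\<in>{1, - 1}. \<Sum>b\<in>{1, - 1}. G l j a k b)"
      by (rule sum.swap)
    \<comment> \<open>The term k = j has both roots in one coordinate plane; the remaining ones give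
      rotations of type A2.\<close>
    also have "\<dots> = (\<Sum>a\<in>{1, - 1}. \<Sum>b\<in>{1, - 1}. G l j a j b)
        + (\<Sum>k\<in>I - {l} - {j}. \<Sum>a\<in>{1, - 1}. \<Sum>b\<in>{1, - 1}. G l j a k b)"
      using I j by (intro sum.remove) simp_all
    finally show "(\<Sum>a\<in>{1, - 1}. root_coeff l j a *
        (\<Sum>k\<in>I - {l}. \<Sum>b\<in>{1, - 1}. root_coeff l k b * h (tt l j a \<circ> tt l k b)))
        = (\<Sum>a\<in>{1, - 1}. \<Sum>b\<in>{1, - 1}. G l j a j b)
        + (\<Sum>k\<in>I - {l} - {j}. \<Sum>a\<in>{1, - 1}. \<Sum>b\<in>{1, - 1}. G l j a k b)" .
  qed
  also have "\<dots> = (\<Sum>l\<in>I. \<Sum>j\<in>I - {l}. \<Sum>a\<in>{1, - 1}. \<Sum>b\<in>{1, - 1}. G l j a j b)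
      + (\<Sum>l\<in>I. \<Sum>j\<in>I - {l}. \<Sum>k\<in>I - {l} - {j}. \<Sum>a\<in>{1, - 1}. \<Sum>b\<in>{1, - 1}. G l j a k b)"
    by (simp only: sum.distrib)
  also have "(\<Sum>l\<in>I. \<Sum>j\<in>I - {l}. \<Sum>a\<in>{1, - 1}. \<Sum>b\<in>{1, - 1}. G l j a j b)
      = 2 * of_nat (card I) * (of_nat (card I) - 1) * h id"
    unfolding G_def by (rule same_plane_sum[OF I])
  also have "(\<Sum>l\<in>I. \<Sum>j\<in>I - {l}. \<Sum>k\<in>I - {l} - {j}. \<Sum>a\<in>{1, - 1}. \<Sum>b\<in>{1, - 1}. G l j a k b)
      = (\<Sum>(j, l, k)\<in>distinct_triples I. \<Sum>a\<in>{1, - 1}. \<Sum>b\<in>{1, - 1}. G l j a k b)"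
    by (rule sum_distinct_triples[OF I])
  also have "\<dots> = (\<Sum>t\<in>distinct_triples I. \<Sum>x\<in>{1, - 1} \<times> {1, - 1}.
      (case (t, x) of ((j, l, k), a, b) \<Rightarrow> G l j a k b))"
  proof (rule sum.cong[OF refl])
    fix t :: "nat \<times> nat \<times> nat"
    obtain j l k where t: "t = (j, l, k)" by (metis prod.collapse)
    show "(case t of (j, l, k) \<Rightarrow> \<Sum>a\<in>{1, - 1}. \<Sum>b\<in>{1, - 1}. G l j a k b)
        = (\<Sum>x\<in>{1, - 1} \<times> {1, - 1}. case (t, x) of ((j, l, k), a, b) \<Rightarrow> G l j a k b)"
      unfolding t prod.case by (rule sum.cartesian_product)
  qed
  also have "\<dots> = (\<Sum>((j, l, k), a, b)\<in>A3_index I. G l j a k b)"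
    unfolding A3_index_def
    by (rule trans[OF sum.cartesian_product], rule sum.cong[OF refl]) (auto simp only: split_paired_all prod.case)
  also have "\<dots> = (\<Sum>((i, j, k), a, b)\<in>A3_index I. root_coeff j i a * root_coeff j k b * h (A3 i j k a b))"
    by (rule sum.cong[OF refl]) (auto simp: G_def A3_def tt_commute)
  also have "\<dots> = (\<Sum>w\<in>A3_set I. h w)"
    by (rule rotation_sum[OF I])
  finally show ?thesis .
qed

text \<open>The form splits as a sum over coordinates, which decouples the two roots. An arbitrary
  \<open>h\<close> stands for a linear functional on the group algebra; in \<open>Omega_eq\<close>
  it is the coefficient at \<open>w\<close>.\<close>

lemma pos_roots_double_sum:
  fixes h :: "((nat \<Rightarrow> real) \<Rightarrow> nat \<Rightarrow> real) \<Rightarrow> complex"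
  assumes I: "finite I"
  shows "(\<Sum>\<alpha>\<in>pos_roots I. \<Sum>\<beta>\<in>pos_roots I.
      root_param I kl ks \<alpha> * root_param I kl ks \<beta> * of_real (bform I \<alpha> \<beta>) * h (reflection I \<alpha> \<circ> reflection I \<beta>))
    = (2 * of_nat (card I) * (of_nat (card I) - 1) * kl\<^sup>2 + of_nat (card I) * ks\<^sup>2) * h id
      + kl\<^sup>2 * (\<Sum>w\<in>A3_set I. h w) + 2 * kl * ks * (\<Sum>w\<in>B2_set I. h w)"
proof -
  define P where "P l \<alpha> = root_param I kl ks \<alpha> * of_real (\<alpha> l)" for \<alpha> and l :: nat
  have "(\<Sum>\<alpha>\<in>pos_roots I. \<Sum>\<beta>\<in>pos_roots I.
      root_param I kl ks \<alpha> * root_param I kl ks \<beta> * of_real (bform I \<alpha> \<beta>) * h (reflection I \<alpha> \<circ> reflection I \<beta>))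
      = (\<Sum>\<alpha>\<in>pos_roots I. \<Sum>\<beta>\<in>pos_roots I. \<Sum>l\<in>I. P l \<alpha> * (P l \<beta> * h (reflection I \<alpha> \<circ> reflection I \<beta>)))"
    unfolding bform_def of_real_sum sum_distrib_left sum_distrib_right P_def
    by (intro sum.cong refl) (simp add: mult_ac)
  also have "\<dots> = (\<Sum>\<alpha>\<in>pos_roots I. \<Sum>l\<in>I. \<Sum>\<beta>\<in>pos_roots I. P l \<alpha> * (P l \<beta> * h (reflection I \<alpha> \<circ> reflection I \<beta>)))"
    by (intro sum.cong refl sum.swap)
  also have "\<dots> = (\<Sum>l\<in>I. \<Sum>\<alpha>\<in>pos_roots I. \<Sum>\<beta>\<in>pos_roots I. P l \<alpha> * (P l \<beta> * h (reflection I \<alpha> \<circ> reflection I \<beta>)))"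
    by (rule sum.swap)
  also have "\<dots> = (\<Sum>l\<in>I. ks\<^sup>2 * h id
      + kl * ks * (\<Sum>j\<in>I - {l}. \<Sum>a\<in>{1, - 1}. root_coeff l j a * h (ss l \<circ> tt l j a))
      + kl * ks * (\<Sum>j\<in>I - {l}. \<Sum>a\<in>{1, - 1}. root_coeff l j a * h (tt l j a \<circ> ss l))
      + kl\<^sup>2 * (\<Sum>j\<in>I - {l}. \<Sum>a\<in>{1, - 1}. root_coeff l j a *
        (\<Sum>k\<in>I - {l}. \<Sum>b\<in>{1, - 1}. root_coeff l k b * h (tt l j a \<circ> tt l k b))))"
  proof (rule sum.cong[OF refl])
    fix l assume l: "l \<in> I"
    define Q where "Q u = (\<Sum>j\<in>I - {l}. \<Sum>a\<in>{1, - 1}. root_coeff l j a * h (u \<circ> tt l j a))" for u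
    \<comment> \<open>The inner sum as a function of the first reflection, so that
      \<open>root_sum\<close> applies once more to the outer sum.\<close>
    define F where "F u = ks * h (u \<circ> ss l) + kl * Q u" for u
    have "(\<Sum>\<alpha>\<in>pos_roots I. \<Sum>\<beta>\<in>pos_roots I. P l \<alpha> * (P l \<beta> * h (reflection I \<alpha> \<circ> reflection I \<beta>)))
        = (\<Sum>\<alpha>\<in>pos_roots I. P l \<alpha> * F (reflection I \<alpha>))"
      unfolding sum_distrib_left[symmetric] P_def F_def Q_def
      using root_sum[OF I l, of kl ks "\<lambda>u. h (_ \<circ> u)"] by (intro sum.cong refl arg_cong2[where f = "(*)"]) simp
    also have "\<dots> = ks * F (ss l) + kl * (\<Sum>j\<in>I - {l}. \<Sum>a\<in>{1, - 1}. root_coeff l j a * F (tt l j a))"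
      unfolding P_def by (rule root_sum[OF I l])
    also have "(\<Sum>j\<in>I - {l}. \<Sum>a\<in>{1, - 1}. root_coeff l j a * F (tt l j a))
        = ks * (\<Sum>j\<in>I - {l}. \<Sum>a\<in>{1, - 1}. root_coeff l j a * h (tt l j a \<circ> ss l))
        + kl * (\<Sum>j\<in>I - {l}. \<Sum>a\<in>{1, - 1}. root_coeff l j a *
        (\<Sum>k\<in>I - {l}. \<Sum>b\<in>{1, - 1}. root_coeff l k b * h (tt l j a \<circ> tt l k b)))"
    proof -
      have "root_coeff l j a * F (tt l j a)
          = ks * (root_coeff l j a * h (tt l j a \<circ> ss l)) + kl * (root_coeff l j a * Q (tt l j a))" for j a
        by (simp add: F_def algebra_simps)
      then show ?thesis by (simp only: sum.distrib sum_distrib_left[symmetric] Q_def)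
    qed
    finally show "(\<Sum>\<alpha>\<in>pos_roots I. \<Sum>\<beta>\<in>pos_roots I. P l \<alpha> * (P l \<beta> * h (reflection I \<alpha> \<circ> reflection I \<beta>)))
      = ks\<^sup>2 * h id
      + kl * ks * (\<Sum>j\<in>I - {l}. \<Sum>a\<in>{1, - 1}. root_coeff l j a * h (ss l \<circ> tt l j a))
      + kl * ks * (\<Sum>j\<in>I - {l}. \<Sum>a\<in>{1, - 1}. root_coeff l j a * h (tt l j a \<circ> ss l))
      + kl\<^sup>2 * (\<Sum>j\<in>I - {l}. \<Sum>a\<in>{1, - 1}. root_coeff l j a *
        (\<Sum>k\<in>I - {l}. \<Sum>b\<in>{1, - 1}. root_coeff l k b * h (tt l j a \<circ> tt l k b)))"
      unfolding F_def ss_ss by (simp only: Q_def distrib_left power2_eq_square mult_ac add_ac)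
  qed
  also have "\<dots> = of_nat (card I) * (ks\<^sup>2 * h id)
      + kl * ks * ((\<Sum>l\<in>I. \<Sum>j\<in>I - {l}. \<Sum>a\<in>{1, - 1}. root_coeff l j a * h (ss l \<circ> tt l j a))
        + (\<Sum>l\<in>I. \<Sum>j\<in>I - {l}. \<Sum>a\<in>{1, - 1}. root_coeff l j a * h (tt l j a \<circ> ss l)))
      + kl\<^sup>2 * (\<Sum>l\<in>I. \<Sum>j\<in>I - {l}. \<Sum>a\<in>{1, - 1}. root_coeff l j a *
        (\<Sum>k\<in>I - {l}. \<Sum>b\<in>{1, - 1}. root_coeff l k b * h (tt l j a \<circ> tt l k b)))"
    unfolding sum.distrib sum_constant sum_distrib_left[symmetric] distrib_left by (simp only: add.assoc)
  also have "\<dots> = (2 * of_nat (card I) * (of_nat (card I) - 1) * kl\<^sup>2 + of_nat (card I) * ks\<^sup>2) * h id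
      + kl\<^sup>2 * (\<Sum>w\<in>A3_set I. h w) + 2 * kl * ks * (\<Sum>w\<in>B2_set I. h w)"
    unfolding short_long_sum[OF I] long_long_sum[OF I] by (simp add: algebra_simps)
  finally show ?thesis .
qed

lemma Omega_eq:
  "Omega n kl ks =
     (\<lambda>w. (1 / 4) * (2 * of_nat n * (of_nat n - 1) * kl\<^sup>2 + of_nat n * ks\<^sup>2) * indicator {id} w
          + (1 / 4) * kl\<^sup>2 * e_A2 n w + (1 / 2) * kl * ks * e_B2 n w)"
proof
  fix w
  have ind: "(\<Sum>v\<in>S. indicator {v} w) = (indicator S w :: complex)"
    if "S \<subseteq> sperms {1..n}" for S :: "((nat \<Rightarrow> real) \<Rightarrow> nat \<Rightarrow> real) set"
  proof -
    have "finite S" using that finite_sperms[of "{1..n}"] finite_subset by blast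
    moreover have "(\<Sum>v\<in>S. indicator {v} w) = (\<Sum>v\<in>S. if v = w then 1 else 0 :: complex)"
      by (rule sum.cong) (auto simp: indicator_def)
    ultimately show ?thesis by (simp add: indicator_def)
  qed
  show "Omega n kl ks w = (1 / 4) * (2 * of_nat n * (of_nat n - 1) * kl\<^sup>2 + of_nat n * ks\<^sup>2) * indicator {id} w
          + (1 / 4) * kl\<^sup>2 * e_A2 n w + (1 / 2) * kl * ks * e_B2 n w"
    unfolding Omega_def
      pos_roots_double_sum[of "{1..n}" kl ks "\<lambda>v. indicator {v} w", OF finite_atLeastAtMost]
      ind[OF A3_set_sperms] ind[OF B2_set_sperms] e_A2_eq e_B2_eq
    by (simp add: field_simps)
qed

section \<open>Characters of bipartitions\<close>

lemma sperms_Int_disjoint: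
  assumes "w \<in> sperms I" "w \<in> sperms J" "I \<inter> J = {}"
  shows "w = id"
proof -
  obtain p s where ps: "w = sperm p s" "p permutes I" "signs I s" using assms(1) by (rule sperms_cases)
  obtain q t where qt: "w = sperm q t" "q permutes J" "signs J t" using assms(2) by (rule sperms_cases)
  have *: "p = q" "s = t" using sperm_eq_iff[OF ps(2,3) qt(2,3)] ps(1) qt(1) by blast+
  have "p x = x" for x
    using permutes_not_in[OF ps(2), of x] permutes_not_in[OF qt(2), of x] * assms(3) by blast
  then have "p = id" by (simp add: fun_eq_iff)
  moreover have "s x = 1" for x
    using ps(3) qt(3) assms(3) unfolding *(2) signs_def by blast
  then have "s = (\<lambda>i. 1)" by (simp add: fun_eq_iff)
  ultimately show ?thesis using ps(1) sperm_id by simp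
qed

text \<open>From u v = u' v' follows u'^-1 u = v' v^-1, which belongs to both blocks and is
  therefore the identity.\<close>

lemma sperms_product_unique:
  assumes "u \<in> sperms I" "u' \<in> sperms I" "v \<in> sperms J" "v' \<in> sperms J" "I \<inter> J = {}" "u \<circ> v = u' \<circ> v'"
  shows "u = u'" "v = v'"
proof -
  obtain p s where ps: "u' = sperm p s" "p permutes I" "signs I s" using assms(2) by (rule sperms_cases)
  obtain q t where qt: "v = sperm q t" "q permutes J" "signs J t" using assms(3) by (rule sperms_cases)
  note ui = sperm_inv[OF ps(2,3), folded ps(1)] and vi = sperm_inv[OF qt(2,3), folded qt(1)]
  have "sperm_inv p s \<circ> u = sperm_inv p s \<circ> (u \<circ> v) \<circ> sperm_inv q t"
    using vi(1) by (simp add: comp_assoc)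
  also have "\<dots> = (sperm_inv p s \<circ> u') \<circ> (v' \<circ> sperm_inv q t)" unfolding assms(6) by (simp only: comp_assoc)
  also have "\<dots> = v' \<circ> sperm_inv q t" by (simp add: ui(2))
  finally have eq: "sperm_inv p s \<circ> u = v' \<circ> sperm_inv q t" .
  have id: "sperm_inv p s \<circ> u = id"
    by (rule sperms_Int_disjoint[OF _ _ assms(5)])
      (rule sperms_comp[OF ui(3) assms(1)], unfold eq, rule sperms_comp[OF assms(4) vi(3)])
  have "u = (u' \<circ> sperm_inv p s) \<circ> u" by (simp add: ui(1))
  also have "\<dots> = u' \<circ> (sperm_inv p s \<circ> u)" by (simp only: comp_assoc)
  finally show "u = u'" by (simp add: id)
  have "v' = v' \<circ> (sperm_inv q t \<circ> v)" by (simp add: vi(2))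
  also have "\<dots> = (v' \<circ> sperm_inv q t) \<circ> v" by (simp only: comp_assoc)
  finally show "v = v'" unfolding eq[symmetric] id by simp
qed

lemma comp_disjoint_permutes:
  assumes "p permutes I" "q permutes J" "I \<inter> J = {}"
  shows "x \<in> I \<Longrightarrow> (p \<circ> q) x \<in> I" "x \<in> J \<Longrightarrow> (p \<circ> q) x \<in> J"
proof -
  show "(p \<circ> q) x \<in> I" if "x \<in> I"
  proof -
    have "x \<notin> J" using that assms(3) by blast
    then have "q x = x" by (rule permutes_not_in[OF assms(2)])
    then show ?thesis using permutes_in_image[OF assms(1), of x] that by simp
  qed
  show "(p \<circ> q) x \<in> J" if x: "x \<in> J"
  proof -
    have "q x \<in> J" using permutes_in_image[OF assms(2)] x by simp
    moreover from this have "p (q x) = q x" using permutes_not_in[OF assms(1)] assms(3) by blast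
    ultimately show ?thesis by simp
  qed
qed

text \<open>The product preserves each block, so the cycle through \<open>i\<close>,
  \<open>j\<close>, \<open>k\<close> stays in the block of \<open>i\<close>. Uniqueness of the
  factors then makes the other one trivial.\<close>

lemma A3_set_split:
  assumes "u \<in> sperms I" "v \<in> sperms J" "I \<inter> J = {}" "u \<circ> v \<in> A3_set (I \<union> J)"
  shows "u \<in> A3_set I \<and> v = id \<or> u = id \<and> v \<in> A3_set J"
proof -
  obtain i j k a b where w: "u \<circ> v = A3 i j k a b" "(i, j, k) \<in> distinct_triples (I \<union> J)" "a \<in> {1, - 1}" "b \<in> {1, - 1}"
    using assms(4) by (rule A3_setE)
  obtain p s where ps: "u = sperm p s" "p permutes I" "signs I s" using assms(1) by (rule sperms_cases)
  obtain q t where qt: "v = sperm q t" "q permutes J" "signs J t" using assms(2) by (rule sperms_cases)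
  note d = distinct_triplesD[OF w(2)]
  have pJ: "p permutes (I \<union> J)" and qJ: "q permutes (I \<union> J)"
    using permutes_subset[OF ps(2)] permutes_subset[OF qt(2)] by auto
  have ss: "signs (I \<union> J) s" "signs (I \<union> J) t" using ps(3) qt(3) by (auto simp: signs_def)
  have "sperm (p \<circ> q) (\<lambda>i. s (q i) * t i) = sperm (cycle3 i j k) (A3_sign i j k a b)"
    using w(1) sperm_comp[OF pJ qJ] unfolding ps(1) qt(1) A3_sperm[OF d(4-6)] by simp
  then have pq: "p \<circ> q = cycle3 i j k"
    using sperm_eq_iff[OF permutes_compose[OF qJ pJ] signs_comp[OF ss qJ] cycle3_permutes[OF d(1-3)]
        signs_A3_sign[OF d(1-3) w(3,4)]] by blast
  have c: "(p \<circ> q) i = j" "(p \<circ> q) j = k" using d unfolding pq by simp_all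
  show ?thesis
  proof (cases "i \<in> I")
    case True
    then have "j \<in> I" "k \<in> I" using comp_disjoint_permutes(1)[OF ps(2) qt(2) assms(3)] c by metis+
    then have "A3 i j k a b \<in> A3_set I" using True d w by (intro A3_setI) (auto simp: distinct_triples_def)
    moreover have "u = A3 i j k a b" "v = id"
      using sperms_product_unique[OF assms(1) subsetD[OF A3_set_sperms calculation] assms(2) id_sperms assms(3)] w(1)
      by simp_all
    ultimately show ?thesis by simp
  next
    case False
    then have i: "i \<in> J" using d(1) by blast
    then have "j \<in> J" "k \<in> J" using comp_disjoint_permutes(2)[OF ps(2) qt(2) assms(3)] c by metis+
    then have "A3 i j k a b \<in> A3_set J" using i d w by (intro A3_setI) (auto simp: distinct_triples_def)
    moreover have "u = id" "v = A3 i j k a b"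
      using sperms_product_unique[OF assms(1) id_sperms assms(2) subsetD[OF A3_set_sperms calculation] assms(3)] w(1)
      by simp_all
    ultimately show ?thesis by simp
  qed
qed

lemma B2_set_split:
  assumes "u \<in> sperms I" "v \<in> sperms J" "I \<inter> J = {}" "u \<circ> v \<in> B2_set (I \<union> J)"
  shows "u \<in> B2_set I \<and> v = id \<or> u = id \<and> v \<in> B2_set J"
proof -
  obtain i j where w: "u \<circ> v = B2 i j" "(i, j) \<in> distinct_pairs (I \<union> J)" using assms(4) by (rule B2_setE)
  obtain p s where ps: "u = sperm p s" "p permutes I" "signs I s" using assms(1) by (rule sperms_cases)
  obtain q t where qt: "v = sperm q t" "q permutes J" "signs J t" using assms(2) by (rule sperms_cases)
  note d = distinct_pairsD[OF w(2)]
  have pJ: "p permutes (I \<union> J)" and qJ: "q permutes (I \<union> J)"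
    using permutes_subset[OF ps(2)] permutes_subset[OF qt(2)] by auto
  have ss: "signs (I \<union> J) s" "signs (I \<union> J) t" using ps(3) qt(3) by (auto simp: signs_def)
  have "sperm (p \<circ> q) (\<lambda>i. s (q i) * t i) = sperm (transpose i j) (\<lambda>l. if l = i then - 1 else 1)"
    using w(1) sperm_comp[OF pJ qJ] unfolding ps(1) qt(1) B2_sperm[OF d(3)] by simp
  then have pq: "p \<circ> q = transpose i j"
    using sperm_eq_iff[OF permutes_compose[OF qJ pJ] signs_comp[OF ss qJ] permutes_swap_id[OF d(1,2)]
        signs_B2[OF d(1)]] by blast
  have c: "(p \<circ> q) i = j" unfolding pq by simp
  show ?thesis
  proof (cases "i \<in> I")
    case True
    then have "j \<in> I" using comp_disjoint_permutes(1)[OF ps(2) qt(2) assms(3)] c by metis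
    then have "B2 i j \<in> B2_set I" using True d by (intro B2_setI) (auto simp: distinct_pairs_def)
    moreover have "u = B2 i j" "v = id"
      using sperms_product_unique[OF assms(1) subsetD[OF B2_set_sperms calculation] assms(2) id_sperms assms(3)] w(1)
      by simp_all
    ultimately show ?thesis by simp
  next
    case False
    then have i: "i \<in> J" using d(1) by blast
    then have "j \<in> J" using comp_disjoint_permutes(2)[OF ps(2) qt(2) assms(3)] c by metis
    then have "B2 i j \<in> B2_set J" using i d by (intro B2_setI) (auto simp: distinct_pairs_def)
    moreover have "u = id" "v = B2 i j"
      using sperms_product_unique[OF assms(1) id_sperms assms(2) subsetD[OF B2_set_sperms calculation] assms(3)] w(1)
      by simp_all
    ultimately show ?thesis by simp
  qed
qed

lemma id_notin_A3_set: "id \<notin> A3_set I"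
proof
  assume "id \<in> A3_set I"
  then obtain i j k a b where w: "id = A3 i j k a b" "(i, j, k) \<in> distinct_triples I" by (rule A3_setE)
  note d = distinct_triplesD[OF w(2)]
  have "eps k = A3 i j k a b (eps k)" by (simp flip: w(1))
  also have "\<dots> = (\<lambda>l. if l = i then a * b else 0)"
    using d by (auto simp: A3_def tt_apply eps_def fun_eq_iff)
  finally have "eps k k = (if k = i then a * b else 0)" by (rule fun_cong)
  then show False using d by (simp add: eps_def)
qed

lemma id_notin_B2_set: "id \<notin> B2_set I"
proof
  assume "id \<in> B2_set I"
  then obtain i j where w: "id = B2 i j" "(i, j) \<in> distinct_pairs I" by (rule B2_setE)
  note d = distinct_pairsD[OF w(2)]
  have "eps i i = B2 i j (eps i) i" by (simp flip: w(1))
  then show False using d by (simp add: B2_def ss_apply tt_apply eps_def)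
qed

text \<open>The summation range is SI x {id} together with {id} x SJ, disjoint because neither set
  contains the identity. The form is abstract enough to serve both classes.\<close>

lemma sum_product_class:
  fixes f g :: "((nat \<Rightarrow> real) \<Rightarrow> nat \<Rightarrow> real) \<Rightarrow> complex"
  assumes fin: "finite I" "finite J"
    and S: "SI \<subseteq> sperms I" "SJ \<subseteq> sperms J" "SI \<subseteq> SK" "SJ \<subseteq> SK" "id \<notin> SI" "id \<notin> SJ"
    and split: "\<And>u v. u \<in> sperms I \<Longrightarrow> v \<in> sperms J \<Longrightarrow> u \<circ> v \<in> SK \<Longrightarrow> u \<in> SI \<and> v = id \<or> u = id \<and> v \<in> SJ"
  shows "(\<Sum>h | h \<in> sperms I \<times> sperms J \<and> (\<lambda>(u, v). u \<circ> v) h \<in> SK. (\<lambda>(u, v). f u * g v) h)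
    = (\<Sum>u\<in>SI. f u) * g id + f id * (\<Sum>v\<in>SJ. g v)"
proof -
  have finS: "finite SI" "finite SJ"
    using finite_subset[OF S(1) finite_sperms[OF fin(1)]] finite_subset[OF S(2) finite_sperms[OF fin(2)]] by auto
  have "{h. h \<in> sperms I \<times> sperms J \<and> (\<lambda>(u, v). u \<circ> v) h \<in> SK} = SI \<times> {id} \<union> {id} \<times> SJ"
  proof (intro equalityI subsetI)
    fix h assume "h \<in> {h. h \<in> sperms I \<times> sperms J \<and> (\<lambda>(u, v). u \<circ> v) h \<in> SK}"
    then show "h \<in> SI \<times> {id} \<union> {id} \<times> SJ" using split by auto
  next
    fix h assume "h \<in> SI \<times> {id} \<union> {id} \<times> SJ"
    then show "h \<in> {h. h \<in> sperms I \<times> sperms J \<and> (\<lambda>(u, v). u \<circ> v) h \<in> SK}"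
      using S id_sperms by auto
  qed
  then have "(\<Sum>h | h \<in> sperms I \<times> sperms J \<and> (\<lambda>(u, v). u \<circ> v) h \<in> SK. (\<lambda>(u, v). f u * g v) h)
      = (\<Sum>h\<in>SI \<times> {id}. (\<lambda>(u, v). f u * g v) h) + (\<Sum>h\<in>{id} \<times> SJ. (\<lambda>(u, v). f u * g v) h)"
    using finS S(5,6) by (simp only:) (rule sum.union_disjoint, auto)
  also have "(\<Sum>h\<in>SI \<times> {id}. (\<lambda>(u, v). f u * g v) h) = (\<Sum>u\<in>SI. f u) * g id"
    by (simp flip: sum.cartesian_product add: sum_distrib_right)
  also have "(\<Sum>h\<in>{id} \<times> SJ. (\<lambda>(u, v). f u * g v) h) = f id * (\<Sum>v\<in>SJ. g v)"
    by (simp flip: sum.cartesian_product add: sum_distrib_left)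
  finally show ?thesis .
qed

subsection \<open>Traces of inflated representations\<close>

lemma mat_trace_smult: "mat_trace (c \<cdot>\<^sub>m A) = c * mat_trace A" if "A \<in> carrier_mat d d"
  using that by (simp add: mat_trace_def sum_distrib_left)

lemma mat_trace_inflate:
  assumes \<sigma>: "matrix_rep (perm_group_on I) d \<sigma>" and "p permutes I" "signs I s"
  shows "mat_trace (inflate \<eta> \<sigma> (sperm p s)) = \<eta> ^ card {i. s i = - 1} * mat_trace (\<sigma> p)"
  unfolding inflate_def unsigned_perm_sperm[OF assms(2,3)] sign_changes_sperm[OF assms(2,3)]
  by (rule mat_trace_smult) (rule matrix_rep_carrier[OF \<sigma>], simp add: assms(2))

lemma mat_trace_inflate_id:
  assumes \<sigma>: "matrix_rep (perm_group_on I) d \<sigma>"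
  shows "mat_trace (inflate \<eta> \<sigma> id) = of_nat d"
proof -
  have "mat_trace (inflate \<eta> \<sigma> (sperm id (\<lambda>i. 1))) = mat_trace (\<sigma> id)"
    using mat_trace_inflate[OF \<sigma> permutes_id, of "\<lambda>i. 1"] by (simp add: signs_def)
  moreover have "\<sigma> id = 1\<^sub>m d" using \<sigma> by (simp add: matrix_rep_def)
  ultimately show ?thesis by (simp only: sperm_id mat_trace_one)
qed

text \<open>The number of negative signs is 0 or 2, so both characters of the short reflections are
  invisible here.\<close>

lemma mat_trace_inflate_A3:
  assumes \<sigma>: "matrix_rep (perm_group_on I) d \<sigma>" and \<eta>: "\<eta>\<^sup>2 = 1"
    and t: "(i, j, k) \<in> distinct_triples I" "a \<in> {1, - 1}" "b \<in> {1, - 1}"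
  shows "mat_trace (inflate \<eta> \<sigma> (A3 i j k a b)) = mat_trace (\<sigma> (cycle3 i j k))"
proof -
  note d = distinct_triplesD[OF t(1)]
  consider "a = 1" "b = 1" | "a = 1" "b = - 1" | "a = - 1" "b = 1" | "a = - 1" "b = - 1"
    using t by blast
  then have "\<eta> ^ card {l. A3_sign i j k a b l = - 1} = 1"
  proof cases
    case 1
    then have "{l. A3_sign i j k a b l = - 1} = {}" by (simp add: A3_sign_def)
    then show ?thesis by simp
  next
    case 2
    then have "{l. A3_sign i j k a b l = - 1} = {j, k}" using d by (auto simp: A3_sign_def)
    then show ?thesis using \<eta> d by (simp add: power2_eq_square)
  next
    case 3
    then have "{l. A3_sign i j k a b l = - 1} = {i, k}" using d by (auto simp: A3_sign_def)
    then show ?thesis using \<eta> d by (simp add: power2_eq_square)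
  next
    case 4
    then have "{l. A3_sign i j k a b l = - 1} = {i, j}" using d by (auto simp: A3_sign_def)
    then show ?thesis using \<eta> d by (simp add: power2_eq_square)
  qed
  then show ?thesis
    unfolding A3_sperm[OF d(4-6)]
      mat_trace_inflate[OF \<sigma> cycle3_permutes[OF d(1-3)] signs_A3_sign[OF d(1-3) t(2,3)]]
    by simp
qed

text \<open>Exactly one basis vector changes sign, so \<eta> survives; this is the source of the
  opposite signs of the two transposition terms.\<close>

lemma mat_trace_inflate_B2:
  assumes \<sigma>: "matrix_rep (perm_group_on I) d \<sigma>" and t: "(i, j) \<in> distinct_pairs I"
  shows "mat_trace (inflate \<eta> \<sigma> (B2 i j)) = \<eta> * mat_trace (\<sigma> (transpose i j))"
proof -
  note d = distinct_pairsD[OF t]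
  have "{l. (if l = i then - 1 else 1 :: real) = - 1} = {i}" by auto
  then show ?thesis
    unfolding B2_sperm[OF d(3)] mat_trace_inflate[OF \<sigma> permutes_swap_id[OF d(1,2)] signs_B2[OF d(1)]]
    by simp
qed

lemma sum_k_cycles_trace:
  assumes I: "finite I" and \<sigma>: "matrix_rep (perm_group_on I) d \<sigma>"
    and K: "\<And>g. g \<in> K \<Longrightarrow> g permutes I"
    and c: "acts_by_scalar (perm_group_on I) d \<sigma> (indicator K) c"
  shows "(\<Sum>g\<in>K. mat_trace (\<sigma> g)) = c * of_nat d"
proof -
  have "(\<Sum>g\<in>carrier (perm_group_on I). indicator K g * mat_trace (\<sigma> g)) = (\<Sum>g\<in>K. mat_trace (\<sigma> g))"
    by (rule sum.mono_neutral_cong_right) (auto simp: K finite_permutations[OF I])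
  then show ?thesis using trace_algebra_action[OF \<sigma> c] by simp
qed

lemma sum_A3_trace:
  assumes I: "finite I" and \<sigma>: "matrix_rep (perm_group_on I) d \<sigma>" and \<eta>: "\<eta>\<^sup>2 = 1"
    and c: "acts_by_scalar (perm_group_on I) d \<sigma> (indicator (k_cycles I 3)) c"
  shows "(\<Sum>w\<in>A3_set I. mat_trace (inflate \<eta> \<sigma> w)) = 4 * (c * of_nat d)"
proof -
  define g where "g = (\<lambda>(i, j, k). mat_trace (\<sigma> (cycle3 i j k)))"
  have "3 * (\<Sum>w\<in>A3_set I. mat_trace (inflate \<eta> \<sigma> w))
      = (\<Sum>((i, j, k), a, b)\<in>A3_index I. mat_trace (inflate \<eta> \<sigma> (A3 i j k a b)))"
    by (rule sum_A3[OF I, symmetric])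
  also have "\<dots> = (\<Sum>(t, x)\<in>A3_index I. g t)"
  proof (rule sum.cong[OF refl])
    fix y assume y: "y \<in> A3_index I"
    obtain i j k a b where ye: "y = ((i, j, k), a, b)" by (metis prod.collapse)
    have t: "(i, j, k) \<in> distinct_triples I" "a \<in> {1, - 1}" "b \<in> {1, - 1}"
      using y unfolding ye A3_index_def by blast+
    show "(\<lambda>((i, j, k), a, b). mat_trace (inflate \<eta> \<sigma> (A3 i j k a b))) y = (\<lambda>(t, x). g t) y"
      unfolding ye prod.case g_def by (rule mat_trace_inflate_A3[OF \<sigma> \<eta> t])
  qed
  also have "\<dots> = (\<Sum>t\<in>distinct_triples I. \<Sum>x\<in>{1, - 1 :: real} \<times> {1, - 1 :: real}. g t)"
    unfolding A3_index_def by (rule sum.cartesian_product[symmetric])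
  \<comment> \<open>Four is the number of sign pairs (a, b), that is, of lifts of each 3-cycle. The
    3 for rotations occurs on both sides and cancels.\<close>
  also have "\<dots> = 4 * (\<Sum>t\<in>distinct_triples I. g t)"
    by (simp only: sum_constant sum_distrib_left card_cartesian_product) simp
  also have "(\<Sum>t\<in>distinct_triples I. g t) = 3 * (\<Sum>p\<in>k_cycles I 3. mat_trace (\<sigma> p))"
    unfolding g_def by (rule sum_k_cycles_3[OF I])
  also have "(\<Sum>p\<in>k_cycles I 3. mat_trace (\<sigma> p)) = c * of_nat d"
    by (rule sum_k_cycles_trace[OF I \<sigma> k_cycles_permutes(2) c])
  finally show ?thesis by simp
qed

text \<open>The factor 2 counts the ordered pairs (i, j) and (j, i), the two lifts of one
  transposition.\<close>

lemma sum_B2_trace: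
  assumes I: "finite I" and \<sigma>: "matrix_rep (perm_group_on I) d \<sigma>"
    and c: "acts_by_scalar (perm_group_on I) d \<sigma> (indicator (k_cycles I 2)) c"
  shows "(\<Sum>w\<in>B2_set I. mat_trace (inflate \<eta> \<sigma> w)) = 2 * \<eta> * (c * of_nat d)"
proof -
  have "(\<Sum>w\<in>B2_set I. mat_trace (inflate \<eta> \<sigma> w))
      = (\<Sum>(i, j)\<in>distinct_pairs I. mat_trace (inflate \<eta> \<sigma> (B2 i j)))"
    by (rule sum_B2[symmetric])
  also have "\<dots> = (\<Sum>(i, j)\<in>distinct_pairs I. \<eta> * mat_trace (\<sigma> (transpose i j)))"
  proof (rule sum.cong[OF refl])
    fix x assume x: "x \<in> distinct_pairs I"
    obtain i j where e: "x = (i, j)" by (metis prod.collapse)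
    show "(case x of (i, j) \<Rightarrow> mat_trace (inflate \<eta> \<sigma> (B2 i j)))
        = (case x of (i, j) \<Rightarrow> \<eta> * mat_trace (\<sigma> (transpose i j)))"
      unfolding e prod.case by (rule mat_trace_inflate_B2[OF \<sigma> x[unfolded e]])
  qed
  also have "\<dots> = \<eta> * (\<Sum>(i, j)\<in>distinct_pairs I. mat_trace (\<sigma> (transpose i j)))"
    by (simp add: sum_distrib_left case_prod_beta)
  also have "(\<Sum>(i, j)\<in>distinct_pairs I. mat_trace (\<sigma> (transpose i j))) = 2 * (\<Sum>p\<in>k_cycles I 2. mat_trace (\<sigma> p))"
    by (rule sum_k_cycles_2[OF I])
  also have "(\<Sum>p\<in>k_cycles I 2. mat_trace (\<sigma> p)) = c * of_nat d"
    by (rule sum_k_cycles_trace[OF I \<sigma> k_cycles_permutes(1) c])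
  finally show ?thesis by simp
qed

subsection \<open>The scalar of the Casimir element\<close>

lemma indicator_conj:
  fixes G (structure)
  assumes G: "group G" and C: "\<And>g x. g \<in> carrier G \<Longrightarrow> x \<in> C \<Longrightarrow> g \<otimes> x \<otimes> inv g \<in> C"
    and g: "g \<in> carrier G" and x: "x \<in> carrier G"
  shows "indicator C (g \<otimes> x \<otimes> inv g) = (indicator C x :: complex)"
proof -
  interpret group G by (rule G)
  have "x \<in> C" if "g \<otimes> x \<otimes> inv g \<in> C"
  proof -
    have "inv g \<otimes> (g \<otimes> x \<otimes> inv g) \<otimes> inv (inv g) \<in> C"
      using g by (intro C that) simp
    moreover have "inv g \<otimes> (g \<otimes> x \<otimes> inv g) \<otimes> inv (inv g) = x"
      using g x by (simp add: m_assoc inv_cancel_left)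
    ultimately show ?thesis by simp
  qed
  then show ?thesis using C[OF g, of x] by (auto simp: indicator_def)
qed

text \<open>Centrality comes from the three classes in \<open>Omega_eq\<close>, and
  \<open>central_acts_by_scalar\<close> leaves a trace identity. Each of its three sums is evaluated
  by the same reduction \<open>class_sum\<close> to the product subgroup.\<close>

lemma Omega_acts_by_scalar:
  assumes \<sigma>: "matrix_rep (perm_group_on {1..a}) dl \<sigma>" and \<tau>: "matrix_rep (perm_group_on {a + 1..a + b}) dm \<tau>"
    and l3: "acts_by_scalar (perm_group_on {1..a}) dl \<sigma> (indicator (k_cycles {1..a} 3)) l3"
    and l2: "acts_by_scalar (perm_group_on {1..a}) dl \<sigma> (indicator (k_cycles {1..a} 2)) l2"
    and m3: "acts_by_scalar (perm_group_on {a + 1..a + b}) dm \<tau> (indicator (k_cycles {a + 1..a + b} 3)) m3"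
    and m2: "acts_by_scalar (perm_group_on {a + 1..a + b}) dm \<tau> (indicator (k_cycles {a + 1..a + b} 2)) m2"
    and \<rho>: "irreducible_rep (weyl_B {1..a + b}) d \<rho>"
    and \<chi>: "\<And>w. w \<in> carrier (weyl_B {1..a + b}) \<Longrightarrow> mat_trace (\<rho> w) = bipartition_char a b \<sigma> \<tau> w"
  shows "acts_by_scalar (weyl_B {1..a + b}) d \<rho> (Omega (a + b) kl ks)
    ((1 / 4) * (2 * of_nat (a + b) * (of_nat (a + b) - 1) * kl\<^sup>2 + of_nat (a + b) * ks\<^sup>2)
      + kl\<^sup>2 * (l3 + m3) + kl * ks * (l2 - m2))"
proof -
  define I where "I = {1..a}"
  define J where "J = {a + 1..a + b}"
  define K where "K = {1..a + b}"
  have K: "K = I \<union> J" and IJ: "I \<inter> J = {}" and fin: "finite I" "finite J" "finite K"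
    by (auto simp: I_def J_def K_def)
  define G where "G = weyl_B K"
  define H where "H = weyl_B I \<times>\<times> weyl_B J"
  define f where "f u = mat_trace (inflate 1 \<sigma> u)" for u
  define g where "g v = mat_trace (inflate (- 1) \<tau> v)" for v
  define N :: complex where "N = of_nat (order G) / of_nat (order H)"
  define c0 where "c0 = (1 / 4) * (2 * of_nat (a + b) * (of_nat (a + b) - 1) * kl\<^sup>2 + of_nat (a + b) * ks\<^sup>2)"
  have G: "group G" "finite (carrier G)" and cG: "carrier G = sperms K"
    using group_weyl_B carrier_weyl_B[OF fin(3)] finite_sperms[OF fin(3)] by (simp_all add: G_def)
  have cH: "carrier H = sperms I \<times> sperms J"
    by (simp add: H_def DirProd_def carrier_weyl_B fin)
  have finH: "finite (carrier H)" unfolding cH using fin finite_sperms by blast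
  have \<iota>: "(\<lambda>(u, v). u \<circ> v) h \<in> carrier G" if "h \<in> carrier H" for h
    using that sperms_mono[of I K] sperms_mono[of J K] K sperms_comp[of _ K] unfolding cH cG by fastforce
  have inv_C: "x \<otimes>\<^bsub>G\<^esub> w \<otimes>\<^bsub>G\<^esub> inv\<^bsub>G\<^esub> x \<in> C"
    if x: "x \<in> carrier G" and C: "\<And>p s. p permutes K \<Longrightarrow> signs K s \<Longrightarrow> sperm p s \<circ> w \<circ> sperm_inv p s \<in> C" for x w C
  proof -
    obtain p s where ps: "x = sperm p s" "p permutes K" "signs K s"
      using x unfolding cG by (rule sperms_cases)
    show ?thesis
      using C[OF ps(2,3)] inv_weyl_B[OF fin(3) ps(2,3)] by (simp add: ps(1) G_def)
  qed
  have inv_id: "x \<otimes>\<^bsub>G\<^esub> w \<otimes>\<^bsub>G\<^esub> inv\<^bsub>G\<^esub> x \<in> {id}" if "x \<in> carrier G" "w \<in> {id}" for x w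
    using inv_C[OF that(1), of w "{id}"] sperm_inv(1) that(2) by auto
  have inv_A3: "x \<otimes>\<^bsub>G\<^esub> w \<otimes>\<^bsub>G\<^esub> inv\<^bsub>G\<^esub> x \<in> A3_set K" if "x \<in> carrier G" "w \<in> A3_set K" for x w
    using inv_C[OF that(1)] A3_set_conj[OF _ _ that(2)] by blast
  have inv_B2: "x \<otimes>\<^bsub>G\<^esub> w \<otimes>\<^bsub>G\<^esub> inv\<^bsub>G\<^esub> x \<in> B2_set K" if "x \<in> carrier G" "w \<in> B2_set K" for x w
    using inv_C[OF that(1)] B2_set_conj[OF _ _ that(2)] by blast
  have Omega: "Omega (a + b) kl ks w = c0 * indicator {id} w + (1 / 4) * kl\<^sup>2 * indicator (A3_set K) w
      + (1 / 2) * kl * ks * indicator (B2_set K) w" for w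
    unfolding Omega_eq e_A2_eq e_B2_eq c0_def K_def ..
  have class_sum: "(\<Sum>w\<in>carrier G. indicator C w * mat_trace (\<rho> w))
      = N * (\<Sum>h | h \<in> sperms I \<times> sperms J \<and> (\<lambda>(u, v). u \<circ> v) h \<in> C. (\<lambda>(u, v). f u * g v) h)"
    if C: "C \<subseteq> carrier G" "\<And>x w. x \<in> carrier G \<Longrightarrow> w \<in> C \<Longrightarrow> x \<otimes>\<^bsub>G\<^esub> w \<otimes>\<^bsub>G\<^esub> inv\<^bsub>G\<^esub> x \<in> C" for C
  proof -
    have "(\<Sum>w\<in>carrier G. indicator C w * mat_trace (\<rho> w)) = (\<Sum>w\<in>C. mat_trace (\<rho> w))"
      by (rule sum.mono_neutral_cong_right[OF G(2) C(1)]) auto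
    also have "\<dots> = (\<Sum>w\<in>C. induced_char G H (\<lambda>(u, v). u \<circ> v) (\<lambda>(u, v). f u * g v) w)"
    proof (rule sum.cong[OF refl])
      fix w assume "w \<in> C"
      then have "w \<in> carrier (weyl_B {1..a + b})" using C(1) by (auto simp: G_def K_def)
      then show "mat_trace (\<rho> w) = induced_char G H (\<lambda>(u, v). u \<circ> v) (\<lambda>(u, v). f u * g v) w"
        unfolding f_def g_def G_def H_def I_def J_def K_def using \<chi>[of w] by (simp only: bipartition_char_def)
    qed
    also have "\<dots> = N * (\<Sum>h | h \<in> carrier H \<and> (\<lambda>(u, v). u \<circ> v) h \<in> C. (\<lambda>(u, v). f u * g v) h)"
      unfolding N_def by (rule sum_induced_char[OF G finH \<iota> C])
    finally show ?thesis unfolding cH .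
  qed
  note \<sigma>I = \<sigma>[folded I_def] and \<tau>J = \<tau>[folded J_def]
  have f_id: "f id = of_nat dl" and g_id: "g id = of_nat dm"
    unfolding f_def g_def using mat_trace_inflate_id[OF \<sigma>I] mat_trace_inflate_id[OF \<tau>J] by auto
  have rep: "matrix_rep G d \<rho>" using \<rho> by (simp add: irreducible_rep_def G_def K_def)
  have sum_id: "(\<Sum>w\<in>carrier G. indicator {id} w * mat_trace (\<rho> w)) = N * (of_nat dl * of_nat dm)"
  proof -
    have "{h. h \<in> sperms I \<times> sperms J \<and> (\<lambda>(u, v). u \<circ> v) h \<in> {id}} = {(id, id)}"
      using sperms_product_unique[OF _ id_sperms _ id_sperms IJ] id_sperms by auto
    moreover have "{id} \<subseteq> carrier G" using id_sperms by (simp add: cG)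
    ultimately show ?thesis using class_sum[OF _ inv_id] by (simp add: f_id g_id)
  qed
  \<comment> \<open>The class of the identity yields the degree; it contains the factors
    \<open>N\<close>, \<open>dl\<close> and \<open>dm\<close> of the other two sums.\<close>
  have d: "of_nat d = N * (of_nat dl * of_nat dm)"
  proof -
    have "(\<Sum>w\<in>carrier G. indicator {id} w * mat_trace (\<rho> w)) = (\<Sum>w\<in>{id}. mat_trace (\<rho> w))"
      by (rule sum.mono_neutral_cong_right[OF G(2)]) (auto simp: cG id_sperms)
    moreover have "\<rho> id = 1\<^sub>m d" using rep by (simp add: matrix_rep_def G_def)
    ultimately show ?thesis using sum_id by (simp add: mat_trace_one)
  qed
  have sum_A3: "(\<Sum>w\<in>carrier G. indicator (A3_set K) w * mat_trace (\<rho> w))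
      = N * (4 * (l3 * of_nat dl) * of_nat dm + of_nat dl * (4 * (m3 * of_nat dm)))"
  proof -
    have "(\<Sum>h | h \<in> sperms I \<times> sperms J \<and> (\<lambda>(u, v). u \<circ> v) h \<in> A3_set K. (\<lambda>(u, v). f u * g v) h)
        = (\<Sum>u\<in>A3_set I. f u) * g id + f id * (\<Sum>v\<in>A3_set J. g v)"
      by (rule sum_product_class[OF fin(1,2) A3_set_sperms A3_set_sperms A3_set_mono A3_set_mono
            id_notin_A3_set id_notin_A3_set]) (use A3_set_split[OF _ _ IJ] in \<open>auto simp: K\<close>)
    moreover have "(\<Sum>u\<in>A3_set I. f u) = 4 * (l3 * of_nat dl)"
      unfolding f_def by (rule sum_A3_trace[OF fin(1) \<sigma>I _ l3[folded I_def]]) simp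
    moreover have "(\<Sum>v\<in>A3_set J. g v) = 4 * (m3 * of_nat dm)"
      unfolding g_def by (rule sum_A3_trace[OF fin(2) \<tau>J _ m3[folded J_def]]) simp
    moreover have "(\<Sum>w\<in>carrier G. indicator (A3_set K) w * mat_trace (\<rho> w))
        = N * (\<Sum>h | h \<in> sperms I \<times> sperms J \<and> (\<lambda>(u, v). u \<circ> v) h \<in> A3_set K. (\<lambda>(u, v). f u * g v) h)"
      by (rule class_sum[OF _ inv_A3]) (simp_all add: cG A3_set_sperms)
    ultimately show ?thesis by (simp add: f_id g_id)
  qed
  have sum_B2: "(\<Sum>w\<in>carrier G. indicator (B2_set K) w * mat_trace (\<rho> w))
      = N * (2 * (l2 * of_nat dl) * of_nat dm + of_nat dl * (- 2 * (m2 * of_nat dm)))"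
  proof -
    have "(\<Sum>h | h \<in> sperms I \<times> sperms J \<and> (\<lambda>(u, v). u \<circ> v) h \<in> B2_set K. (\<lambda>(u, v). f u * g v) h)
        = (\<Sum>u\<in>B2_set I. f u) * g id + f id * (\<Sum>v\<in>B2_set J. g v)"
      by (rule sum_product_class[OF fin(1,2) B2_set_sperms B2_set_sperms B2_set_mono B2_set_mono
            id_notin_B2_set id_notin_B2_set]) (use B2_set_split[OF _ _ IJ] in \<open>auto simp: K\<close>)
    moreover have "(\<Sum>u\<in>B2_set I. f u) = 2 * 1 * (l2 * of_nat dl)"
      unfolding f_def by (rule sum_B2_trace[OF fin(1) \<sigma>I l2[folded I_def]])
    moreover have "(\<Sum>v\<in>B2_set J. g v) = 2 * (- 1) * (m2 * of_nat dm)"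
      unfolding g_def by (rule sum_B2_trace[OF fin(2) \<tau>J m2[folded J_def]])
    moreover have "(\<Sum>w\<in>carrier G. indicator (B2_set K) w * mat_trace (\<rho> w))
        = N * (\<Sum>h | h \<in> sperms I \<times> sperms J \<and> (\<lambda>(u, v). u \<circ> v) h \<in> B2_set K. (\<lambda>(u, v). f u * g v) h)"
      by (rule class_sum[OF _ inv_B2]) (simp_all add: cG B2_set_sperms)
    ultimately show ?thesis by (simp add: f_id g_id)
  qed
  have "acts_by_scalar G d \<rho> (Omega (a + b) kl ks) (c0 + kl\<^sup>2 * (l3 + m3) + kl * ks * (l2 - m2))"
  proof (rule central_acts_by_scalar[OF G])
    show "irreducible_rep G d \<rho>" using \<rho> by (simp add: G_def K_def)
    show "Omega (a + b) kl ks (x \<otimes>\<^bsub>G\<^esub> w \<otimes>\<^bsub>G\<^esub> inv\<^bsub>G\<^esub> x) = Omega (a + b) kl ks w"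
      if "x \<in> carrier G" "w \<in> carrier G" for x w
    proof -
      have "indicator {id} (x \<otimes>\<^bsub>G\<^esub> w \<otimes>\<^bsub>G\<^esub> inv\<^bsub>G\<^esub> x) = (indicator {id} w :: complex)"
        by (rule indicator_conj[OF G(1) _ that]) (rule inv_id)
      moreover have "indicator (A3_set K) (x \<otimes>\<^bsub>G\<^esub> w \<otimes>\<^bsub>G\<^esub> inv\<^bsub>G\<^esub> x) = (indicator (A3_set K) w :: complex)"
        by (rule indicator_conj[OF G(1) _ that]) (rule inv_A3)
      moreover have "indicator (B2_set K) (x \<otimes>\<^bsub>G\<^esub> w \<otimes>\<^bsub>G\<^esub> inv\<^bsub>G\<^esub> x) = (indicator (B2_set K) w :: complex)"
        by (rule indicator_conj[OF G(1) _ that]) (rule inv_B2)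
      ultimately show ?thesis unfolding Omega by (simp only:)
    qed
    have "(\<Sum>w\<in>carrier G. Omega (a + b) kl ks w * mat_trace (\<rho> w))
        = c0 * (\<Sum>w\<in>carrier G. indicator {id} w * mat_trace (\<rho> w))
        + (1 / 4) * kl\<^sup>2 * (\<Sum>w\<in>carrier G. indicator (A3_set K) w * mat_trace (\<rho> w))
        + (1 / 2) * kl * ks * (\<Sum>w\<in>carrier G. indicator (B2_set K) w * mat_trace (\<rho> w))"
      unfolding Omega distrib_right sum.distrib sum_distrib_left by (simp only: mult.assoc)
    \<comment> \<open>The four lifts of 3-cycles cancel 1/4 and the two lifts of transpositions
      cancel 1/2, leaving coefficients kl^2 and kl ks.\<close>
    also have "\<dots> = (c0 + kl\<^sup>2 * (l3 + m3) + kl * ks * (l2 - m2)) * of_nat d"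
      unfolding sum_id sum_A3 sum_B2 d by (simp add: field_simps)
    finally show "(\<Sum>w\<in>carrier G. Omega (a + b) kl ks w * mat_trace (\<rho> w))
        = (c0 + kl\<^sup>2 * (l3 + m3) + kl * ks * (l2 - m2)) * of_nat d" .
  qed
  then show ?thesis unfolding c0_def G_def K_def .
qed

theorem lemma4p11:
  fixes n :: nat and kl ks :: complex
  shows
    "Omega n kl ks =
       (\<lambda>w. (1 / 4) * (2 * of_nat n * (of_nat n - 1) * kl\<^sup>2 + of_nat n * ks\<^sup>2) * indicator {id} w
            + (1 / 4) * kl\<^sup>2 * e_A2 n w + (1 / 2) * kl * ks * e_B2 n w)
     \<and>
     (\<forall>a b lam mu dl dm \<sigma> \<tau>.
        a + b = n \<longrightarrow> is_partition lam a \<longrightarrow> is_partition mu b \<longrightarrow>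
        specht_rep {1..a} lam dl \<sigma> \<longrightarrow> specht_rep {a + 1..a + b} mu dm \<tau> \<longrightarrow>
        (\<exists>l3 l2 m3 m2.
           acts_by_scalar (perm_group_on {1..a}) dl \<sigma> (indicator (k_cycles {1..a} 3)) l3 \<and>
           acts_by_scalar (perm_group_on {1..a}) dl \<sigma> (indicator (k_cycles {1..a} 2)) l2 \<and>
           acts_by_scalar (perm_group_on {a + 1..a + b}) dm \<tau> (indicator (k_cycles {a + 1..a + b} 3)) m3 \<and>
           acts_by_scalar (perm_group_on {a + 1..a + b}) dm \<tau> (indicator (k_cycles {a + 1..a + b} 2)) m2 \<and>
           (\<forall>d \<rho>. irreducible_rep (weyl_B {1..n}) d \<rho> \<longrightarrow>
              (\<forall>w\<in>carrier (weyl_B {1..n}). mat_trace (\<rho> w) = bipartition_char a b \<sigma> \<tau> w) \<longrightarrow>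
              acts_by_scalar (weyl_B {1..n}) d \<rho> (Omega n kl ks)
                ((1 / 4) * (2 * of_nat n * (of_nat n - 1) * kl\<^sup>2 + of_nat n * ks\<^sup>2)
                 + kl\<^sup>2 * (l3 + m3) + kl * ks * (l2 - m2))) \<and>
           l3 = - (of_nat a * (of_nat a - 1) / 2) + content_sum 2 lam \<and>
           l2 = content_sum 1 lam \<and>
           m3 = - (of_nat b * (of_nat b - 1) / 2) + content_sum 2 mu \<and>
           m2 = content_sum 1 mu))"
proof (rule conjI[OF Omega_eq], intro allI impI, goal_cases)
  case (1 a b lam mu dl dm \<sigma> \<tau>)
  note l = specht_k_cycles[OF finite_atLeastAtMost 1(2,4)]
  note m = specht_k_cycles[OF finite_atLeastAtMost 1(3,5)]
  have "matrix_rep (perm_group_on {1..a}) dl \<sigma>" "matrix_rep (perm_group_on {a + 1..a + b}) dm \<tau>"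
    using 1(4,5) by (simp_all add: specht_rep_def)
  note scalar = Omega_acts_by_scalar[OF this l m, unfolded 1(1)]
  show ?case
    \<comment> \<open>The four scalars are instantiated by unification with the content formulas of
      \<open>specht_k_cycles\<close>, so the closing equations become reflexive.\<close>
    by (intro exI, rule conjI, rule l(1), rule conjI, rule l(2), rule conjI, rule m(1), rule conjI, rule m(2),
        rule conjI, intro allI impI, rule scalar, assumption, blast, intro conjI refl)
qed

end
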